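(* For any constant $\alpha_0<1$, there exists a constant $\varepsilon_0>0$ such that the following holds. Let $N\le 2^{\alpha_0 n}$ be a given parameter. Any two-sided, adaptive algorithm (with access to $\mathrm{MQ}(f)$ and $\mathrm{Samp}(f)$) for testing whether an unknown function $f:\{0,1\}^n\to\{0,1\}$ with $|f^{-1}(1)|=\Theta(N)$ is monotone or has relative distance at least $\varepsilon_0$ from every monotone function must make $\tilde{\Omega}((\log N)^{2/3})$ queries.
   Context: For $f,g:\{0,1\}^n\to\{0,1\}$, $\mathrm{rel\text{-}dist}(f,g)=|f^{-1}(1)\triangle g^{-1}(1)|/|f^{-1}(1)|$; the relative distance of $f$ from a class is the minimum over functions in the class. $\mathrm{MQ}(f)$ returns $f(x)$ on query $x$; $\mathrm{Samp}(f)$ returns an independent uniformly random element of $f^{-1}(1)$. A testing algorithm must accept monotone $f$ with probability at least $2/3$ and reject $f$ at relative distance at least $\varepsilon_0$ from monotone with probability at least $2/3$ (two-sided error allowed). Queries count calls to both oracles. A function is monotone if $x\preceq y$ coordinatewise implies $f(x)\le f(y)$. *)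

theory Defs
  imports "HOL-Probability.Probability"
begin

(* Points are extensional functions on {..<n}, so the pointwise order on functions is
   exactly the coordinatewise order and mono_on applies as it stands. *)
type_synonym point = "nat \<Rightarrow> bool"

definition cube :: "nat \<Rightarrow> point set" where
  "cube n = {..<n} \<rightarrow>\<^sub>E UNIV"

(* Also extensional: outside the cube a function carries no information, so a membership
   query at such a point is merely a wasted query. *)
definition boolean_functions :: "nat \<Rightarrow> (point \<Rightarrow> bool) set" where
  "boolean_functions n = cube n \<rightarrow>\<^sub>E UNIV"

definition ones :: "nat \<Rightarrow> (point \<Rightarrow> bool) \<Rightarrow> point set" where
  "ones n f = {x \<in> cube n. f x}"

definition monotone_functions :: "nat \<Rightarrow> (point \<Rightarrow> bool) set" where
  "monotone_functions n = {f \<in> boolean_functions n. mono_on (cube n) f}"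

definition rel_dist :: "nat \<Rightarrow> (point \<Rightarrow> bool) \<Rightarrow> (point \<Rightarrow> bool) \<Rightarrow> real" where
  "rel_dist n f g = real (card (sym_diff (ones n f) (ones n g))) / real (card (ones n f))"

definition rel_dist_class :: "nat \<Rightarrow> (point \<Rightarrow> bool) \<Rightarrow> (point \<Rightarrow> bool) set \<Rightarrow> real" where
  "rel_dist_class n f \<C> = Min (rel_dist n f ` \<C>)"

(* Deterministic adaptive algorithm: the next step depends on all answers received so far. *)
datatype decision_tree =
    Output bool
  | MQ point "bool \<Rightarrow> decision_tree"
  | Samp "point \<Rightarrow> decision_tree"

(* Randomized algorithm: the internal coins are drawn at the start. *)
type_synonym algorithm = "decision_tree pmf"

(* Joint distribution of the verdict (True = accept) and the number of oracle calls. Each Samp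
   node draws a fresh sample; pmf_of_set is meaningful only when ones n f is nonempty. *)
primrec run_tree :: "nat \<Rightarrow> (point \<Rightarrow> bool) \<Rightarrow> decision_tree \<Rightarrow> (bool \<times> nat) pmf" where
  "run_tree n f (Output b) = return_pmf (b, 0)"
| "run_tree n f (MQ x T) = map_pmf (apsnd Suc) (run_tree n f (T (f x)))"
| "run_tree n f (Samp T) =
     map_pmf (apsnd Suc) (bind_pmf (pmf_of_set (ones n f)) (\<lambda>x. run_tree n f (T x)))"

definition run :: "nat \<Rightarrow> (point \<Rightarrow> bool) \<Rightarrow> algorithm \<Rightarrow> (bool \<times> nat) pmf" where
  "run n f A = bind_pmf A (run_tree n f)"

definition accept_prob :: "nat \<Rightarrow> (point \<Rightarrow> bool) \<Rightarrow> algorithm \<Rightarrow> real" where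
  "accept_prob n f A = measure_pmf.prob (run n f A) {(b, q). b}"

definition reject_prob :: "nat \<Rightarrow> (point \<Rightarrow> bool) \<Rightarrow> algorithm \<Rightarrow> real" where
  "reject_prob n f A = measure_pmf.prob (run n f A) {(b, q). \<not> b}"

definition functions_of_size :: "nat \<Rightarrow> real \<Rightarrow> real \<Rightarrow> (point \<Rightarrow> bool) set" where
  "functions_of_size n a b =
     {f \<in> boolean_functions n. a \<le> real (card (ones n f)) \<and> real (card (ones n f)) \<le> b}"

definition far_from_monotone :: "nat \<Rightarrow> real \<Rightarrow> (point \<Rightarrow> bool) set" where
  "far_from_monotone n \<epsilon> =
     {f \<in> boolean_functions n. \<epsilon> \<le> rel_dist_class n f (monotone_functions n)}"

(* Two-sided error; the guarantee is only required for functions in the class F. *)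
definition monotonicity_tester ::
    "nat \<Rightarrow> (point \<Rightarrow> bool) set \<Rightarrow> real \<Rightarrow> algorithm \<Rightarrow> bool" where
  "monotonicity_tester n F \<epsilon> A \<longleftrightarrow>
     (\<forall>f \<in> F \<inter> monotone_functions n. accept_prob n f A \<ge> 2 / 3) \<and>
     (\<forall>f \<in> F \<inter> far_from_monotone n \<epsilon>. reject_prob n f A \<ge> 2 / 3)"

(* Worst-case query count: on some admissible input (in F, and monotone or far) some run of
   positive probability makes at least t oracle calls. *)
definition makes_queries ::
    "nat \<Rightarrow> (point \<Rightarrow> bool) set \<Rightarrow> real \<Rightarrow> algorithm \<Rightarrow> real \<Rightarrow> bool" where
  "makes_queries n F \<epsilon> A t \<longleftrightarrow>
     (\<exists>f \<in> F \<inter> (monotone_functions n \<union> far_from_monotone n \<epsilon>).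
        \<exists>(b, q) \<in> set_pmf (run n f A). t \<le> real q)"

end

theory Submission
  imports Defs "HOL-Real_Asymp.Real_Asymp"
begin

text \<open>
The hard functions live on two adjacent layers \<open>4s\<close>, \<open>4s + 1\<close> of a \<open>6s\<close>-dimensional cube: they
are 0 below and 1 above, and the sizes of the layers above \<open>4s\<close> decrease geometrically, so
everything that matters has constant relative weight. About \<open>(3/2)^s\<close> random terms \<open>T i\<close> and
\<open>3^s\<close> random clauses \<open>C j\<close> of \<open>s\<close> variables cut the two layers into cells: \<open>x\<close> lies in
cell \<open>(i, j)\<close> if \<open>T i\<close> is the only satisfied term and \<open>C j\<close> the only falsified clause. Each cell
carries a secret coordinate; the function is the corresponding dictator there in the monotone
case, and the antidictator in the other case, where a constant fraction of the points of layer
\<open>4s\<close> then has a violated edge in the secret direction, and these edges form a matching.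

A tester can only tell the two cases apart by finding two points of one cell that differ in its
secret coordinate. After \<open>p\<close> queries satisfying \<open>T i\<close>, all but \<open>O(p log s)\<close> of the \<open>4s\<close> ones
common to these points are still there, by a union bound over the positions of the \<open>p\<close> successes
among all queries; the same holds for zeros and \<open>C j\<close>. As all points have nearly the same weight,
this bounds the coordinates on which the points queried in cell \<open>(i, j)\<close> disagree both by
\<open>O((p\<^sub>i + p\<^sub>j) log s)\<close> and by \<open>O(p\<^sub>i\<^sub>j min(p\<^sub>i, p\<^sub>j) log s)\<close>. The geometric mean of the two bounds is
summed with the Cauchy-Schwarz inequality to \<open>O(Q^(3/2) log s)\<close> for \<open>Q\<close> queries in total, which is
\<open>o(s)\<close> unless \<open>Q\<close> is about \<open>s^(2/3)\<close>.

Samples are replaced by membership queries through rejection sampling. A random antidictator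
instance is far from monotone only with some constant probability, so the tester is amplified
first. Fixing some of the remaining coordinates to 1 and leaving \<open>e\<close> of them free adjusts the
number of ones to \<open>N\<close>; \<open>\<alpha>\<^sub>0 < 1\<close> leaves room for \<open>6s = \<Theta>(log N)\<close> coordinates.
\<close>

section \<open>Averages over finite product sets\<close>

definition avg :: "'a set \<Rightarrow> ('a \<Rightarrow> real) \<Rightarrow> real" where
  "avg A g = (\<Sum>x\<in>A. g x) / real (card A)"

lemma avg_mono: "(\<And>x. x \<in> A \<Longrightarrow> f x \<le> g x) \<Longrightarrow> avg A f \<le> avg A g"
  unfolding avg_def by (intro divide_right_mono sum_mono) auto

lemma avg_cong: "(\<And>x. x \<in> A \<Longrightarrow> f x = g x) \<Longrightarrow> avg A f = avg A g"
  unfolding avg_def by simp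

lemma avg_nonneg: "(\<And>x. x \<in> A \<Longrightarrow> 0 \<le> f x) \<Longrightarrow> 0 \<le> avg A f"
  unfolding avg_def by (intro divide_nonneg_nonneg sum_nonneg) auto

lemma avg_const: "finite A \<Longrightarrow> A \<noteq> {} \<Longrightarrow> avg A (\<lambda>_. c) = c"
  unfolding avg_def by simp

lemma avg_le_const:
  "finite A \<Longrightarrow> A \<noteq> {} \<Longrightarrow> (\<And>x. x \<in> A \<Longrightarrow> f x \<le> c) \<Longrightarrow> avg A f \<le> c"
  using avg_mono[of A f "\<lambda>_. c"] by (simp add: avg_const)

lemma avg_add: "avg A (\<lambda>x. f x + g x) = avg A f + avg A g"
  unfolding avg_def by (simp add: sum.distrib add_divide_distrib)

lemma avg_diff: "avg A (\<lambda>x. f x - g x) = avg A f - avg A g"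
  unfolding avg_def by (simp add: sum_subtractf diff_divide_distrib)

lemma avg_cmult: "avg A (\<lambda>x. c * f x) = c * avg A f"
  unfolding avg_def by (simp add: sum_distrib_left)

lemma avg_multc: "avg A (\<lambda>x. f x * c) = avg A f * c"
  unfolding avg_def by (simp add: sum_distrib_right)

lemma avg_sum: "avg A (\<lambda>x. \<Sum>i\<in>I. g i x) = (\<Sum>i\<in>I. avg A (g i))"
  unfolding avg_def by (subst sum.swap) (simp add: sum_divide_distrib)

lemma avg_swap: "avg A (\<lambda>x. avg B (g x)) = avg B (\<lambda>y. avg A (\<lambda>x. g x y))"
  unfolding avg_def by (simp add: sum_divide_distrib sum.swap[of _ B A] mult.commute)

lemma avg_of_bool: "finite A \<Longrightarrow> avg A (\<lambda>x. of_bool (P x)) = real (card {x \<in> A. P x}) / real (card A)"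
  unfolding avg_def by (simp add: of_bool_def sum.If_cases Int_def)

lemma avg_PiE_upd:
  assumes "finite I" "i \<in> I"
  shows "avg (PiE I S) g = avg (PiE (I - {i}) S) (\<lambda>h. avg (S i) (\<lambda>v. g (h(i := v))))"
proof -
  have I: "I = insert i (I - {i})" using assms by auto
  have "(\<Sum>h\<in>PiE I S. g h) = (\<Sum>(v, h)\<in>S i \<times> PiE (I - {i}) S. g (h(i := v)))"
    using inj_combinator[of i "I - {i}" S]
    by (subst I, subst PiE_insert_eq, subst sum.reindex) (auto intro!: sum.cong simp: case_prod_unfold)
  also have "\<dots> = (\<Sum>h\<in>PiE (I - {i}) S. \<Sum>v\<in>S i. g (h(i := v)))"
    by (subst sum.swap) (simp add: sum.cartesian_product)
  finally have *: "(\<Sum>h\<in>PiE I S. g h) = (\<Sum>h\<in>PiE (I - {i}) S. \<Sum>v\<in>S i. g (h(i := v)))" .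
  have "card (PiE I S) = card (PiE (I - {i}) S) * card (S i)"
    using assms by (simp add: card_PiE prod.remove[of I i] mult.commute)
  then show ?thesis
    unfolding avg_def * by (simp add: sum_divide_distrib mult.commute)
qed

lemma avg_PiE_prod:
  assumes "finite I" "\<And>i. i \<in> I \<Longrightarrow> finite (S i)"
  shows "avg (PiE I S) (\<lambda>h. \<Prod>i\<in>I. g i (h i)) = (\<Prod>i\<in>I. avg (S i) (g i))"
  unfolding avg_def using assms
  by (simp add: prod_sum_PiE[symmetric] card_PiE prod_dividef)

lemma of_bool_Ball: "finite J \<Longrightarrow> (of_bool (\<forall>c\<in>J. P c) :: real) = (\<Prod>c\<in>J. of_bool (P c))"
  by (induction J rule: finite_induct) auto

text \<open>Independence of the coordinates: those outside \<open>J\<close> contribute a factor 1,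
  which is where nonemptiness of the sets \<open>S i\<close> enters.\<close>

lemma avg_PiE_cylinder:
  assumes "finite I" "\<And>i. i \<in> I \<Longrightarrow> finite (S i)" "\<And>i. i \<in> I \<Longrightarrow> S i \<noteq> {}" "J \<subseteq> I"
  shows "avg (PiE I S) (\<lambda>h. of_bool (\<forall>i\<in>J. P i (h i))) = (\<Prod>i\<in>J. avg (S i) (\<lambda>v. of_bool (P i v)))"
proof -
  have fJ: "finite J" using assms finite_subset by blast
  have "avg (PiE I S) (\<lambda>h. of_bool (\<forall>i\<in>J. P i (h i)))
    = avg (PiE I S) (\<lambda>h. \<Prod>i\<in>I. if i \<in> J then of_bool (P i (h i)) else 1)"
    using assms fJ by (intro avg_cong) (simp add: of_bool_Ball prod.If_cases Int_absorb1)
  also have "\<dots> = (\<Prod>i\<in>I. avg (S i) (\<lambda>v. if i \<in> J then of_bool (P i v) else 1))"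
    using assms by (intro avg_PiE_prod[where g = "\<lambda>i v. if i \<in> J then of_bool (P i v) else 1"]) auto
  also have "\<dots> = (\<Prod>i\<in>I. if i \<in> J then avg (S i) (\<lambda>v. of_bool (P i v)) else 1)"
    using assms by (intro prod.cong) (auto simp: avg_const)
  also have "\<dots> = (\<Prod>i\<in>J. avg (S i) (\<lambda>v. of_bool (P i v)))"
    using assms by (simp add: prod.If_cases Int_absorb1)
  finally show ?thesis .
qed

text \<open>Weierstrass' product inequality, for deviations whose sum may exceed 1.\<close>

lemma prod_ge_one_minus_sum:
  fixes r \<delta> :: "'a \<Rightarrow> real"
  assumes "finite A" "\<And>c. c \<in> A \<Longrightarrow> 0 \<le> \<delta> c" "\<And>c. c \<in> A \<Longrightarrow> 0 \<le> r c" "\<And>c. c \<in> A \<Longrightarrow> 1 - \<delta> c \<le> r c"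
  shows "1 - sum \<delta> A \<le> prod r A"
  using assms
proof (induction A rule: finite_induct)
  case (insert a A)
  have IH: "1 - sum \<delta> A \<le> prod r A" and P: "0 \<le> prod r A" and S: "0 \<le> sum \<delta> A"
    and a: "0 \<le> \<delta> a" "0 \<le> r a" "1 - \<delta> a \<le> r a"
    using insert by (auto intro: prod_nonneg sum_nonneg)
  have "1 - (\<delta> a + sum \<delta> A) \<le> r a * prod r A"
  \<comment> \<open>A total deviation of at least 1 makes the left side nonpositive; below 1 both
    factors on the left are nonnegative and can be multiplied.\<close>
  proof (cases "\<delta> a + sum \<delta> A \<ge> 1")
    case True
    then show ?thesis using mult_nonneg_nonneg[OF a(2) P] by linarith
  next
    case False
    have "(1 - \<delta> a) * (1 - sum \<delta> A) \<le> r a * prod r A"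
      using False IH P S a by (intro mult_mono) auto
    moreover have "1 - (\<delta> a + sum \<delta> A) \<le> (1 - \<delta> a) * (1 - sum \<delta> A)"
      using mult_nonneg_nonneg[OF a(1) S] by (simp add: algebra_simps)
    ultimately show ?thesis by linarith
  qed
  then show ?case using insert by simp
qed auto

section \<open>Trees of membership queries\<close>

text \<open>The value at a \<open>Samp\<close> node is a placeholder: trees are evaluated after the
  samples have been replaced by membership queries.\<close>

primrec eval_tree :: "decision_tree \<Rightarrow> (point \<Rightarrow> bool) \<Rightarrow> bool" where
  "eval_tree (Output b) a = b"
| "eval_tree (MQ x T) a = eval_tree (T (a x)) a"
| "eval_tree (Samp T) a = False"

primrec queried :: "decision_tree \<Rightarrow> (point \<Rightarrow> bool) \<Rightarrow> point list" where
  "queried (Output b) a = []"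
| "queried (MQ x T) a = x # queried (T (a x)) a"
| "queried (Samp T) a = []"

primrec mq_only :: "decision_tree \<Rightarrow> nat \<Rightarrow> bool" where
  "mq_only (Output b) d = True"
| "mq_only (MQ x T) d = (0 < d \<and> (\<forall>r. mq_only (T r) (d - 1)))"
| "mq_only (Samp T) d = False"

lemma mq_only_mono: "mq_only t d \<Longrightarrow> d \<le> d' \<Longrightarrow> mq_only t d'"
proof (induction t arbitrary: d d')
  case (MQ x T)
  have "mq_only (T r) (d' - 1)" for r
    by (rule MQ.IH[of "T r" "d - 1"]) (use MQ.prems in \<open>auto intro: diff_le_mono\<close>)
  then show ?case using MQ.prems by simp
qed auto

lemma length_queried: "mq_only t d \<Longrightarrow> length (queried t a) \<le> d"
proof (induction t arbitrary: d)
  case (MQ x T)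
  have "length (queried (T (a x)) a) \<le> d - 1" using MQ by auto
  moreover have "0 < d" using MQ.prems by simp
  ultimately show ?case by simp
qed auto

lemma queried_agree:
  assumes "\<And>x. x \<in> set (queried t a) \<Longrightarrow> a' x = a x"
  shows "queried t a' = queried t a" and "eval_tree t a' = eval_tree t a"
proof -
  have "queried t a' = queried t a \<and> eval_tree t a' = eval_tree t a"
    using assms by (induction t) auto
  then show "queried t a' = queried t a" and "eval_tree t a' = eval_tree t a" by auto
qed

text \<open>
A query reveals whether the hidden set \<open>\<tau> ` {..<s}\<close> is contained in \<open>V x\<close>. Negative answers are
counted as free: a tree with \<open>d\<close> queries has only \<open>d choose p\<close> patterns with \<open>p\<close> hits, each
contributing \<open>\<epsilon> ^ p\<close>, whence \<open>(1 + \<epsilon>) ^ d\<close>. \<open>A\<close> and \<open>p\<close> describe the hits of the past.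
\<close>
lemma card_bad_hidden_set:
  fixes V :: "point \<Rightarrow> nat set" and R :: "point \<Rightarrow> bool" and F :: "point \<Rightarrow> bool \<Rightarrow> bool" and \<epsilon> :: real
    and m s k w :: nat
  defines "U \<equiv> PiE {..<s} (\<lambda>_. {..<m})"
  defines "hit \<equiv> \<lambda>\<tau> x. \<tau> ` {..<s} \<subseteq> V x"
  defines "hits \<equiv> \<lambda>t \<tau>. filter (\<lambda>x. R x \<and> hit \<tau> x) (queried t (\<lambda>x. F x (hit \<tau> x)))"
  assumes "mq_only t d" "A \<subseteq> {..<m}"
    and F: "\<And>x. \<not> R x \<Longrightarrow> F x True = F x False"
    and \<epsilon>: "0 \<le> \<epsilon>" and base: "\<And>a p. a + p * w < k \<Longrightarrow> real a ^ s \<le> real k ^ s * \<epsilon> ^ p"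
  shows "real (card {\<tau> \<in> U. \<tau> ` {..<s} \<subseteq> A \<and>
      card (A \<inter> (\<Inter>x\<in>set (hits t \<tau>). V x)) + (p + length (hits t \<tau>)) * w < k})
    \<le> real k ^ s * \<epsilon> ^ p * ((1 + \<epsilon>) ^ d - of_bool (k \<le> card A + p * w))"
  (is "real (card (?B t A p)) \<le> ?rhs d A p")
  using assms(4,5)
proof (induction t arbitrary: d A p)
  have one: "1 \<le> (1 + \<epsilon>) ^ d" for d using \<epsilon> by simp
  case (Output b)
  show ?case
  proof (cases "k \<le> card A + p * w")
    case True
    \<comment> \<open>Without further hits nothing is bad while
      \<open>k \<le> card A + p * w\<close>. The subtracted indicator records this saving; it turns
      the final bound into \<open>(1 + \<epsilon>) ^ d - 1\<close>, which is small for small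
      \<epsilon>.\<close>
    then have B: "?B (Output b) A p = {}" unfolding hits_def by auto
    show ?thesis unfolding B using True one[of d] \<epsilon> by simp
  next
    case False
    have "?B (Output b) A p \<subseteq> PiE {..<s} (\<lambda>_. A)"
      unfolding U_def by (auto simp: PiE_iff extensional_def)
    moreover have fA: "finite A" using Output finite_subset by blast
    ultimately have "card (?B (Output b) A p) \<le> card (PiE {..<s} (\<lambda>_. A))"
      by (intro card_mono[OF finite_PiE]) simp_all
    also have "\<dots> = card A ^ s" by (simp add: card_PiE)
    finally have "real (card (?B (Output b) A p)) \<le> real (card A ^ s)"
      unfolding of_nat_le_iff .
    also have "\<dots> = real (card A) ^ s" by simp
    also have "\<dots> \<le> real k ^ s * \<epsilon> ^ p" using base[of "card A" p] False by simp
    also have "\<dots> \<le> ?rhs d A p"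
      using False mult_left_mono[OF one[of d], of "real k ^ s * \<epsilon> ^ p"] \<epsilon> by simp
    finally show ?thesis .
  qed
next
  case (MQ y T)
  have finU: "finite U" unfolding U_def by (intro finite_PiE) auto
  obtain e where d: "d = Suc e" and T: "\<And>r. mq_only (T r) e"
    using MQ.prems(1) by (cases d) auto
  show ?case
  proof (cases "R y")
    case True
    \<comment> \<open>A hit replaces \<open>A\<close> by \<open>A \<inter> V y\<close> and increases
      \<open>p\<close>; a miss merely discards information, so \<open>A\<close> and \<open>p\<close>
      stay as they are.\<close>
    have sub: "?B (MQ y T) A p \<subseteq> ?B (T (F y True)) (A \<inter> V y) (Suc p) \<union> ?B (T (F y False)) A p"
    proof
      fix \<tau> assume \<tau>: "\<tau> \<in> ?B (MQ y T) A p"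
      show "\<tau> \<in> ?B (T (F y True)) (A \<inter> V y) (Suc p) \<union> ?B (T (F y False)) A p"
      proof (cases "hit \<tau> y")
        case h: True
        then have "hits (MQ y T) \<tau> = y # hits (T (F y True)) \<tau>"
          using True unfolding hits_def by simp
        then show ?thesis using \<tau> h unfolding hit_def by (auto simp: Int_assoc)
      next
        case h: False
        then have "hits (MQ y T) \<tau> = hits (T (F y False)) \<tau>" unfolding hits_def by simp
        then show ?thesis using \<tau> by auto
      qed
    qed
    have "real (card (?B (MQ y T) A p))
        \<le> real (card (?B (T (F y True)) (A \<inter> V y) (Suc p)) + card (?B (T (F y False)) A p))"
      unfolding of_nat_le_iff
      by (rule order_trans[OF card_mono[OF _ sub] card_Un_le]) (use finU in auto)
    also have "\<dots> \<le> ?rhs e (A \<inter> V y) (Suc p) + ?rhs e A p"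
      unfolding of_nat_add
      by (intro add_mono MQ.IH T) (use MQ.prems in auto)
    \<comment> \<open>The indicator is dropped in the branch of the hit and kept in that of the
      miss; the weights \<epsilon> and 1 of the branches add up to one more factor
      \<open>1 + \<epsilon>\<close>.\<close>
    also have "\<dots> \<le> real k ^ s * \<epsilon> ^ Suc p * (1 + \<epsilon>) ^ e + ?rhs e A p"
      using \<epsilon> by (intro add_mono mult_left_mono) auto
    also have "\<dots> = ?rhs d A p" unfolding d by (simp add: algebra_simps)
    finally show ?thesis .
  next
    case False
    \<comment> \<open>Both values of \<open>hit\<close> give the same answer, so there is only one
      branch and no hit is recorded.\<close>
    have "hits (MQ y T) \<tau> = hits (T (F y True)) \<tau>" for \<tau>
      using False F[OF False] unfolding hits_def by (cases "hit \<tau> y") auto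
    then have "real (card (?B (MQ y T) A p)) \<le> ?rhs e A p"
      using MQ.IH[of "T (F y True)" e A p] T MQ.prems(2) by simp
    also have "\<dots> \<le> ?rhs d A p"
      unfolding d using \<epsilon> by (intro mult_left_mono diff_mono power_increasing) auto
    finally show ?thesis .
  qed
next
  case (Samp T)
  then show ?case by simp
qed

section \<open>Cell answers and comparison with the ideal process\<close>

definition answers :: "('p \<Rightarrow> 'c option) \<Rightarrow> ('p \<Rightarrow> bool) \<Rightarrow> ('k \<Rightarrow> 'p \<Rightarrow> bool) \<Rightarrow> ('c \<Rightarrow> 'k) \<Rightarrow> 'p \<Rightarrow> bool" where
  "answers cell dflt h \<kappa> x = (case cell x of None \<Rightarrow> dflt x | Some c \<Rightarrow> h (\<kappa> c) x)"

abbreviation ideal_answers :: "('p \<Rightarrow> 'c option) \<Rightarrow> ('p \<Rightarrow> bool) \<Rightarrow> ('c \<Rightarrow> nat) \<Rightarrow> 'p \<Rightarrow> bool" where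
  "ideal_answers cell dflt \<equiv> answers cell dflt (\<lambda>b _. b = 0)"

definition touched :: "('p \<Rightarrow> 'c option) \<Rightarrow> 'p list \<Rightarrow> 'c set" where
  "touched cell xs = {c. \<exists>x\<in>set xs. cell x = Some c}"

lemma finite_touched: "finite (touched cell xs)"
proof -
  have "touched cell xs \<subseteq> the ` cell ` set xs"
    unfolding touched_def by (force simp: image_iff)
  then show ?thesis by (rule finite_subset) auto
qed

text \<open>
In the ideal process each cell answers with one bit, which is true with probability \<open>1/3\<close>
(\<open>\<beta> c = 0\<close> for \<open>\<beta> c < 3\<close>). Both sides count pairs of \<open>\<beta>\<close> and \<open>\<kappa>\<close> whose answers agree along the
queries of \<open>\<beta>\<close>: all \<open>\<beta>\<close> that agree with a given \<open>\<kappa>\<close> share their queries and their bits on the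
touched cells.
\<close>
lemma ideal_domination:
  fixes t :: decision_tree and cell :: "point \<Rightarrow> 'c option" and dflt :: "point \<Rightarrow> bool" and h :: "'k \<Rightarrow> point \<Rightarrow> bool"
    and K :: "'k set"
  defines "a0 \<equiv> ideal_answers cell dflt"
  defines "r \<equiv> \<lambda>\<beta> c. avg K (\<lambda>k. of_bool (\<forall>x\<in>set (queried t (a0 \<beta>)). cell x = Some c \<longrightarrow> h k x = (\<beta> c = 0)))
      / (if \<beta> c = 0 then 1 / 3 else 2 / 3)"
  assumes Cs: "finite Cs" "\<And>x c. cell x = Some c \<Longrightarrow> c \<in> Cs" and K: "finite K" "K \<noteq> {}"
  shows "avg (PiE Cs (\<lambda>_. {..<3})) (\<lambda>\<beta>. of_bool (eval_tree t (a0 \<beta>) = v) * (\<Prod>c\<in>touched cell (queried t (a0 \<beta>)). r \<beta> c))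
    \<le> avg (PiE Cs (\<lambda>_. K)) (\<lambda>\<kappa>. of_bool (eval_tree t (answers cell dflt h \<kappa>) = v))"
proof -
  define a where "a = answers cell dflt h"
  define J where "J = (\<lambda>\<beta>. touched cell (queried t (a0 \<beta>)))"
  define E where "E = (\<lambda>\<beta> \<kappa>. \<forall>x\<in>set (queried t (a0 \<beta>)). a \<kappa> x = a0 \<beta> x)"
  define N where "N = (\<lambda>\<beta>. \<Prod>c\<in>J \<beta>. if \<beta> c = (0::nat) then 1 / 3 else 2 / 3 :: real)"
  define B where "B = PiE Cs (\<lambda>_. {..<3::nat})"
  have JC: "J \<beta> \<subseteq> Cs" for \<beta> unfolding J_def touched_def using Cs by auto
  have N0: "0 < N \<beta>" for \<beta> unfolding N_def by (intro prod_pos) auto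
  \<comment> \<open>Cells have independent keys, so the product of the ratios is the probability
    that \<kappa> agrees with \<beta> along the queries of \<beta>, divided by the ideal probability
    \<open>N \<beta>\<close> of the bits seen.\<close>
  have "(\<Prod>c\<in>J \<beta>. r \<beta> c) = avg (PiE Cs (\<lambda>_. K)) (\<lambda>\<kappa>. of_bool (E \<beta> \<kappa>)) / N \<beta>" for \<beta>
  proof -
    have "E \<beta> \<kappa> \<longleftrightarrow> (\<forall>c\<in>J \<beta>. \<forall>x\<in>set (queried t (a0 \<beta>)). cell x = Some c \<longrightarrow> h (\<kappa> c) x = (\<beta> c = 0))" for \<kappa>
      unfolding E_def J_def touched_def a_def a0_def answers_def by (force split: option.splits)
    then show ?thesis
      using avg_PiE_cylinder[of Cs "\<lambda>_. K" "J \<beta>" "\<lambda>c k. \<forall>x\<in>set (queried t (a0 \<beta>)). cell x = Some c \<longrightarrow> h k x = (\<beta> c = 0)"]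
        Cs K JC[of \<beta>] unfolding r_def N_def by (simp add: prod_dividef)
  qed
  then have "avg B (\<lambda>\<beta>. of_bool (eval_tree t (a0 \<beta>) = v) * (\<Prod>c\<in>J \<beta>. r \<beta> c))
    = avg B (\<lambda>\<beta>. avg (PiE Cs (\<lambda>_. K)) (\<lambda>\<kappa>. of_bool (eval_tree t (a0 \<beta>) = v) * of_bool (E \<beta> \<kappa>) / N \<beta>))"
    by (simp add: avg_cmult avg_multc divide_inverse mult.assoc)
  also have "\<dots> = avg (PiE Cs (\<lambda>_. K)) (\<lambda>\<kappa>. avg B (\<lambda>\<beta>. of_bool (eval_tree t (a0 \<beta>) = v) * of_bool (E \<beta> \<kappa>) / N \<beta>))"
    by (rule avg_swap)
  also have "\<dots> \<le> avg (PiE Cs (\<lambda>_. K)) (\<lambda>\<kappa>. of_bool (eval_tree t (a \<kappa>) = v))"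
  proof (rule avg_mono)
    fix \<kappa>
    show "avg B (\<lambda>\<beta>. of_bool (eval_tree t (a0 \<beta>) = v) * of_bool (E \<beta> \<kappa>) / N \<beta>) \<le> of_bool (eval_tree t (a \<kappa>) = v)"
    proof (cases "\<exists>\<beta>\<in>B. E \<beta> \<kappa>")
      case False
      then show ?thesis by (simp add: avg_def)
    next
      case True
      then obtain \<beta>0 where \<beta>0: "\<beta>0 \<in> B" "E \<beta>0 \<kappa>" by auto
      \<comment> \<open>Every \<beta> that agrees with \<kappa> follows the path of
        \<open>\<beta>0\<close>, so it shares the verdict, the touched cells, the bits there and the
        weight \<open>N\<close>. The probability of these bits is \<open>N \<beta>0\<close>, which
        will cancel the denominator.\<close>
      have EJ: "of_bool (eval_tree t (a0 \<beta>) = v) * of_bool (E \<beta> \<kappa>) / N \<beta>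
          \<le> of_bool (eval_tree t (a \<kappa>) = v) / N \<beta>0 * of_bool (\<forall>c\<in>J \<beta>0. (\<beta> c = 0) = (\<beta>0 c = 0))" for \<beta>
      proof (cases "E \<beta> \<kappa>")
        case True
        have p: "queried t (a \<kappa>) = queried t (a0 \<beta>)" "eval_tree t (a \<kappa>) = eval_tree t (a0 \<beta>)"
          using queried_agree[of t "a0 \<beta>" "a \<kappa>"] True unfolding E_def by auto
        have p0: "queried t (a \<kappa>) = queried t (a0 \<beta>0)"
          using queried_agree[of t "a0 \<beta>0" "a \<kappa>"] \<beta>0(2) unfolding E_def by auto
        have J: "J \<beta> = J \<beta>0" unfolding J_def using p p0 by simp
        have bits: "(\<beta> c = 0) = (\<beta>0 c = 0)" if c: "c \<in> J \<beta>0" for c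
        proof -
          obtain x where x: "x \<in> set (queried t (a \<kappa>))" "cell x = Some c"
            using c unfolding p0 J_def touched_def by auto
          have "a0 \<beta> x = a \<kappa> x" "a0 \<beta>0 x = a \<kappa> x"
            using True \<beta>0(2) x(1) p(1) p0 unfolding E_def by auto
          then show ?thesis unfolding a0_def answers_def using x(2) by simp
        qed
        then have "N \<beta> = N \<beta>0" unfolding N_def J by (intro prod.cong) auto
        then show ?thesis using True bits p(2) by simp
      next
        case False
        then show ?thesis using N0[of \<beta>0] by (simp add: less_imp_le)
      qed
      have "avg B (\<lambda>\<beta>. of_bool (eval_tree t (a0 \<beta>) = v) * of_bool (E \<beta> \<kappa>) / N \<beta>)
        \<le> of_bool (eval_tree t (a \<kappa>) = v) / N \<beta>0 * avg B (\<lambda>\<beta>. of_bool (\<forall>c\<in>J \<beta>0. (\<beta> c = 0) = (\<beta>0 c = 0)))"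
        unfolding avg_cmult[symmetric] by (intro avg_mono EJ)
      also have "avg B (\<lambda>\<beta>. of_bool (\<forall>c\<in>J \<beta>0. (\<beta> c = 0) = (\<beta>0 c = 0)))
        = (\<Prod>c\<in>J \<beta>0. avg {..<3} (\<lambda>b::nat. of_bool ((b = 0) = (\<beta>0 c = 0))))"
        unfolding B_def by (intro avg_PiE_cylinder) (use Cs JC in \<open>auto simp: lessThan_empty_iff\<close>)
      also have "\<dots> = N \<beta>0"
      proof -
        have "{..<3::nat} = {0, 1, 2}" by auto
        then show ?thesis unfolding N_def by (intro prod.cong) (auto simp: avg_def)
      qed
      finally show ?thesis using N0[of \<beta>0] by simp
    qed
  qed
  finally show ?thesis unfolding B_def a_def J_def .
qed

section \<open>Eliminating samples, and amplification\<close>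

definition accepts :: "decision_tree pmf \<Rightarrow> (point \<Rightarrow> bool) \<Rightarrow> real" where
  "accepts p f = measure_pmf.prob p {t. eval_tree t f}"

lemma accepts_conv_pmf: "accepts p f = pmf (map_pmf (\<lambda>t. eval_tree t f) p) True"
  unfolding accepts_def pmf_map by (simp add: vimage_def)

lemma accepts_nonneg: "0 \<le> accepts p f" and accepts_le_1: "accepts p f \<le> 1"
  unfolding accepts_def by simp_all

lemma accepts_bind: "accepts (bind_pmf p q) f = (\<integral>x. accepts (q x) f \<partial>measure_pmf p)"
  unfolding accepts_conv_pmf map_bind_pmf pmf_bind ..

lemma accepts_return: "accepts (return_pmf t) f = of_bool (eval_tree t f)"
  unfolding accepts_conv_pmf by simp

text \<open>All coins are drawn before the tree is built, hence continuations are drawn for both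
  outcomes of a trial; only the one taken affects acceptance.\<close>

primrec scan :: "point set \<Rightarrow> (point \<Rightarrow> decision_tree pmf) \<Rightarrow> nat \<Rightarrow> decision_tree pmf" where
  "scan R p 0 = return_pmf (Output False)"
| "scan R p (Suc l) = bind_pmf (pmf_of_set R) (\<lambda>z. bind_pmf (p z) (\<lambda>a. bind_pmf (scan R p l)
     (\<lambda>r. return_pmf (MQ z (\<lambda>b. if b then a else r)))))"

text \<open>Samples become \<open>L\<close> rounds of rejection sampling from \<open>R\<close>; the fuel \<open>d\<close> truncates the tree.\<close>
primrec sim :: "point set \<Rightarrow> nat \<Rightarrow> decision_tree \<Rightarrow> nat \<Rightarrow> decision_tree pmf" where
  "sim R L (Output b) = (\<lambda>d. return_pmf (Output b))"
| "sim R L (MQ x T) = (\<lambda>d. case d of 0 \<Rightarrow> return_pmf (Output False)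
     | Suc e \<Rightarrow> bind_pmf (sim R L (T True) e) (\<lambda>a. bind_pmf (sim R L (T False) e)
         (\<lambda>b. return_pmf (MQ x (\<lambda>r. if r then a else b)))))"
| "sim R L (Samp T) = (\<lambda>d. case d of 0 \<Rightarrow> return_pmf (Output False)
     | Suc e \<Rightarrow> scan R (\<lambda>z. sim R L (T z) e) L)"

lemma accepts_MQ_branch:
  "accepts (bind_pmf p (\<lambda>a. bind_pmf q (\<lambda>b. return_pmf (MQ x (\<lambda>r. if r then a else b))))) f
    = (if f x then accepts p f else accepts q f)"
  unfolding accepts_conv_pmf by (simp add: map_pmf_def bind_return_pmf bind_assoc_pmf)

lemma accepts_scan_Suc:
  assumes "finite R" "R \<noteq> {}"
  shows "accepts (scan R p (Suc l)) f
    = avg R (\<lambda>z. if f z then accepts (p z) f else accepts (scan R p l) f)"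
  using assms by (simp add: accepts_bind[of "pmf_of_set R"] accepts_MQ_branch integral_pmf_of_set avg_def)

text \<open>Given that one of the \<open>l\<close> trials succeeds, the first success is uniform
  among the ones in \<open>R\<close>; if all fail, the tree rejects.\<close>

lemma accepts_scan:
  fixes R :: "point set"
  defines "Ob \<equiv> \<lambda>f. {z \<in> R. f z}"
  assumes R: "finite R" "R \<noteq> {}" and O: "Ob f \<noteq> {}"
  shows "accepts (scan R p l) f
    = (1 - (1 - real (card (Ob f)) / real (card R)) ^ l) * avg (Ob f) (\<lambda>z. accepts (p z) f)"
proof (induction l)
  case 0
  then show ?case by (simp add: accepts_return)
next
  case (Suc l)
  let ?\<alpha> = "real (card (Ob f)) / real (card R)" and ?g = "avg (Ob f) (\<lambda>z. accepts (p z) f)"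
  have f: "finite (Ob f)" unfolding Ob_def using R by auto
  have cR: "card R > 0" "card (Ob f) > 0" using R O f by (auto simp: card_gt_0_iff)
  have "{z \<in> R. \<not> f z} = R - Ob f" unfolding Ob_def by auto
  moreover have "card (R - Ob f) = card R - card (Ob f)" "card (Ob f) \<le> card R"
    unfolding Ob_def using R by (auto intro: card_Diff_subset card_mono)
  ultimately have c: "real (card {z \<in> R. \<not> f z}) = real (card R) - real (card (Ob f))" by simp
  have "accepts (scan R p (Suc l)) f
      = avg R (\<lambda>z. if f z then accepts (p z) f else accepts (scan R p l) f)"
    by (rule accepts_scan_Suc[OF R])
  also have "\<dots> = ((\<Sum>z\<in>Ob f. accepts (p z) f) + real (card {z \<in> R. \<not> f z}) * accepts (scan R p l) f) / real (card R)"
  proof -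
    have "R \<inter> {z. f z} = Ob f" "R \<inter> - {z. f z} = {z \<in> R. \<not> f z}" unfolding Ob_def by auto
    then show ?thesis unfolding avg_def sum.If_cases[OF R(1)] by simp
  qed
  also have "(\<Sum>z\<in>Ob f. accepts (p z) f) = real (card (Ob f)) * ?g"
    unfolding avg_def using cR by simp
  finally have eq: "accepts (scan R p (Suc l)) f
    = (real (card (Ob f)) * ?g + (real (card R) - real (card (Ob f))) * accepts (scan R p l) f) / real (card R)"
    unfolding c .
  have gen: "(O' * g + (R' - O') * ((1 - X) * g)) / R' = (1 - (1 - O' / R') * X) * g"
    if "R' \<noteq> 0" for O' R' g X :: real
  proof -
    have "(O' * g + (R' - O') * ((1 - X) * g)) = R' * ((1 - (1 - O' / R') * X) * g)"
      using that by (simp add: ring_distribs)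
    then show ?thesis using that by simp
  qed
  show ?case
    unfolding eq Suc power_Suc by (rule gen) (use cR in simp)
qed

section \<open>Error and depth of the simulation\<close>

definition tree_accept :: "nat \<Rightarrow> (point \<Rightarrow> bool) \<Rightarrow> decision_tree \<Rightarrow> real" where
  "tree_accept n f t = measure_pmf.prob (run_tree n f t) {(b, q). b}"

lemma accepting_runs_conv_vimage: "{(b, q). b} = (fst -` {True} :: (bool \<times> nat) set)"
  unfolding vimage_def by (rule Collect_cong) (simp add: case_prod_unfold)

lemma tree_accept_conv_pmf: "tree_accept n f t = pmf (map_pmf fst (run_tree n f t)) True"
  unfolding tree_accept_def pmf_map accepting_runs_conv_vimage ..

lemma tree_accept_Output: "tree_accept n f (Output b) = of_bool b"
  unfolding tree_accept_conv_pmf by simp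

lemma tree_accept_MQ: "tree_accept n f (MQ x T) = tree_accept n f (T (f x))"
  unfolding tree_accept_conv_pmf by (simp add: pmf.map_comp o_def apsnd_def map_prod_def case_prod_unfold)

lemma tree_accept_Samp:
  assumes "finite (ones n f)" "ones n f \<noteq> {}"
  shows "tree_accept n f (Samp T) = avg (ones n f) (\<lambda>x. tree_accept n f (T x))"
proof -
  have "map_pmf fst (run_tree n f (Samp T)) = bind_pmf (pmf_of_set (ones n f)) (\<lambda>x. map_pmf fst (run_tree n f (T x)))"
    by (simp add: pmf.map_comp o_def apsnd_def map_prod_def case_prod_unfold map_bind_pmf)
  then show ?thesis
    unfolding tree_accept_conv_pmf using assms by (simp add: pmf_bind integral_pmf_of_set avg_def)
qed

text \<open>A simulated sample goes wrong only if all \<open>L\<close> trials fail, which has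
  probability at most \<open>(1 - \<theta>) ^ L\<close>, and at most \<open>d\<close> samples lie on
  a path.\<close>

lemma sim_error:
  fixes \<theta> :: real
  assumes R: "finite R" "R \<noteq> {}" "R \<subseteq> cube n" "ones n f \<subseteq> R"
    and \<theta>: "0 < \<theta>" "\<theta> * card R \<le> card (ones n f)"
    and "\<And>b q. (b, q) \<in> set_pmf (run_tree n f t) \<Longrightarrow> q \<le> d"
  shows "\<bar>accepts (sim R L t d) f - tree_accept n f t\<bar> \<le> real d * (1 - \<theta>) ^ L"
proof -
  have Oeq: "{z \<in> R. f z} = ones n f" using R unfolding ones_def by auto
  have cR: "real (card R) > 0" using R by (simp add: card_gt_0_iff)
  have fO: "finite (ones n f)" using R finite_subset by blast
  have cO: "card (ones n f) > 0"
    using \<theta> cR by (metis mult_pos_pos less_le_trans of_nat_0_less_iff)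
  then have O: "ones n f \<noteq> {}" by auto
  have \<alpha>: "\<theta> \<le> card (ones n f) / card R" "card (ones n f) / card R \<le> 1"
    using \<theta> cR card_mono[OF R(1,4)] by (auto simp: field_simps)
  have \<theta>1: "0 \<le> 1 - \<theta>" using \<alpha> by simp
  show ?thesis using assms(7)
  proof (induction t arbitrary: d)
    case (Output b)
    then show ?case using \<theta>1 by (simp add: accepts_return tree_accept_Output)
  next
    case (MQ x T)
    \<comment> \<open>The support of a run is never empty and a run through this node costs at least
      one call, so the fuel \<open>d\<close> is positive.\<close>
    obtain b0 q0 where "(b0, q0) \<in> set_pmf (run_tree n f (T (f x)))"
      using set_pmf_not_empty[of "run_tree n f (T (f x))"] by (metis ex_in_conv surj_pair)
    then have "(b0, Suc q0) \<in> set_pmf (run_tree n f (MQ x T))" by force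
    from MQ.prems[OF this] obtain e where d: "d = Suc e" by (cases d) auto
    have "q \<le> e" if "(b, q) \<in> set_pmf (run_tree n f (T (f x)))" for b q
    proof -
      have "(b, Suc q) \<in> set_pmf (run_tree n f (MQ x T))" using that by force
      from MQ.prems[OF this] show ?thesis using d by simp
    qed
    then have "\<bar>accepts (sim R L (T (f x)) e) f - tree_accept n f (T (f x))\<bar> \<le> real e * (1 - \<theta>) ^ L"
      by (intro MQ.IH) auto
    also have "\<dots> \<le> real d * (1 - \<theta>) ^ L" unfolding d using \<theta>1 by (intro mult_right_mono) auto
    finally show ?case unfolding d
      by (cases "f x") (simp_all add: accepts_MQ_branch tree_accept_MQ)
  next
    case (Samp T)
    have set: "set_pmf (run_tree n f (Samp T)) = (\<Union>x\<in>ones n f. apsnd Suc ` set_pmf (run_tree n f (T x)))"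
      using fO O by (simp add: image_UN)
    obtain x0 where x0: "x0 \<in> ones n f" using O by auto
    obtain b0 q0 where "(b0, q0) \<in> set_pmf (run_tree n f (T x0))"
      using set_pmf_not_empty[of "run_tree n f (T x0)"] by (metis ex_in_conv surj_pair)
    then have "(b0, Suc q0) \<in> set_pmf (run_tree n f (Samp T))" unfolding set using x0 by force
    from Samp.prems[OF this] obtain e where d: "d = Suc e" by (cases d) auto
    let ?\<delta> = "(1 - \<theta>) ^ L" and ?g = "\<lambda>z. accepts (sim R L (T z) e) f"
    have IH: "\<bar>?g x - tree_accept n f (T x)\<bar> \<le> real e * ?\<delta>" if x: "x \<in> ones n f" for x
    proof (rule Samp.IH)
      fix b q assume "(b, q) \<in> set_pmf (run_tree n f (T x))"
      then have "(b, Suc q) \<in> set_pmf (run_tree n f (Samp T))" unfolding set using x by force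
      from Samp.prems[OF this] show "q \<le> e" using d by simp
    qed simp
    have up: "avg (ones n f) ?g - avg (ones n f) (\<lambda>x. tree_accept n f (T x)) \<le> real e * ?\<delta>"
      unfolding avg_diff[symmetric] by (rule avg_le_const[OF fO O]) (use IH abs_le_D1 in blast)
    have lo: "avg (ones n f) (\<lambda>x. tree_accept n f (T x)) - avg (ones n f) ?g \<le> real e * ?\<delta>"
      unfolding avg_diff[symmetric] by (rule avg_le_const[OF fO O]) (use IH in \<open>force simp: abs_le_iff\<close>)
    have g01: "0 \<le> avg (ones n f) ?g" "avg (ones n f) ?g \<le> 1"
      by (auto intro!: avg_nonneg avg_le_const fO O accepts_nonneg accepts_le_1)
    let ?\<gamma> = "(1 - card (ones n f) / card R) ^ L"
    have \<gamma>: "0 \<le> ?\<gamma>" "?\<gamma> \<le> ?\<delta>" using \<alpha> by (auto intro: power_mono)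
    have "accepts (sim R L (Samp T) d) f = (1 - ?\<gamma>) * avg (ones n f) ?g"
      using accepts_scan[of R f "\<lambda>z. sim R L (T z) e" L] R O unfolding d Oeq by simp
    moreover have "0 \<le> ?\<gamma> * avg (ones n f) ?g" "?\<gamma> * avg (ones n f) ?g \<le> ?\<delta>"
      using \<gamma> g01 by (auto intro: order_trans[OF mult_left_le])
    moreover have "real d * ?\<delta> = real e * ?\<delta> + ?\<delta>" unfolding d by (simp add: algebra_simps)
    ultimately show ?case
      using up lo unfolding tree_accept_Samp[OF fO O] left_diff_distrib by linarith
  qed
qed

lemma mq_only_scan:
  assumes "\<And>z a. a \<in> set_pmf (p z) \<Longrightarrow> mq_only a D" "t \<in> set_pmf (scan R p l)"
  shows "mq_only t (l + D)"
  using assms(2)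
proof (induction l arbitrary: t)
  case (Suc l)
  then obtain z a r where t: "t = MQ z (\<lambda>b. if b then a else r)"
    "a \<in> set_pmf (p z)" "r \<in> set_pmf (scan R p l)"
    by auto
  have "mq_only a (l + D)" by (rule mq_only_mono[OF assms(1)[OF t(2)]]) simp
  moreover have "mq_only r (l + D)" by (rule Suc.IH[OF t(3)])
  ultimately show ?case using t(1) by simp
qed auto

text \<open>A call costs at most \<open>L\<close> queries. The fuel also bounds the branches that no
  run on the actual input takes.\<close>

lemma mq_only_sim:
  assumes "1 \<le> L" "t' \<in> set_pmf (sim R L t d)"
  shows "mq_only t' (L * d)"
  using assms(2)
proof (induction t arbitrary: d t')
  case (MQ x T)
  show ?case
  proof (cases d)
    case (Suc e)
    then obtain a b where t': "t' = MQ x (\<lambda>r. if r then a else b)"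
      "a \<in> set_pmf (sim R L (T True) e)" "b \<in> set_pmf (sim R L (T False) e)"
      using MQ.prems by auto
    have "mq_only a (L * e)" "mq_only b (L * e)"
      using MQ.IH[of "T True" a e] MQ.IH[of "T False" b e] t' by auto
    moreover have "L * e \<le> L * d - 1" using Suc assms(1) by simp
    ultimately have "mq_only a (L * d - 1)" "mq_only b (L * d - 1)"
      using mq_only_mono by blast+
    moreover have "0 < L * d" using Suc assms(1) by simp
    ultimately show ?thesis using t' by simp
  qed (use MQ in auto)
next
  case (Samp T)
  show ?case
  proof (cases d)
    case (Suc e)
    have "mq_only t' (L + L * e)"
    proof (rule mq_only_scan[where p = "\<lambda>z. sim R L (T z) e" and R = R])
      show "mq_only a (L * e)" if "a \<in> set_pmf (sim R L (T z) e)" for z a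
        using that by (intro Samp.IH[of "T z"]) simp_all
      show "t' \<in> set_pmf (scan R (\<lambda>z. sim R L (T z) e) L)" using Samp.prems Suc by simp
    qed
    then show ?thesis using Suc by simp
  qed (use Samp in auto)
qed auto

section \<open>Amplification by iterated majority votes\<close>

primrec bind_tree :: "decision_tree \<Rightarrow> (bool \<Rightarrow> decision_tree) \<Rightarrow> decision_tree" where
  "bind_tree (Output b) k = k b"
| "bind_tree (MQ x T) k = MQ x (\<lambda>r. bind_tree (T r) k)"
| "bind_tree (Samp T) k = Samp (\<lambda>x. bind_tree (T x) k)"

lemma eval_bind_tree: "mq_only t d \<Longrightarrow> eval_tree (bind_tree t k) f = eval_tree (k (eval_tree t f)) f"
  by (induction t arbitrary: d) auto

lemma mq_only_bind_tree:
  "mq_only t d \<Longrightarrow> (\<And>b. mq_only (k b) e) \<Longrightarrow> mq_only (bind_tree t k) (d + e)"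
proof (induction t arbitrary: d)
  case (Output b)
  then show ?case using mq_only_mono[of "k b" e "d + e"] by simp
next
  case (MQ x T)
  have "mq_only (bind_tree (T r) k) (d - 1 + e)" for r
    by (rule MQ.IH) (use MQ.prems in auto)
  moreover have "0 < d" using MQ.prems(1) by simp
  ultimately show ?case by simp
qed auto

text \<open>The third copy is run only if the first two disagree; its verdict then is the
  majority.\<close>

definition maj3 :: "decision_tree pmf \<Rightarrow> decision_tree pmf" where
  "maj3 p = bind_pmf p (\<lambda>a. bind_pmf p (\<lambda>b. bind_pmf p (\<lambda>c.
     return_pmf (bind_tree a (\<lambda>x. bind_tree b (\<lambda>y. if x = y then Output x else c))))))"

lemma mq_only_maj3:
  assumes "\<And>t. t \<in> set_pmf p \<Longrightarrow> mq_only t d" "t \<in> set_pmf (maj3 p)"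
  shows "mq_only t (3 * d)"
proof -
  from assms(2) obtain a b c where t: "a \<in> set_pmf p" "b \<in> set_pmf p" "c \<in> set_pmf p"
    "t = bind_tree a (\<lambda>x. bind_tree b (\<lambda>y. if x = y then Output x else c))"
    unfolding maj3_def by auto
  then have "mq_only t (d + (d + d))"
    using assms(1) by (auto intro!: mq_only_bind_tree)
  then show ?thesis by (simp add: numeral_3_eq_3)
qed

lemma accepts_maj3:
  assumes "\<And>t. t \<in> set_pmf p \<Longrightarrow> mq_only t d"
  shows "accepts (maj3 p) f = 3 * accepts p f ^ 2 - 2 * accepts p f ^ 3"
proof -
  let ?e = "map_pmf (\<lambda>t. eval_tree t f) p"
  have "map_pmf (\<lambda>t. eval_tree t f) (maj3 p)
    = bind_pmf p (\<lambda>a. bind_pmf p (\<lambda>b. bind_pmf p (\<lambda>c.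
        return_pmf (if eval_tree a f = eval_tree b f then eval_tree a f else eval_tree c f))))"
    unfolding maj3_def map_bind_pmf map_return_pmf
    using assms by (intro bind_pmf_cong refl) (simp add: eval_bind_tree[of _ d])
  also have "\<dots> = bind_pmf ?e (\<lambda>x. bind_pmf ?e (\<lambda>y. bind_pmf ?e (\<lambda>z.
        return_pmf (if x = y then x else z))))"
    by (simp add: bind_map_pmf)
  finally have *: "map_pmf (\<lambda>t. eval_tree t f) (maj3 p) = \<dots>" .
  have F: "pmf ?e False = 1 - pmf ?e True"
  proof -
    have "(\<Sum>x\<in>UNIV. pmf ?e x) = 1" by (rule sum_pmf_eq_1) auto
    then show ?thesis by (simp add: UNIV_bool)
  qed
  have int: "(\<integral>x. g x \<partial>measure_pmf ?e) = pmf ?e True * g True + (1 - pmf ?e True) * g False" for g :: "bool \<Rightarrow> real"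
    by (subst integral_measure_pmf_real[of UNIV]) (simp_all add: UNIV_bool F mult.commute)
  show ?thesis
    unfolding accepts_conv_pmf[of "maj3 p"] * pmf_bind int unfolding accepts_conv_pmf
    by (simp add: power2_eq_square power3_eq_cube algebra_simps)
qed

text \<open>Each round of majority votes multiplies an error of at most 7/20 by at most 17/20. The
  number of rounds depends on \<delta> only, so the depth grows by a constant factor.\<close>

lemma amplification:
  fixes \<delta> :: real
  assumes "0 < \<delta>"
  obtains r :: nat where
    "\<And>p d t. (\<And>t. t \<in> set_pmf p \<Longrightarrow> mq_only t d) \<Longrightarrow> t \<in> set_pmf ((maj3 ^^ r) p) \<Longrightarrow> mq_only t (3 ^ r * d)"
    "\<And>p d f. (\<And>t. t \<in> set_pmf p \<Longrightarrow> mq_only t d) \<Longrightarrow> 13 / 20 \<le> accepts p f \<Longrightarrow> 1 - \<delta> \<le> accepts ((maj3 ^^ r) p) f"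
    "\<And>p d f. (\<And>t. t \<in> set_pmf p \<Longrightarrow> mq_only t d) \<Longrightarrow> accepts p f \<le> 7 / 20 \<Longrightarrow> accepts ((maj3 ^^ r) p) f \<le> \<delta>"
proof -
  have depth: "mq_only t (3 ^ r * d)"
    if "\<And>t. t \<in> set_pmf p \<Longrightarrow> mq_only t d" "t \<in> set_pmf ((maj3 ^^ r) p)" for p d t r
    using that(2)
  proof (induction r arbitrary: t)
    case (Suc r)
    then show ?case using mq_only_maj3[of "(maj3 ^^ r) p" "3 ^ r * d" t] by (simp add: mult.assoc)
  qed (use that in auto)
  define \<phi> :: "real \<Rightarrow> real" where "\<phi> = (\<lambda>x. 3 * x ^ 2 - 2 * x ^ 3)"
  have acc: "accepts ((maj3 ^^ r) p) f = (\<phi> ^^ r) (accepts p f)"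
    if "\<And>t. t \<in> set_pmf p \<Longrightarrow> mq_only t d" for p d f r
  proof (induction r)
    case (Suc r)
    have "accepts (maj3 ((maj3 ^^ r) p)) f = \<phi> (accepts ((maj3 ^^ r) p) f)"
      unfolding \<phi>_def by (rule accepts_maj3[of _ "3 ^ r * d"]) (use depth that in blast)
    then show ?case using Suc by simp
  qed simp
  have step: "0 \<le> \<phi> x" "\<phi> x \<le> (17 / 20) * x" if "0 \<le> x" "x \<le> 7 / 20" for x
  proof -
    have eq: "\<phi> x = x * (x * (3 - 2 * x))" unfolding \<phi>_def by (simp add: power2_eq_square power3_eq_cube algebra_simps)
    show "0 \<le> \<phi> x" unfolding eq using that by (intro mult_nonneg_nonneg) auto
    have "x * (3 - 2 * x) \<le> 17 / 20"
    proof -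
      \<comment> \<open>This product equals \<open>161 / 200 - x * (3 - 2 * x)\<close>, and 161/200
        is below 17/20.\<close>
      have "0 \<le> (7 / 20 - x) * (3 - 2 * x - 7 / 10)" using that by (intro mult_nonneg_nonneg) auto
      then show ?thesis by (simp add: algebra_simps)
    qed
    from mult_left_mono[OF this that(1)] show "\<phi> x \<le> (17 / 20) * x" unfolding eq by (simp add: mult.commute)
  qed
  have it: "0 \<le> (\<phi> ^^ r) x \<and> (\<phi> ^^ r) x \<le> (17 / 20) ^ r * x" if "0 \<le> x" "x \<le> 7 / 20" for x r
  proof (induction r)
    case (Suc r)
    have "(17 / 20) ^ r * x \<le> x" using that by (simp add: mult_left_le_one_le power_le_one)
    then have "(\<phi> ^^ r) x \<le> 7 / 20" using Suc that by linarith
    then show ?case using step[of "(\<phi> ^^ r) x"] Suc by simp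
  qed (use that in auto)
  \<comment> \<open>Symmetry about 1/2 reduces the accepting side to the rejecting one.\<close>
  have "\<phi> (1 - x) = 1 - \<phi> x" for x
    unfolding \<phi>_def by (simp add: power2_eq_square power3_eq_cube algebra_simps)
  then have sym: "(\<phi> ^^ r) (1 - x) = 1 - (\<phi> ^^ r) x" for r x
    by (induction r) simp_all
  obtain r where r: "(17 / 20 :: real) ^ r < \<delta>"
    using real_arch_pow_inv[OF assms, of "17 / 20"] by auto
  have small: "(\<phi> ^^ r) x \<le> \<delta>" if "0 \<le> x" "x \<le> 7 / 20" for x
  proof -
    have "(\<phi> ^^ r) x \<le> (17 / 20) ^ r * x" using it[OF that] by simp
    also have "\<dots> \<le> (17 / 20) ^ r" using that by (intro mult_left_le) auto
    finally show ?thesis using r by simp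
  qed
  show ?thesis
  proof (rule that[of r])
    show "mq_only t (3 ^ r * d)"
      if "\<And>t. t \<in> set_pmf p \<Longrightarrow> mq_only t d" "t \<in> set_pmf ((maj3 ^^ r) p)" for p d t
      using depth that by blast
    show "1 - \<delta> \<le> accepts ((maj3 ^^ r) p) f"
      if "\<And>t. t \<in> set_pmf p \<Longrightarrow> mq_only t d" "13 / 20 \<le> accepts p f" for p d f
    proof -
      have "accepts ((maj3 ^^ r) p) f = (\<phi> ^^ r) (accepts p f)" by (rule acc[of p d]) (rule that(1))
      then show ?thesis
        using small[of "1 - accepts p f"] that(2) accepts_le_1[of p f] sym[of r "accepts p f"] by simp
    qed
    show "accepts ((maj3 ^^ r) p) f \<le> \<delta>"
      if "\<And>t. t \<in> set_pmf p \<Longrightarrow> mq_only t d" "accepts p f \<le> 7 / 20" for p d f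
    proof -
      have "accepts ((maj3 ^^ r) p) f = (\<phi> ^^ r) (accepts p f)" by (rule acc[of p d]) (rule that(1))
      then show ?thesis using small[of "accepts p f"] that(2) accepts_nonneg[of p f] by simp
    qed
  qed
qed

section \<open>What a tree learns about the terms\<close>

text \<open>Variables are drawn with repetition, so that a tuple lies in a set \<open>A\<close> of
  variables with probability exactly \<open>(card A / m) ^ s\<close>.\<close>

definition tuples :: "nat \<Rightarrow> nat \<Rightarrow> (nat \<Rightarrow> nat) set" where
  "tuples s m = PiE {..<s} (\<lambda>_. {..<m})"

text \<open>Serves both families: applied to the ones of a point it yields the satisfied terms,
  applied to its zeros the falsified clauses.\<close>

definition sats :: "nat \<Rightarrow> nat \<Rightarrow> (nat \<Rightarrow> nat \<Rightarrow> nat) \<Rightarrow> nat set \<Rightarrow> nat set" where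
  "sats s K T S = {i \<in> {..<K}. T i ` {..<s} \<subseteq> S}"

text \<open>
Once two other sets are contained in \<open>V x\<close>, the answer does not depend on set \<open>i\<close> any more;
discarding these queries keeps the total number of hits linear in the number of queries.
\<close>
definition hits :: "nat \<Rightarrow> nat \<Rightarrow> (nat \<Rightarrow> nat \<Rightarrow> nat) \<Rightarrow> (point \<Rightarrow> nat set) \<Rightarrow> nat \<Rightarrow> point list \<Rightarrow> point list" where
  "hits s K T V i = filter (\<lambda>x. i \<in> sats s K T (V x) \<and> card (sats s K T (V x)) \<le> 2)"

text \<open>\<open>k\<close> is the typical size of \<open>V x\<close>, and each hit is granted a
  loss of \<open>w\<close> common elements. Without hits the intersection is all of
  \<open>{..<m}\<close>.\<close>

definition bad :: "nat \<Rightarrow> nat \<Rightarrow> nat \<Rightarrow> nat \<Rightarrow> nat \<Rightarrow> (nat \<Rightarrow> nat \<Rightarrow> nat) \<Rightarrow> (point \<Rightarrow> nat set) \<Rightarrow> point list \<Rightarrow> bool" where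
  "bad s m k w K T V xs \<longleftrightarrow>
     (\<exists>i<K. card ({..<m} \<inter> (\<Inter>x\<in>set (hits s K T V i xs). V x)) + length (hits s K T V i xs) * w < k)"

lemma finite_tuples: "finite (tuples s m)"
  unfolding tuples_def by (intro finite_PiE) auto

lemma tuples_nonempty: "0 < m \<Longrightarrow> tuples s m \<noteq> {}"
  unfolding tuples_def by (auto simp: PiE_eq_empty_iff lessThan_empty_iff)

lemma card_tuples: "card (tuples s m) = m ^ s"
  unfolding tuples_def by (simp add: card_PiE)

lemma finite_sats: "finite (sats s K T S)"
  unfolding sats_def by simp

lemma sum_length_hits: "(\<Sum>i<K. length (hits s K T V i xs)) \<le> 2 * length xs"
proof (induction xs)
  case Nil
  then show ?case by (simp add: hits_def)
next
  case (Cons x xs)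
  let ?J = "sats s K T (V x)"
  have "length (hits s K T V i (x # xs)) = length (hits s K T V i xs) + of_bool (i \<in> ?J \<and> card ?J \<le> 2)" for i
    unfolding hits_def by simp
  then have "(\<Sum>i<K. length (hits s K T V i (x # xs)))
      = (\<Sum>i<K. length (hits s K T V i xs)) + (\<Sum>i<K. of_bool (i \<in> ?J \<and> card ?J \<le> 2))"
    by (simp add: sum.distrib)
  moreover have "(\<Sum>i<K. of_bool (i \<in> ?J \<and> card ?J \<le> 2)) \<le> (2::nat)"
  proof (cases "card ?J \<le> 2")
    case True
    have "?J = {i \<in> {..<K}. i \<in> ?J}" unfolding sats_def by auto
    then show ?thesis using True by (simp add: of_bool_def sum.If_cases Int_def)
  qed auto
  ultimately show ?case using Cons by simp
qed

text \<open>Fix all tuples but the \<open>i\<close>-th: the tree then faces a single hidden set, and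
  \<open>card_bad_hidden_set\<close> applies with \<open>A = {..<m}\<close> and
  \<open>p = 0\<close>. The union bound over \<open>i\<close> gives the factor
  \<open>K\<close>.\<close>

lemma prob_bad:
  fixes V :: "point \<Rightarrow> nat set" and \<epsilon> :: real
  assumes t: "mq_only t d" and m: "0 < m" "k \<le> m"
    and \<Phi>: "\<And>x I J. 2 \<le> card I \<Longrightarrow> 2 \<le> card J \<Longrightarrow> \<Phi> x I = \<Phi> x J"
    and \<epsilon>: "0 \<le> \<epsilon>" and base: "\<And>a p. a + p * w < k \<Longrightarrow> real a ^ s \<le> real k ^ s * \<epsilon> ^ p"
  shows "avg (PiE {..<K} (\<lambda>_. tuples s m))
      (\<lambda>T. of_bool (bad s m k w K T V (queried t (\<lambda>x. \<Phi> x (sats s K T (V x))))))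
    \<le> real K * (real k / real m) ^ s * ((1 + \<epsilon>) ^ d - 1)"
proof -
  let ?\<Omega> = "\<lambda>I. PiE I (\<lambda>_. tuples s m)"
  define q where "q = (\<lambda>T. queried t (\<lambda>x. \<Phi> x (sats s K T (V x))))"
  define bi where "bi = (\<lambda>i T. card ({..<m} \<inter> (\<Inter>x\<in>set (hits s K T V i (q T)). V x)) + length (hits s K T V i (q T)) * w < k)"
  have "avg (?\<Omega> {..<K}) (\<lambda>T. of_bool (bi i T)) \<le> (real k / real m) ^ s * ((1 + \<epsilon>) ^ d - 1)" if i: "i < K" for i
  proof -
    have "avg (?\<Omega> {..<K}) (\<lambda>T. of_bool (bi i T))
        = avg (?\<Omega> ({..<K} - {i})) (\<lambda>h. avg (tuples s m) (\<lambda>\<tau>. of_bool (bi i (h(i := \<tau>)))))"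
      using i by (intro avg_PiE_upd) auto
    also have "\<dots> \<le> (real k / real m) ^ s * ((1 + \<epsilon>) ^ d - 1)"
    proof (rule avg_le_const)
      show "finite (?\<Omega> ({..<K} - {i}))" by (intro finite_PiE) (auto simp: finite_tuples)
      show "?\<Omega> ({..<K} - {i}) \<noteq> {}" using m by (simp add: PiE_eq_empty_iff tuples_nonempty)
      fix h :: "nat \<Rightarrow> nat \<Rightarrow> nat"
      define O' where "O' = (\<lambda>S. {l \<in> {..<K} - {i}. h l ` {..<s} \<subseteq> S})"
      have sats: "sats s K (h(i := \<tau>)) S = (if \<tau> ` {..<s} \<subseteq> S then insert i (O' S) else O' S)" for \<tau> S
        unfolding sats_def O'_def using i by auto
      have O': "finite (O' S)" "i \<notin> O' S" for S unfolding O'_def by auto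
      define F where "F = (\<lambda>x b. \<Phi> x (if b then insert i (O' (V x)) else O' (V x)))"
      \<comment> \<open>At most one other set inside \<open>V x\<close> means at most two including
        set \<open>i\<close>; with more of them \<Phi> does not depend on set
        \<open>i\<close>.\<close>
      define R where "R = (\<lambda>x. card (O' (V x)) \<le> 1)"
      define hh where "hh = (\<lambda>\<tau>. filter (\<lambda>x. R x \<and> \<tau> ` {..<s} \<subseteq> V x) (queried t (\<lambda>x. F x (\<tau> ` {..<s} \<subseteq> V x))))"
      have q: "q (h(i := \<tau>)) = queried t (\<lambda>x. F x (\<tau> ` {..<s} \<subseteq> V x))" for \<tau>
        unfolding q_def F_def sats by simp
      have "hits s K (h(i := \<tau>)) V i (q (h(i := \<tau>))) = hh \<tau>" for \<tau>
        unfolding hits_def hh_def q sats R_def using O' by (intro filter_cong) auto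
      then have bi: "bi i (h(i := \<tau>)) \<longleftrightarrow> card ({..<m} \<inter> (\<Inter>x\<in>set (hh \<tau>). V x)) + (0 + length (hh \<tau>)) * w < k" for \<tau>
        unfolding bi_def by simp
      have F: "F x True = F x False" if "\<not> R x" for x
        unfolding F_def using that O' by (auto simp: R_def intro!: \<Phi>)
      have sub: "{\<tau> \<in> tuples s m. bi i (h(i := \<tau>))} \<subseteq> {\<tau> \<in> tuples s m. \<tau> ` {..<s} \<subseteq> {..<m} \<and>
          card ({..<m} \<inter> (\<Inter>x\<in>set (hh \<tau>). V x)) + (0 + length (hh \<tau>)) * w < k}" (is "_ \<subseteq> ?B")
        unfolding bi tuples_def by (auto simp: PiE_iff)
      have "real (card {\<tau> \<in> tuples s m. bi i (h(i := \<tau>))}) \<le> real (card ?B)"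
        using card_mono[OF _ sub] finite_tuples by simp
      also have "\<dots> \<le> real k ^ s * \<epsilon> ^ 0 * ((1 + \<epsilon>) ^ d - of_bool (k \<le> card {..<m} + 0 * w))"
        unfolding hh_def tuples_def
        by (rule card_bad_hidden_set) (use t F \<epsilon> base in auto)
      also have "\<dots> = real k ^ s * ((1 + \<epsilon>) ^ d - 1)" using m by simp
      finally show "avg (tuples s m) (\<lambda>\<tau>. of_bool (bi i (h(i := \<tau>)))) \<le> (real k / real m) ^ s * ((1 + \<epsilon>) ^ d - 1)"
        using m by (simp add: avg_of_bool[OF finite_tuples] card_tuples field_simps)
    qed
    finally show ?thesis .
  qed
  note bi = this
  have "avg (?\<Omega> {..<K}) (\<lambda>T. of_bool (bad s m k w K T V (q T))) \<le> avg (?\<Omega> {..<K}) (\<lambda>T. \<Sum>i<K. of_bool (bi i T))"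
  proof (rule avg_mono)
    fix T
    show "of_bool (bad s m k w K T V (q T)) \<le> (\<Sum>i<K. of_bool (bi i T) :: real)"
    proof (cases "bad s m k w K T V (q T)")
      case True
      then obtain i where "i < K" "bi i T" unfolding bad_def bi_def by auto
      moreover from this have "of_bool (bi i T) \<le> (\<Sum>j<K. of_bool (bi j T) :: real)"
        by (intro member_le_sum) auto
      ultimately show ?thesis by (simp del: sum_of_bool_eq)
    qed (simp add: sum_nonneg)
  qed
  also have "\<dots> \<le> (\<Sum>i<K. (real k / real m) ^ s * ((1 + \<epsilon>) ^ d - 1))"
    unfolding avg_sum using bi by (intro sum_mono) auto
  finally show ?thesis unfolding q_def by (simp add: mult.assoc)
qed

lemma min_le_sqrt_mult:
  fixes a b :: real
  assumes "0 \<le> a" "0 \<le> b"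
  shows "min a b \<le> sqrt (a * b)"
proof (rule real_le_rsqrt)
  show "(min a b)\<^sup>2 \<le> a * b"
    unfolding power2_eq_square using assms by (intro mult_mono) auto
qed

lemma card_1_imp_singleton_the_elem: "card A = 1 \<Longrightarrow> A = {the_elem A}"
  by (metis card_1_singletonE the_elem_eq)

section \<open>The hard functions\<close>

text \<open>\<open>M\<close> and \<open>M'\<close> count terms and clauses. The first
  \<open>6 * s\<close> coordinates carry the construction, and the last \<open>e\<close> are
  free.\<close>

locale hard_instance =
  fixes s M M' n e :: nat
  assumes s_ge: "2 \<le> s" and fits: "6 * s + e \<le> n"
begin

definition supp :: "point \<Rightarrow> nat set" where
  "supp x = {i \<in> {..<6 * s}. x i}"

definition zeros :: "point \<Rightarrow> nat set" where
  "zeros x = {..<6 * s} - supp x"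

definition active :: "point \<Rightarrow> bool" where
  "active x \<longleftrightarrow> x \<in> cube n \<and> (\<forall>i\<in>{6 * s..<n - e}. x i)"

text \<open>The satisfied terms \<open>I\<close> and the falsified clauses \<open>J\<close> are
  separate arguments because \<open>prob_bad\<close> needs the answer as a function of the point and
  one of them. The case distinction is monotone: more satisfied terms and fewer falsified clauses
  favour the value 1.\<close>

definition multiplexer :: "(nat \<times> nat \<Rightarrow> bool) \<Rightarrow> point \<Rightarrow> nat set \<Rightarrow> nat set \<Rightarrow> bool" where
  "multiplexer g x I J =
    (if x \<notin> cube n then undefined
     else if \<not> active x then False
     else if card (supp x) < 4 * s then False
     else if 4 * s + 1 < card (supp x) then True
     else if card I \<noteq> 1 then 2 \<le> card I
     else if card J \<noteq> 1 then card J = 0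
     else g (the_elem I, the_elem J))"

definition cell :: "(nat \<Rightarrow> nat \<Rightarrow> nat) \<Rightarrow> (nat \<Rightarrow> nat \<Rightarrow> nat) \<Rightarrow> point \<Rightarrow> (nat \<times> nat) option" where
  "cell T C x =
    (if active x \<and> 4 * s \<le> card (supp x) \<and> card (supp x) \<le> 4 * s + 1
        \<and> card (sats s M T (supp x)) = 1 \<and> card (sats s M' C (zeros x)) = 1
     then Some (the_elem (sats s M T (supp x)), the_elem (sats s M' C (zeros x))) else None)"

definition dflt :: "(nat \<Rightarrow> nat \<Rightarrow> nat) \<Rightarrow> (nat \<Rightarrow> nat \<Rightarrow> nat) \<Rightarrow> point \<Rightarrow> bool" where
  "dflt T C x = multiplexer (\<lambda>_. False) x (sats s M T (supp x)) (sats s M' C (zeros x))"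

abbreviation cells :: "(nat \<times> nat) set" where
  "cells \<equiv> {..<M} \<times> {..<M'}"

abbreviation hard :: "(nat \<Rightarrow> nat \<Rightarrow> nat) \<Rightarrow> (nat \<Rightarrow> nat \<Rightarrow> nat) \<Rightarrow> (nat \<Rightarrow> point \<Rightarrow> bool) \<Rightarrow> (nat \<times> nat \<Rightarrow> nat) \<Rightarrow> point \<Rightarrow> bool" where
  "hard T C \<equiv> answers (cell T C) (dflt T C)"

text \<open>
Secrets of the monotone functions range over \<open>{..<12 * s}\<close>, where \<open>\<kappa> \<ge> 6 * s\<close> yields the constant
0: thus a single point of a cell has value 1 with probability about \<open>1/3\<close>, as for the
antidictators with secrets in \<open>{..<6 * s}\<close>.
\<close>
definition dictator :: "nat \<Rightarrow> point \<Rightarrow> bool" where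
  "dictator \<kappa> x \<longleftrightarrow> \<kappa> \<in> supp x"

definition antidictator :: "nat \<Rightarrow> point \<Rightarrow> bool" where
  "antidictator \<kappa> x \<longleftrightarrow> \<kappa> \<notin> supp x"

lemma supp_subset: "supp x \<subseteq> {..<6 * s}" and zeros_subset: "zeros x \<subseteq> {..<6 * s}"
  unfolding supp_def zeros_def by auto

lemma finite_supp: "finite (supp x)" and finite_zeros: "finite (zeros x)"
  unfolding zeros_def supp_def by auto

lemma card_zeros: "card (zeros x) = 6 * s - card (supp x)"
  unfolding zeros_def using supp_subset[of x] finite_supp[of x] by (simp add: card_Diff_subset)

lemma hard_conv_multiplexer:
  "hard T C h \<kappa> x = multiplexer (\<lambda>c. h (\<kappa> c) x) x (sats s M T (supp x)) (sats s M' C (zeros x))"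
  unfolding answers_def cell_def dflt_def multiplexer_def by (auto simp: active_def)

lemma cell_SomeD:
  assumes "cell T C x = Some (i, j)"
  shows "active x" "4 * s \<le> card (supp x)" "card (supp x) \<le> 4 * s + 1"
    "sats s M T (supp x) = {i}" "sats s M' C (zeros x) = {j}" "(i, j) \<in> cells"
proof -
  show "active x" "4 * s \<le> card (supp x)" "card (supp x) \<le> 4 * s + 1"
    using assms unfolding cell_def by (auto split: if_splits)
  show I: "sats s M T (supp x) = {i}" and J: "sats s M' C (zeros x) = {j}"
    using assms card_1_imp_singleton_the_elem[of "sats s M T (supp x)"] card_1_imp_singleton_the_elem[of "sats s M' C (zeros x)"]
    unfolding cell_def by (simp_all split: if_splits)
  have "i \<in> sats s M T (supp x)" "j \<in> sats s M' C (zeros x)" unfolding I J by auto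
  then show "(i, j) \<in> cells" unfolding sats_def by auto
qed

lemma cell_in_cells: "cell T C x = Some c \<Longrightarrow> c \<in> cells"
  using cell_SomeD(6)[of T C x "fst c" "snd c"] by simp

section \<open>Disagreement of the points queried in a cell\<close>

definition cell_points :: "(nat \<Rightarrow> nat \<Rightarrow> nat) \<Rightarrow> (nat \<Rightarrow> nat \<Rightarrow> nat) \<Rightarrow> point list \<Rightarrow> nat \<times> nat \<Rightarrow> point list" where
  "cell_points T C xs c = filter (\<lambda>x. cell T C x = Some c) xs"

text \<open>For a touched cell, the number of secrets on which its queried points disagree; only
  these would expose the kind of function.\<close>

definition spread :: "(nat \<Rightarrow> nat \<Rightarrow> nat) \<Rightarrow> (nat \<Rightarrow> nat \<Rightarrow> nat) \<Rightarrow> point list \<Rightarrow> nat \<times> nat \<Rightarrow> real" where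
  "spread T C xs c = real (card (\<Union>x\<in>set (cell_points T C xs c). supp x))
     - real (card (\<Inter>x\<in>set (cell_points T C xs c). supp x))"

lemma touched_iff: "c \<in> touched (cell T C) xs \<longleftrightarrow> set (cell_points T C xs c) \<noteq> {}"
  unfolding touched_def cell_points_def by auto

lemma touched_subset_cells: "touched (cell T C) xs \<subseteq> cells"
  unfolding touched_def using cell_in_cells by auto

lemma spread_nonneg:
  assumes "c \<in> touched (cell T C) xs"
  shows "0 \<le> spread T C xs c"
proof -
  obtain x where "x \<in> set (cell_points T C xs c)"
    using assms unfolding touched_iff by (metis all_not_in_conv)
  then have "(\<Inter>x\<in>set (cell_points T C xs c). supp x) \<subseteq> (\<Union>x\<in>set (cell_points T C xs c). supp x)"
    by blast
  then show ?thesis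
    unfolding spread_def by (simp add: card_mono finite_supp)
qed

text \<open>The hits of term \<open>i\<close> are all 1 on \<open>A\<close>, those of clause
  \<open>j\<close> all 0 on \<open>Z\<close>. Since nothing is bad, these sets stay close to the
  sizes \<open>4 * s\<close> and \<open>2 * s\<close>, which add up to \<open>6 * s\<close>.\<close>

lemma spread_le:
  assumes c: "(i, j) \<in> touched (cell T C) xs" and w: "1 \<le> w"
    and T: "\<not> bad s (6 * s) (4 * s) w M T supp xs" and C: "\<not> bad s (6 * s) (2 * s) w M' C zeros xs"
  shows "spread T C xs (i, j) \<le> 3 * real w * (sqrt (length (cell_points T C xs (i, j)))
    * sqrt (real (length (hits s M T supp i xs)) * real (length (hits s M' C zeros j xs))))"
proof -
  define P where "P = set (cell_points T C xs (i, j))"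
  define p where "p = length (cell_points T C xs (i, j))"
  define pT where "pT = length (hits s M T supp i xs)"
  define pC where "pC = length (hits s M' C zeros j xs)"
  define A where "A = {..<6 * s} \<inter> (\<Inter>x\<in>set (hits s M T supp i xs). supp x)"
  define Z where "Z = {..<6 * s} \<inter> (\<Inter>x\<in>set (hits s M' C zeros j xs). zeros x)"
  define U where "U = (\<Union>x\<in>P. supp x)"
  define N where "N = (\<Inter>x\<in>P. supp x)"
  have PD: "4 * s \<le> card (supp x)" "card (supp x) \<le> 4 * s + 1"
    "x \<in> set (hits s M T supp i xs)" "x \<in> set (hits s M' C zeros j xs)" if "x \<in> P" for x
  proof -
    have "cell T C x = Some (i, j)" "x \<in> set xs" using that unfolding P_def cell_points_def by auto
    then show "4 * s \<le> card (supp x)" "card (supp x) \<le> 4 * s + 1"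
      "x \<in> set (hits s M T supp i xs)" "x \<in> set (hits s M' C zeros j xs)"
      using cell_SomeD[of T C x i j] unfolding hits_def by auto
  qed
  obtain x0 where x0: "x0 \<in> P" using c unfolding touched_iff P_def by (metis all_not_in_conv)
  have p1: "1 \<le> p" "1 \<le> pT" "1 \<le> pC"
    using x0 PD(3,4)[OF x0] unfolding P_def p_def pT_def pC_def by (auto simp: Suc_le_eq)
  have ij: "i < M" "j < M'" using c touched_subset_cells by auto
  have cA: "4 * s \<le> card A + pT * w" using T ij unfolding bad_def A_def pT_def by auto
  have cZ: "2 * s \<le> card Z + pC * w" using C ij unfolding bad_def Z_def pC_def by auto
  have AP: "A \<subseteq> supp x" and ZP: "Z \<subseteq> zeros x" if "x \<in> P" for x
    using PD(3,4)[OF that] unfolding A_def Z_def by auto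
  have fin: "finite A" "finite Z" "finite U" "finite N"
    unfolding A_def Z_def U_def N_def P_def using x0 finite_supp by (auto simp: P_def)
  have "A \<subseteq> N" using AP unfolding N_def by auto
  then have cN: "card A \<le> card N" using fin by (intro card_mono) auto
  have "U \<subseteq> {..<6 * s} - Z"
    using ZP supp_subset unfolding U_def zeros_def by blast
  moreover have "card ({..<6 * s} - Z) = 6 * s - card Z" "card Z \<le> 6 * s"
    using card_mono[of "{..<6 * s}" Z] fin unfolding Z_def by (auto simp: card_Diff_subset)
  ultimately have cU: "card U + card Z \<le> 6 * s"
    using card_mono[of "{..<6 * s} - Z" U] by simp
  have D: "spread T C xs (i, j) = real (card U) - real (card N)"
    unfolding spread_def U_def N_def P_def ..
  \<comment> \<open>The union of the supports avoids \<open>Z\<close> and their intersection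
    contains \<open>A\<close>, so the thresholds cancel.\<close>
  have b1: "spread T C xs (i, j) \<le> real w * (real pT + real pC)"
  proof -
    have "card U \<le> card N + (pT * w + pC * w)" using cA cZ cN cU by linarith
    then have "real (card U) \<le> real (card N + (pT * w + pC * w))" by (rule of_nat_mono)
    then show ?thesis unfolding D by (simp add: algebra_simps)
  qed
  \<comment> \<open>Both points have weight \<open>4 * s\<close> or \<open>4 * s + 1\<close>, so
    either family alone bounds their difference. The extra 1 from the upper layer is absorbed by
    doubling \<open>pT * w\<close>.\<close>
  have diff: "card (supp x - supp y) \<le> 2 * pT * w \<and> card (supp x - supp y) \<le> pC * w"
    if x: "x \<in> P" and y: "y \<in> P" for x y
  proof
    have "card (supp x - supp y) \<le> card (supp x - A)"
      using AP[OF y] finite_supp by (intro card_mono) auto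
    also have "\<dots> = card (supp x) - card A"
      using AP[OF x] fin by (intro card_Diff_subset) auto
    also have "\<dots> \<le> 1 + pT * w" using PD(2)[OF x] cA by linarith
    also have "\<dots> \<le> 2 * pT * w" using p1 w mult_le_mono[OF p1(2) w] by linarith
    finally show "card (supp x - supp y) \<le> 2 * pT * w" .
    have "card (supp x - supp y) \<le> card (zeros y - Z)"
      using ZP[OF x] supp_subset[of x] finite_zeros unfolding zeros_def by (intro card_mono) auto
    also have "\<dots> = card (zeros y) - card Z"
      using ZP[OF y] fin by (intro card_Diff_subset) auto
    also have "\<dots> \<le> pC * w" using PD(1)[OF y] cZ unfolding card_zeros by linarith
    finally show "card (supp x - supp y) \<le> pC * w" .
  qed
  define \<mu> where "\<mu> = min pT pC"
  \<comment> \<open>A coordinate on which the points disagree separates some \<open>y\<close> from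
    \<open>x0\<close>, in one of two directions.\<close>
  have "U - N \<subseteq> (\<Union>y\<in>P. (supp x0 - supp y) \<union> (supp y - supp x0))"
    using x0 unfolding U_def N_def by auto
  then have "card (U - N) \<le> card (\<Union>y\<in>P. (supp x0 - supp y) \<union> (supp y - supp x0))"
    by (intro card_mono) (auto simp: finite_supp P_def)
  also have "\<dots> \<le> (\<Sum>y\<in>P. card ((supp x0 - supp y) \<union> (supp y - supp x0)))"
    by (rule card_UN_le) (simp add: P_def)
  also have "\<dots> \<le> (\<Sum>y\<in>P. 4 * \<mu> * w)"
  proof (rule sum_mono)
    fix y assume y: "y \<in> P"
    have "card (supp x0 - supp y) \<le> 2 * \<mu> * w" "card (supp y - supp x0) \<le> 2 * \<mu> * w"
      using diff[OF x0 y] diff[OF y x0] unfolding \<mu>_def by (auto simp: min_def)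
    then show "card ((supp x0 - supp y) \<union> (supp y - supp x0)) \<le> 4 * \<mu> * w"
      using card_Un_le[of "supp x0 - supp y" "supp y - supp x0"] by linarith
  qed
  also have "\<dots> = card P * (4 * \<mu> * w)" by simp
  also have "\<dots> \<le> p * (4 * \<mu> * w)" unfolding p_def P_def by (intro mult_le_mono card_length) auto
  finally have cUN: "card (U - N) \<le> p * (4 * \<mu> * w)" .
  have "N \<subseteq> U" using x0 unfolding N_def U_def by auto
  then have "real (card U) - real (card N) = real (card (U - N))"
    using fin by (simp add: card_Diff_subset card_mono)
  also have "\<dots> \<le> real (p * (4 * \<mu> * w))" using cUN by (rule of_nat_mono)
  finally have b2: "spread T C xs (i, j) \<le> real w * (4 * real p * real \<mu>)" unfolding D by (simp add: algebra_simps)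
  have "spread T C xs (i, j) \<le> min (real w * (real pT + real pC)) (real w * (4 * real p * real \<mu>))"
    using b1 b2 by simp
  also have "\<dots> = real w * min (real pT + real pC) (4 * real p * real \<mu>)"
    by (rule min_mult_distrib_left[THEN trans, symmetric]) simp
  also have "\<dots> \<le> real w * sqrt ((real pT + real pC) * (4 * real p * real \<mu>))"
    by (intro mult_left_mono min_le_sqrt_mult) auto
  also have "\<dots> \<le> real w * sqrt (9 * (real p * (real pT * real pC)))"
  proof (intro mult_left_mono real_sqrt_le_mono)
    \<comment> \<open>A sum is at most twice the maximum, and maximum times minimum is the product.
      The resulting 8 is rounded up to the square 9.\<close>
    have "(real pT + real pC) * real \<mu> \<le> 2 * (real pT * real pC)"
    proof (cases "pT \<le> pC")
      case True
      have "(real pT + real pC) * real \<mu> \<le> (2 * real pC) * real pT"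
        using True unfolding \<mu>_def by (intro mult_mono) auto
      then show ?thesis by (simp add: ac_simps)
    next
      case False
      have "(real pT + real pC) * real \<mu> \<le> (2 * real pT) * real pC"
        using False unfolding \<mu>_def by (intro mult_mono) auto
      then show ?thesis by (simp add: ac_simps)
    qed
    from mult_left_mono[OF this, of "4 * real p"]
    have "(real pT + real pC) * (4 * real p * real \<mu>) \<le> 8 * (real p * (real pT * real pC))"
      by (simp add: ac_simps)
    also have "\<dots> \<le> 9 * (real p * (real pT * real pC))" by simp
    finally show "(real pT + real pC) * (4 * real p * real \<mu>) \<le> 9 * (real p * (real pT * real pC))" .
  qed auto
  finally show ?thesis
    unfolding p_def[symmetric] pT_def[symmetric] pC_def[symmetric] by (simp add: real_sqrt_mult)
qed

lemma sum_length_cell_points: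
  assumes "finite J"
  shows "(\<Sum>c\<in>J. length (cell_points T C xs c)) \<le> length xs"
proof (induction xs)
  case Nil
  then show ?case by (simp add: cell_points_def)
next
  case (Cons x xs)
  have "length (cell_points T C (x # xs) c) = length (cell_points T C xs c) + of_bool (cell T C x = Some c)" for c
    unfolding cell_points_def by simp
  then have "(\<Sum>c\<in>J. length (cell_points T C (x # xs) c))
      = (\<Sum>c\<in>J. length (cell_points T C xs c)) + (\<Sum>c\<in>J. of_bool (cell T C x = Some c))"
    by (simp add: sum.distrib)
  moreover have "(\<Sum>c\<in>J. of_bool (cell T C x = Some c)) \<le> (1::nat)"
  proof (cases "cell T C x")
    case (Some c)
    then show ?thesis using assms by (simp add: of_bool_def sum.delta)
  qed simp
  ultimately show ?case using Cons by simp
qed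

text \<open>Cauchy-Schwarz over the touched cells: the first factor is at most \<open>sqrt Q\<close>
  as the cells are disjoint; the second is at most \<open>2 * Q\<close> because the sum over all
  cells factors and a point is a hit for at most two terms and two clauses.\<close>

lemma sum_spread_le:
  assumes w: "1 \<le> w" and xs: "length xs \<le> Q"
    and T: "\<not> bad s (6 * s) (4 * s) w M T supp xs" and C: "\<not> bad s (6 * s) (2 * s) w M' C zeros xs"
  shows "(\<Sum>c\<in>touched (cell T C) xs. spread T C xs c) \<le> 6 * real w * (real Q * sqrt (real Q))"
proof -
  let ?J = "touched (cell T C) xs"
  define p where "p = (\<lambda>c. real (length (cell_points T C xs c)))"
  define pT where "pT = (\<lambda>i. real (length (hits s M T supp i xs)))"
  define pC where "pC = (\<lambda>j. real (length (hits s M' C zeros j xs)))"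
  have "(\<Sum>c\<in>?J. spread T C xs c) \<le> (\<Sum>c\<in>?J. 3 * real w * (sqrt (p c) * sqrt (pT (fst c) * pC (snd c))))"
    unfolding p_def pT_def pC_def using spread_le[OF _ w T C] by (intro sum_mono) (auto simp: case_prod_unfold)
  also have "\<dots> = 3 * real w * (\<Sum>c\<in>?J. sqrt (p c) * sqrt (pT (fst c) * pC (snd c)))"
    by (simp add: sum_distrib_left)
  finally have le: "(\<Sum>c\<in>?J. spread T C xs c) \<le> \<dots>" .
  have "(\<Sum>c\<in>?J. sqrt (p c) * sqrt (pT (fst c) * pC (snd c)))
      \<le> sqrt (\<Sum>c\<in>?J. (sqrt (p c))\<^sup>2) * sqrt (\<Sum>c\<in>?J. (sqrt (pT (fst c) * pC (snd c)))\<^sup>2)"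
    using L2_set_mult_ineq[of "\<lambda>c. sqrt (p c)" "\<lambda>c. sqrt (pT (fst c) * pC (snd c))" ?J]
    unfolding L2_set_def by (simp add: p_def pT_def pC_def)
  also have "\<dots> = sqrt (\<Sum>c\<in>?J. p c) * sqrt (\<Sum>c\<in>?J. pT (fst c) * pC (snd c))"
    unfolding p_def pT_def pC_def by simp
  also have "\<dots> \<le> sqrt (real Q) * sqrt ((2 * real Q) * (2 * real Q))"
  proof (intro mult_mono real_sqrt_le_mono)
    have "(\<Sum>c\<in>?J. length (cell_points T C xs c)) \<le> Q"
      using sum_length_cell_points[OF finite_touched] xs by (rule order_trans)
    then show "(\<Sum>c\<in>?J. p c) \<le> real Q" unfolding p_def by (metis of_nat_le_iff of_nat_sum)
    have "(\<Sum>i<M. length (hits s M T supp i xs)) \<le> 2 * Q"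
      using sum_length_hits[of s M T supp xs] xs by simp
    then have sT: "(\<Sum>i<M. pT i) \<le> 2 * real Q"
      unfolding pT_def by (metis of_nat_le_iff of_nat_sum of_nat_mult of_nat_numeral)
    have "(\<Sum>i<M'. length (hits s M' C zeros i xs)) \<le> 2 * Q"
      using sum_length_hits[of s M' C zeros xs] xs by simp
    then have sC: "(\<Sum>i<M'. pC i) \<le> 2 * real Q"
      unfolding pC_def by (metis of_nat_le_iff of_nat_sum of_nat_mult of_nat_numeral)
    have "(\<Sum>c\<in>?J. pT (fst c) * pC (snd c)) \<le> (\<Sum>c\<in>cells. pT (fst c) * pC (snd c))"
      using touched_subset_cells by (intro sum_mono2) (auto simp: pT_def pC_def)
    also have "\<dots> = (\<Sum>i<M. pT i) * (\<Sum>j<M'. pC j)"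
      by (simp add: sum_product sum.cartesian_product case_prod_unfold)
    also have "\<dots> \<le> (2 * real Q) * (2 * real Q)"
      using sT sC by (intro mult_mono) (auto simp: pT_def pC_def sum_nonneg)
    finally show "(\<Sum>c\<in>?J. pT (fst c) * pC (snd c)) \<le> (2 * real Q) * (2 * real Q)" .
  qed (auto simp: pT_def pC_def intro!: sum_nonneg)
  also have "sqrt ((2 * real Q) * (2 * real Q)) = 2 * real Q" by (simp add: real_sqrt_mult)
  finally have "(\<Sum>c\<in>?J. sqrt (p c) * sqrt (pT (fst c) * pC (snd c))) \<le> sqrt (real Q) * (2 * real Q)" .
  from mult_left_mono[OF this, of "3 * real w"] le show ?thesis by (simp add: ac_simps)
qed

end

text \<open>Hypothesis \<open>base\<close> of \<open>card_bad_hidden_set\<close> for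
  \<open>\<epsilon> = exp (- real w / 4)\<close>: the loss of \<open>p * w\<close> out of
  \<open>k\<close> elements costs a factor \<open>(1 - p * w / k) ^ s\<close>, and
  \<open>s / k\<close> is at least 1/4.\<close>

lemma power_le_exp_decay:
  fixes a p w k s :: nat
  assumes "a + p * w < k" "k \<le> 4 * s"
  shows "real a ^ s \<le> real k ^ s * exp (- real w / 4) ^ p"
proof -
  have k: "0 < real k" using assms by simp
  have "real a + real p * real w \<le> real k" using assms(1) by (metis less_imp_le of_nat_add of_nat_le_iff of_nat_mult)
  then have "real a / real k \<le> 1 + (- (real p * real w / real k))" using k by (simp add: field_simps)
  also have "\<dots> \<le> exp (- (real p * real w / real k))" by (rule exp_ge_add_one_self)
  finally have "(real a / real k) ^ s \<le> exp (- (real p * real w / real k)) ^ s"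
    by (intro power_mono) auto
  also have "\<dots> = exp (- (real p * real w * real s / real k))"
    by (simp add: exp_of_nat_mult[symmetric] mult.commute)
  also have "\<dots> \<le> exp (- (real p * real w / 4))"
  proof -
    have "real k \<le> 4 * real s" using assms(2) by (metis of_nat_le_iff of_nat_mult of_nat_numeral)
    then have "1 / 4 \<le> real s / real k" using k by (simp add: field_simps)
    from mult_left_mono[OF this, of "real p * real w"] show ?thesis by simp
  qed
  also have "\<dots> = exp (- real w / 4) ^ p" by (simp add: exp_of_nat_mult[symmetric])
  finally show ?thesis using k by (simp add: power_divide field_simps)
qed

section \<open>Likelihood ratios against the ideal process\<close>

context hard_instance
begin

lemma card_bounds_spread:
  assumes "c \<in> touched (cell T C) xs"
  shows "4 * real s - spread T C xs c \<le> real (card (\<Inter>x\<in>set (cell_points T C xs c). supp x))"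
    and "real (card (\<Union>x\<in>set (cell_points T C xs c). supp x)) \<le> 4 * real s + 1 + spread T C xs c"
proof -
  let ?P = "set (cell_points T C xs c)"
  obtain x0 where x0: "x0 \<in> ?P" using assms unfolding touched_iff by (metis all_not_in_conv)
  have "cell T C x0 = Some (fst c, snd c)" using x0 unfolding cell_points_def by simp
  note x0' = cell_SomeD(2,3)[OF this]
  have "card (supp x0) \<le> card (\<Union>x\<in>?P. supp x)" "card (\<Inter>x\<in>?P. supp x) \<le> card (supp x0)"
    using x0 by (auto intro!: card_mono simp: finite_supp)
  then have "4 * s \<le> card (\<Union>x\<in>?P. supp x)" "card (\<Inter>x\<in>?P. supp x) \<le> 4 * s + 1"
    using x0' by linarith+
  then have "real (4 * s) \<le> real (card (\<Union>x\<in>?P. supp x))" "real (card (\<Inter>x\<in>?P. supp x)) \<le> real (4 * s + 1)"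
    by (simp_all only: of_nat_le_iff)
  then show "4 * real s - spread T C xs c \<le> real (card (\<Inter>x\<in>?P. supp x))"
    and "real (card (\<Union>x\<in>?P. supp x)) \<le> 4 * real s + 1 + spread T C xs c"
    unfolding spread_def by simp_all
qed

lemma Ball_cell_points:
  "(\<forall>x\<in>set xs. cell T C x = Some c \<longrightarrow> Q x) \<longleftrightarrow> (\<forall>x\<in>set (cell_points T C xs c). Q x)"
  unfolding cell_points_def by auto

lemma agreement_ratio:
  assumes c: "c \<in> touched (cell T C) xs" and k: "6 * s \<le> k"
  shows "avg {..<k} (\<lambda>\<kappa>. of_bool (\<forall>x\<in>set xs. cell T C x = Some c \<longrightarrow> \<kappa> \<in> supp x))
      = card (\<Inter>x\<in>set (cell_points T C xs c). supp x) / k" (is ?pos)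
    and "avg {..<k} (\<lambda>\<kappa>. of_bool (\<forall>x\<in>set xs. cell T C x = Some c \<longrightarrow> \<kappa> \<notin> supp x))
      = (real k - card (\<Union>x\<in>set (cell_points T C xs c). supp x)) / k" (is ?neg)
proof -
  let ?P = "set (cell_points T C xs c)"
  obtain x0 where x0: "x0 \<in> ?P" using c unfolding touched_iff by (metis all_not_in_conv)
  have "{\<kappa> \<in> {..<k}. \<forall>x\<in>?P. \<kappa> \<in> supp x} = (\<Inter>x\<in>?P. supp x)"
    using x0 supp_subset[of x0] k by fastforce
  then show ?pos unfolding Ball_cell_points by (simp add: avg_of_bool)
  have eq: "{\<kappa> \<in> {..<k}. \<forall>x\<in>?P. \<kappa> \<notin> supp x} = {..<k} - (\<Union>x\<in>?P. supp x)" by auto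
  have sub: "(\<Union>x\<in>?P. supp x) \<subseteq> {..<k}" using supp_subset k by fastforce
  have "card ({..<k} - (\<Union>x\<in>?P. supp x)) = k - card (\<Union>x\<in>?P. supp x)"
    using finite_subset[OF sub] sub by (simp add: card_Diff_subset)
  moreover have "card (\<Union>x\<in>?P. supp x) \<le> k" using card_mono[OF _ sub] by simp
  ultimately show ?neg
    unfolding Ball_cell_points avg_of_bool[OF finite_lessThan] eq by (simp add: of_nat_diff)
qed

text \<open>About \<open>4 * s\<close> of the \<open>12 * s\<close> secrets answer 1 throughout,
  which matches the ideal probability 1/3.\<close>

lemma dictator_ratio:
  assumes "c \<in> touched (cell T C) xs"
  shows "1 - (1 + spread T C xs c) / (2 * real s)
    \<le> avg {..<12 * s} (\<lambda>\<kappa>. of_bool (\<forall>x\<in>set xs. cell T C x = Some c \<longrightarrow> dictator \<kappa> x = b)) / (if b then 1 / 3 else 2 / 3)"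
  using agreement_ratio[OF assms, of "12 * s"] card_bounds_spread[OF assms] spread_nonneg[OF assms] s_ge
  by (cases b) (simp_all add: dictator_def field_simps)

text \<open>The tight case is \<open>b = True\<close>: about \<open>2 * s\<close> of the
  \<open>6 * s\<close> secrets avoid all supports, so each lost one weighs
  \<open>1 / (2 * s)\<close>. This fixes the deviation in both lemmas.\<close>

lemma antidictator_ratio:
  assumes "c \<in> touched (cell T C) xs"
  shows "1 - (1 + spread T C xs c) / (2 * real s)
    \<le> avg {..<6 * s} (\<lambda>\<kappa>. of_bool (\<forall>x\<in>set xs. cell T C x = Some c \<longrightarrow> antidictator \<kappa> x = b)) / (if b then 1 / 3 else 2 / 3)"
  using agreement_ratio[OF assms, of "6 * s"] card_bounds_spread[OF assms] spread_nonneg[OF assms] s_ge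
  by (cases b) (simp_all add: antidictator_def field_simps)

abbreviation ideal :: "(nat \<Rightarrow> nat \<Rightarrow> nat) \<Rightarrow> (nat \<Rightarrow> nat \<Rightarrow> nat) \<Rightarrow> (nat \<times> nat \<Rightarrow> nat) \<Rightarrow> point \<Rightarrow> bool" where
  "ideal T C \<equiv> hard T C (\<lambda>b _. b = 0)"

abbreviation bits :: "(nat \<times> nat \<Rightarrow> nat) set" where
  "bits \<equiv> PiE cells (\<lambda>_. {..<3})"

definition learned :: "nat \<Rightarrow> decision_tree \<Rightarrow> (nat \<Rightarrow> nat \<Rightarrow> nat) \<Rightarrow> (nat \<Rightarrow> nat \<Rightarrow> nat) \<Rightarrow> (nat \<times> nat \<Rightarrow> nat) \<Rightarrow> bool" where
  "learned w t T C \<beta> \<longleftrightarrow> bad s (6 * s) (4 * s) w M T supp (queried t (ideal T C \<beta>))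
     \<or> bad s (6 * s) (2 * s) w M' C zeros (queried t (ideal T C \<beta>))"

text \<open>Of order \<open>w * Q^(3/2) / s\<close>; its smallness is what limits the argument to
  about \<open>s^(2/3)\<close> queries.\<close>

definition gap :: "nat \<Rightarrow> nat \<Rightarrow> real" where
  "gap w Q = (real Q + 6 * real w * (real Q * sqrt (real Q))) / (2 * real s)"

lemma gap_nonneg: "0 \<le> gap w Q"
  unfolding gap_def by simp

lemma sum_deviation_le_gap:
  assumes "1 \<le> w" "length xs \<le> Q"
    and "\<not> bad s (6 * s) (4 * s) w M T supp xs" "\<not> bad s (6 * s) (2 * s) w M' C zeros xs"
  shows "(\<Sum>c\<in>touched (cell T C) xs. (1 + spread T C xs c) / (2 * real s)) \<le> gap w Q"
proof -
  let ?J = "touched (cell T C) xs"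
  have "card ?J = (\<Sum>c\<in>?J. 1)" by simp
  also have "\<dots> \<le> (\<Sum>c\<in>?J. length (cell_points T C xs c))"
  proof (rule sum_mono)
    fix c assume "c \<in> ?J"
    then show "1 \<le> length (cell_points T C xs c)" unfolding touched_iff by (simp add: Suc_le_eq)
  qed
  also have "\<dots> \<le> Q" using sum_length_cell_points[OF finite_touched] assms(2) by (rule order_trans)
  finally have "real (card ?J) \<le> real Q" by simp
  moreover have "(\<Sum>c\<in>?J. spread T C xs c) \<le> 6 * real w * (real Q * sqrt (real Q))"
    by (rule sum_spread_le) (use assms in auto)
  ultimately have "(\<Sum>c\<in>?J. 1 + spread T C xs c) \<le> real Q + 6 * real w * (real Q * sqrt (real Q))"
    by (simp add: sum.distrib)
  then show ?thesis
    unfolding gap_def sum_divide_distrib[symmetric] by (intro divide_right_mono) auto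
qed

text \<open>Unless the terms or clauses are learned, the product of the ratios is at least
  \<open>1 - gap w Q\<close>; \<open>ideal_domination\<close> then bounds the loss for either
  verdict.\<close>

lemma ideal_le_hard:
  fixes K :: "nat set"
  assumes t: "mq_only t Q" and w: "1 \<le> w" and K: "finite K" "K \<noteq> {}"
    and ratio: "\<And>xs c b. c \<in> touched (cell T C) xs \<Longrightarrow> 1 - (1 + spread T C xs c) / (2 * real s)
      \<le> avg K (\<lambda>\<kappa>. of_bool (\<forall>x\<in>set xs. cell T C x = Some c \<longrightarrow> h \<kappa> x = b)) / (if b then 1 / 3 else 2 / 3)"
  shows "avg bits (\<lambda>\<beta>. of_bool (eval_tree t (ideal T C \<beta>) = v))
    \<le> avg (PiE cells (\<lambda>_. K)) (\<lambda>\<kappa>. of_bool (eval_tree t (hard T C h \<kappa>) = v))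
      + gap w Q + avg bits (\<lambda>\<beta>. of_bool (learned w t T C \<beta>))"
proof -
  define r where "r = (\<lambda>\<beta> c. avg K (\<lambda>k. of_bool (\<forall>x\<in>set (queried t (ideal T C \<beta>)). cell T C x = Some c \<longrightarrow> h k x = (\<beta> c = 0)))
      / (if \<beta> c = (0::nat) then 1 / 3 else 2 / 3))"
  define J where "J = (\<lambda>\<beta>. touched (cell T C) (queried t (ideal T C \<beta>)))"
  have fB: "finite bits" by (intro finite_PiE) auto
  have neB: "bits \<noteq> {}" by (simp add: PiE_eq_empty_iff lessThan_empty_iff)
  have "of_bool (eval_tree t (ideal T C \<beta>) = v)
      \<le> of_bool (eval_tree t (ideal T C \<beta>) = v) * (\<Prod>c\<in>J \<beta>. r \<beta> c) + gap w Q + of_bool (learned w t T C \<beta>)" for \<beta>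
  proof -
    have r0: "0 \<le> r \<beta> c" for c unfolding r_def by (intro divide_nonneg_nonneg avg_nonneg) auto
    then have P0: "0 \<le> (\<Prod>c\<in>J \<beta>. r \<beta> c)" by (intro prod_nonneg) auto
    show ?thesis
    proof (cases "learned w t T C \<beta>")
      case True
      then show ?thesis using P0 gap_nonneg[of w Q] by simp
    next
      case False
      let ?xs = "queried t (ideal T C \<beta>)"
      have "1 - gap w Q \<le> 1 - (\<Sum>c\<in>J \<beta>. (1 + spread T C ?xs c) / (2 * real s))"
        unfolding J_def using sum_deviation_le_gap[OF w length_queried[OF t], of T "ideal T C \<beta>" C] False
        by (simp add: learned_def)
      also have "\<dots> \<le> (\<Prod>c\<in>J \<beta>. r \<beta> c)"
      proof (rule prod_ge_one_minus_sum)
        show "finite (J \<beta>)" unfolding J_def by (rule finite_touched)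
        fix c assume c: "c \<in> J \<beta>"
        show "0 \<le> (1 + spread T C ?xs c) / (2 * real s)"
          using spread_nonneg[of c T C ?xs] c unfolding J_def by simp
        show "1 - (1 + spread T C ?xs c) / (2 * real s) \<le> r \<beta> c"
          using ratio[of c ?xs "\<beta> c = 0"] c unfolding J_def r_def by simp
      qed (rule r0)
      finally show ?thesis using gap_nonneg[of w Q] by simp
    qed
  qed
  then have "avg bits (\<lambda>\<beta>. of_bool (eval_tree t (ideal T C \<beta>) = v))
    \<le> avg bits (\<lambda>\<beta>. of_bool (eval_tree t (ideal T C \<beta>) = v) * (\<Prod>c\<in>J \<beta>. r \<beta> c) + gap w Q + of_bool (learned w t T C \<beta>))"
    by (intro avg_mono)
  also have "\<dots> = avg bits (\<lambda>\<beta>. of_bool (eval_tree t (ideal T C \<beta>) = v) * (\<Prod>c\<in>J \<beta>. r \<beta> c))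
      + gap w Q + avg bits (\<lambda>\<beta>. of_bool (learned w t T C \<beta>))"
    by (simp only: avg_add avg_const[OF fB neB])
  also have "avg bits (\<lambda>\<beta>. of_bool (eval_tree t (ideal T C \<beta>) = v) * (\<Prod>c\<in>J \<beta>. r \<beta> c))
      \<le> avg (PiE cells (\<lambda>_. K)) (\<lambda>\<kappa>. of_bool (eval_tree t (hard T C h \<kappa>) = v))"
    unfolding r_def J_def by (rule ideal_domination) (use K cell_in_cells in auto)
  finally show ?thesis by simp
qed

lemma avg_of_bool_not:
  assumes "finite A" "A \<noteq> {}"
  shows "avg A (\<lambda>x. of_bool (P x = False)) = 1 - avg A (\<lambda>x. of_bool (P x = True))"
proof -
  have "avg A (\<lambda>x. of_bool (P x = False)) = avg A (\<lambda>x. 1 - of_bool (P x = True))"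
    by (rule avg_cong) auto
  also have "\<dots> = avg A (\<lambda>_. 1) - avg A (\<lambda>x. of_bool (P x = True))"
    by (rule avg_diff)
  finally show ?thesis unfolding avg_const[OF assms] .
qed

text \<open>Domination is one-sided, so it is used for acceptance of antidictators and for rejection
  of dictators, and the latter is complemented.\<close>

lemma dictator_le_antidictator:
  assumes t: "mq_only t Q" and w: "1 \<le> w"
  shows "avg (PiE cells (\<lambda>_. {..<12 * s})) (\<lambda>\<kappa>. of_bool (eval_tree t (hard T C dictator \<kappa>)))
    \<le> avg (PiE cells (\<lambda>_. {..<6 * s})) (\<lambda>\<kappa>. of_bool (eval_tree t (hard T C antidictator \<kappa>)))
      + 2 * gap w Q + 2 * avg bits (\<lambda>\<beta>. of_bool (learned w t T C \<beta>))"
proof -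
  have ne: "{..<12 * s} \<noteq> {}" "{..<6 * s} \<noteq> {}" using s_ge by (auto simp: lessThan_empty_iff)
  have no: "avg bits (\<lambda>\<beta>. of_bool (eval_tree t (ideal T C \<beta>) = True))
    \<le> avg (PiE cells (\<lambda>_. {..<6 * s})) (\<lambda>\<kappa>. of_bool (eval_tree t (hard T C antidictator \<kappa>) = True))
      + gap w Q + avg bits (\<lambda>\<beta>. of_bool (learned w t T C \<beta>))"
    by (rule ideal_le_hard[OF t w _ ne(2) antidictator_ratio]) auto
  have yes: "avg bits (\<lambda>\<beta>. of_bool (eval_tree t (ideal T C \<beta>) = False))
    \<le> avg (PiE cells (\<lambda>_. {..<12 * s})) (\<lambda>\<kappa>. of_bool (eval_tree t (hard T C dictator \<kappa>) = False))
      + gap w Q + avg bits (\<lambda>\<beta>. of_bool (learned w t T C \<beta>))"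
    by (rule ideal_le_hard[OF t w _ ne(1) dictator_ratio]) auto
  have b: "avg bits (\<lambda>\<beta>. of_bool (eval_tree t (ideal T C \<beta>) = False)) = 1 - avg bits (\<lambda>\<beta>. of_bool (eval_tree t (ideal T C \<beta>) = True))"
    by (rule avg_of_bool_not) (auto intro!: finite_PiE simp: PiE_eq_empty_iff lessThan_empty_iff)
  have y: "avg (PiE cells (\<lambda>_. {..<12 * s})) (\<lambda>\<kappa>. of_bool (eval_tree t (hard T C dictator \<kappa>) = False))
    = 1 - avg (PiE cells (\<lambda>_. {..<12 * s})) (\<lambda>\<kappa>. of_bool (eval_tree t (hard T C dictator \<kappa>) = True))"
    by (rule avg_of_bool_not) (use ne in \<open>auto intro!: finite_PiE simp: PiE_eq_empty_iff\<close>)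
  show ?thesis using no yes unfolding b y by simp
qed

abbreviation terms :: "(nat \<Rightarrow> nat \<Rightarrow> nat) set" where
  "terms \<equiv> PiE {..<M} (\<lambda>_. tuples s (6 * s))"

abbreviation clauses :: "(nat \<Rightarrow> nat \<Rightarrow> nat) set" where
  "clauses \<equiv> PiE {..<M'} (\<lambda>_. tuples s (6 * s))"

text \<open>With clauses and bits fixed, answers depend on the terms only through the satisfied
  ones, and not on which these are once there are two. So \<open>prob_bad\<close> applies, and
  likewise to the clauses; each family contributes a factor 1/4.\<close>

lemma prob_learned:
  assumes t: "mq_only t Q" and M: "real M * (2 / 3) ^ s \<le> 1 / 4" "real M' * (1 / 3) ^ s \<le> 1 / 4"
  shows "avg terms (\<lambda>T. avg clauses (\<lambda>C. avg bits (\<lambda>\<beta>. of_bool (learned w t T C \<beta>))))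
    \<le> ((1 + exp (- real w / 4)) ^ Q - 1) / 2"
proof -
  define \<epsilon> where "\<epsilon> = exp (- real w / 4)"
  define bT where "bT = (\<lambda>T C \<beta>. bad s (6 * s) (4 * s) w M T supp (queried t (ideal T C \<beta>)))"
  define bC where "bC = (\<lambda>T C \<beta>. bad s (6 * s) (2 * s) w M' C zeros (queried t (ideal T C \<beta>)))"
  have fin: "finite terms" "finite clauses" "finite bits"
    by (auto intro!: finite_PiE simp: finite_tuples)
  have ne: "terms \<noteq> {}" "clauses \<noteq> {}" "bits \<noteq> {}"
    using s_ge by (simp_all add: PiE_eq_empty_iff tuples_nonempty lessThan_empty_iff)
  have q: "1 \<le> (1 + \<epsilon>) ^ Q" unfolding \<epsilon>_def by simp
  have T: "avg terms (\<lambda>T. of_bool (bT T C \<beta>)) \<le> ((1 + \<epsilon>) ^ Q - 1) / 4" for C \<beta>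
  proof -
    have "avg terms (\<lambda>T. of_bool (bT T C \<beta>)) \<le> real M * (real (4 * s) / real (6 * s)) ^ s * ((1 + \<epsilon>) ^ Q - 1)"
      unfolding bT_def hard_conv_multiplexer
    proof (rule prob_bad[OF t, where \<Phi> = "\<lambda>x I. multiplexer (\<lambda>c. \<beta> c = 0) x I (sats s M' C (zeros x))"])
      show "real a ^ s \<le> real (4 * s) ^ s * \<epsilon> ^ p" if "a + p * w < 4 * s" for a p
        unfolding \<epsilon>_def using that by (rule power_le_exp_decay) simp
    qed (use s_ge in \<open>auto simp: multiplexer_def \<epsilon>_def\<close>)
    also have "real (4 * s) / real (6 * s) = 2 / 3" using s_ge by simp
    also have "real M * (2 / 3) ^ s * ((1 + \<epsilon>) ^ Q - 1) \<le> 1 / 4 * ((1 + \<epsilon>) ^ Q - 1)"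
      using M q by (intro mult_right_mono) auto
    finally show ?thesis by simp
  qed
  have C: "avg clauses (\<lambda>C. of_bool (bC T C \<beta>)) \<le> ((1 + \<epsilon>) ^ Q - 1) / 4" for T \<beta>
  proof -
    have "avg clauses (\<lambda>C. of_bool (bC T C \<beta>)) \<le> real M' * (real (2 * s) / real (6 * s)) ^ s * ((1 + \<epsilon>) ^ Q - 1)"
      unfolding bC_def hard_conv_multiplexer
    proof (rule prob_bad[OF t, where \<Phi> = "\<lambda>x J. multiplexer (\<lambda>c. \<beta> c = 0) x (sats s M T (supp x)) J"])
      show "real a ^ s \<le> real (2 * s) ^ s * \<epsilon> ^ p" if "a + p * w < 2 * s" for a p
        unfolding \<epsilon>_def using that by (rule power_le_exp_decay) simp
    qed (use s_ge in \<open>auto simp: multiplexer_def \<epsilon>_def\<close>)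
    also have "real (2 * s) / real (6 * s) = 1 / 3" using s_ge by simp
    also have "real M' * (1 / 3) ^ s * ((1 + \<epsilon>) ^ Q - 1) \<le> 1 / 4 * ((1 + \<epsilon>) ^ Q - 1)"
      using M q by (intro mult_right_mono) auto
    finally show ?thesis by simp
  qed
  have "avg terms (\<lambda>T. avg clauses (\<lambda>C. avg bits (\<lambda>\<beta>. of_bool (learned w t T C \<beta>))))
    \<le> avg terms (\<lambda>T. avg clauses (\<lambda>C. avg bits (\<lambda>\<beta>. of_bool (bT T C \<beta>) + of_bool (bC T C \<beta>))))"
    unfolding learned_def bT_def bC_def by (intro avg_mono) auto
  \<comment> \<open>Each summand is reordered so that the family it concerns is averaged
    innermost.\<close>
  also have "\<dots> = avg clauses (\<lambda>C. avg bits (\<lambda>\<beta>. avg terms (\<lambda>T. of_bool (bT T C \<beta>))))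
      + avg terms (\<lambda>T. avg bits (\<lambda>\<beta>. avg clauses (\<lambda>C. of_bool (bC T C \<beta>))))"
  proof -
    have "avg terms (\<lambda>T. avg clauses (\<lambda>C. avg bits (\<lambda>\<beta>. of_bool (bT T C \<beta>))))
        = avg clauses (\<lambda>C. avg bits (\<lambda>\<beta>. avg terms (\<lambda>T. of_bool (bT T C \<beta>))))"
      unfolding avg_swap[of terms clauses] avg_swap[of terms bits] ..
    then show ?thesis unfolding avg_add avg_swap[of clauses bits] by simp
  qed
  also have "\<dots> \<le> ((1 + \<epsilon>) ^ Q - 1) / 4 + ((1 + \<epsilon>) ^ Q - 1) / 4"
    by (intro add_mono avg_le_const fin ne T C)
  finally show ?thesis unfolding \<epsilon>_def by simp
qed

lemma indistinguishable:
  assumes t: "mq_only t Q" and w: "1 \<le> w"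
    and M: "real M * (2 / 3) ^ s \<le> 1 / 4" "real M' * (1 / 3) ^ s \<le> 1 / 4"
  shows "avg terms (\<lambda>T. avg clauses (\<lambda>C. avg (PiE cells (\<lambda>_. {..<12 * s})) (\<lambda>\<kappa>. of_bool (eval_tree t (hard T C dictator \<kappa>)))))
    \<le> avg terms (\<lambda>T. avg clauses (\<lambda>C. avg (PiE cells (\<lambda>_. {..<6 * s})) (\<lambda>\<kappa>. of_bool (eval_tree t (hard T C antidictator \<kappa>)))))
      + 2 * gap w Q + ((1 + exp (- real w / 4)) ^ Q - 1)"
proof -
  have fin: "finite terms" "finite clauses"
    by (auto intro!: finite_PiE simp: finite_tuples)
  have ne: "terms \<noteq> {}" "clauses \<noteq> {}"
    using s_ge by (simp_all add: PiE_eq_empty_iff tuples_nonempty)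
  have "avg terms (\<lambda>T. avg clauses (\<lambda>C. avg (PiE cells (\<lambda>_. {..<12 * s})) (\<lambda>\<kappa>. of_bool (eval_tree t (hard T C dictator \<kappa>)))))
    \<le> avg terms (\<lambda>T. avg clauses (\<lambda>C. avg (PiE cells (\<lambda>_. {..<6 * s})) (\<lambda>\<kappa>. of_bool (eval_tree t (hard T C antidictator \<kappa>)))
      + 2 * gap w Q + 2 * avg bits (\<lambda>\<beta>. of_bool (learned w t T C \<beta>))))"
    by (intro avg_mono dictator_le_antidictator t w)
  also have "\<dots> = avg terms (\<lambda>T. avg clauses (\<lambda>C. avg (PiE cells (\<lambda>_. {..<6 * s})) (\<lambda>\<kappa>. of_bool (eval_tree t (hard T C antidictator \<kappa>)))))
      + 2 * gap w Q + 2 * avg terms (\<lambda>T. avg clauses (\<lambda>C. avg bits (\<lambda>\<beta>. of_bool (learned w t T C \<beta>))))"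
    by (simp only: avg_add avg_cmult avg_const[OF fin(1) ne(1)] avg_const[OF fin(2) ne(2)])
  also have "\<dots> \<le> avg terms (\<lambda>T. avg clauses (\<lambda>C. avg (PiE cells (\<lambda>_. {..<6 * s})) (\<lambda>\<kappa>. of_bool (eval_tree t (hard T C antidictator \<kappa>)))))
      + 2 * gap w Q + ((1 + exp (- real w / 4)) ^ Q - 1)"
    using prob_learned[OF t M, of w] by (intro add_left_mono) simp
  finally show ?thesis .
qed

end

section \<open>Monotonicity, size and distance\<close>

lemma finite_cube: "finite (cube n)"
  unfolding cube_def by (intro finite_PiE) auto

lemma finite_monotone_functions: "finite (monotone_functions n)"
proof (rule finite_subset)
  show "monotone_functions n \<subseteq> cube n \<rightarrow>\<^sub>E UNIV"
    unfolding monotone_functions_def boolean_functions_def by auto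
  show "finite (cube n \<rightarrow>\<^sub>E (UNIV :: bool set))" by (intro finite_PiE finite_cube) auto
qed

lemma monotone_functions_nonempty: "monotone_functions n \<noteq> {}"
proof -
  have "restrict (\<lambda>_. True) (cube n) \<in> monotone_functions n"
    unfolding monotone_functions_def boolean_functions_def by (auto simp: mono_on_def)
  then show ?thesis by auto
qed

lemma far_from_monotoneI:
  assumes "f \<in> boolean_functions n" "\<And>g. g \<in> monotone_functions n \<Longrightarrow> \<epsilon> \<le> rel_dist n f g"
  shows "f \<in> far_from_monotone n \<epsilon>"
  using assms finite_monotone_functions monotone_functions_nonempty
  unfolding far_from_monotone_def rel_dist_class_def by simp

lemma sum_halving:
  fixes a :: "nat \<Rightarrow> nat"
  assumes "\<And>i. 2 * a (Suc i) \<le> a i"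
  shows "(\<Sum>i\<le>l. a i) \<le> 2 * a 0"
proof -
  have "(\<Sum>i\<le>l. a i) + a l \<le> 2 * a 0"
  proof (induction l)
    case (Suc l)
    then show ?case using assms[of l] by simp
  qed simp
  then show ?thesis by simp
qed

text \<open>The ratio of consecutive binomials is
  \<open>(6 * s - j) / (j + 1) \<le> 2 * s / (4 * s + 1) < 1 / 2\<close>.\<close>

lemma binomial_halving:
  assumes "4 * s \<le> j"
  shows "2 * (6 * s choose Suc j) \<le> (6 * s choose j)"
proof -
  have "Suc j * (6 * s choose Suc j) = (6 * s - j) * (6 * s choose j)"
    by (metis binomial_absorb_comp binomial_absorption)
  moreover have "2 * (6 * s - j) \<le> Suc j" using assms by simp
  ultimately have "2 * (Suc j * (6 * s choose Suc j)) \<le> Suc j * (6 * s choose j)"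
    using mult_le_mono1[of "2 * (6 * s - j)" "Suc j" "6 * s choose j"] by (simp only: mult.assoc)
  then have "Suc j * (2 * (6 * s choose Suc j)) \<le> Suc j * (6 * s choose j)"
    by (simp only: mult.left_commute)
  then show ?thesis by (simp only: mult_le_cancel1)
qed

text \<open>For \<open>s \<ge> 2\<close> the two steps have ratios at least 4/9 and 3/10, and their
  product 2/15 exceeds 1/8.\<close>

lemma binomial_two_up:
  assumes "2 \<le> s"
  shows "(6 * s choose (4 * s)) \<le> 8 * (6 * s choose (4 * s + 2))"
proof -
  have a: "Suc (4 * s) * (6 * s choose Suc (4 * s)) = (6 * s - 4 * s) * (6 * s choose (4 * s))"
    by (metis binomial_absorb_comp binomial_absorption)
  have b: "Suc (Suc (4 * s)) * (6 * s choose Suc (Suc (4 * s))) = (6 * s - Suc (4 * s)) * (6 * s choose Suc (4 * s))"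
    by (metis binomial_absorb_comp binomial_absorption)
  let ?B = "real (6 * s choose (4 * s))" and ?B1 = "real (6 * s choose Suc (4 * s))"
    and ?B2 = "real (6 * s choose Suc (Suc (4 * s)))"
  have s: "2 \<le> real s" using assms by simp
  have "real (Suc (4 * s) * (6 * s choose Suc (4 * s))) = real ((6 * s - 4 * s) * (6 * s choose (4 * s)))"
    using a by simp
  then have a': "(4 * real s + 1) * ?B1 = 2 * real s * ?B"
    using assms by (simp add: of_nat_diff algebra_simps)
  have "real (Suc (Suc (4 * s)) * (6 * s choose Suc (Suc (4 * s)))) = real ((6 * s - Suc (4 * s)) * (6 * s choose Suc (4 * s)))"
    using b by simp
  then have b': "(4 * real s + 2) * ?B2 = (2 * real s - 1) * ?B1"
    using assms by (simp add: of_nat_diff algebra_simps)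
  have "?B1 \<ge> 4 / 9 * ?B"
  proof -
    have "(4 * real s + 1) * (4 / 9 * ?B) \<le> (4 * real s + 1) * ?B1"
      unfolding a' using mult_right_mono[of "(4 * real s + 1) * (4 / 9)" "2 * real s" ?B] s by simp
    then show ?thesis using s by (simp add: mult_le_cancel_left_pos)
  qed
  moreover have "?B2 \<ge> 3 / 10 * ?B1"
  proof -
    have "(4 * real s + 2) * (3 / 10 * ?B1) \<le> (4 * real s + 2) * ?B2"
      unfolding b' using mult_right_mono[of "(4 * real s + 2) * (3 / 10)" "2 * real s - 1" ?B1] s by simp
    then show ?thesis using s by (simp add: mult_le_cancel_left_pos)
  qed
  ultimately have "?B \<le> 8 * ?B2" by linarith
  then show ?thesis by simp
qed

lemma sats_mono: "A \<subseteq> B \<Longrightarrow> sats s K T A \<subseteq> sats s K T B"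
  unfolding sats_def by blast

lemma avg_tuples_subset:
  assumes "A \<subseteq> {..<m}"
  shows "avg (tuples s m) (\<lambda>v. of_bool (v ` {..<s} \<subseteq> A)) = (real (card A) / real m) ^ s"
proof -
  have "{v \<in> tuples s m. v ` {..<s} \<subseteq> A} = PiE {..<s} (\<lambda>_. A)"
    unfolding tuples_def using assms by (auto simp: PiE_iff extensional_def)
  then show ?thesis
    by (simp add: avg_of_bool[OF finite_tuples] card_PiE card_tuples power_divide)
qed

text \<open>The two sets belong to the two ends of an edge: tuple \<open>i\<close> has to fit into
  the smaller one and to be alone in the larger one. Independence and Bernoulli's inequality give
  the bound.\<close>

lemma prob_unique_ge:
  assumes m: "0 < m" and A: "A \<subseteq> A'" "A' \<subseteq> {..<m}" and i: "i < K"
  shows "(real (card A) / real m) ^ s * (1 - real K * (real (card A') / real m) ^ s)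
    \<le> avg (PiE {..<K} (\<lambda>_. tuples s m)) (\<lambda>T. of_bool (T i ` {..<s} \<subseteq> A \<and> sats s K T A' = {i}))"
proof -
  define p where "p = (\<lambda>A :: nat set. (real (card A) / real m) ^ s)"
  define P where "P = (\<lambda>l v. if l = i then v ` {..<s} \<subseteq> A else \<not> (v :: nat \<Rightarrow> nat) ` {..<s} \<subseteq> A')"
  have "card A' \<le> m" using card_mono[OF _ A(2)] by simp
  then have p1: "p A' \<le> 1" "0 \<le> p A'" "0 \<le> p A" unfolding p_def using m by (auto intro!: power_le_one)
  have "(T i ` {..<s} \<subseteq> A \<and> sats s K T A' = {i}) = (\<forall>l\<in>{..<K}. P l (T l))" for T
    unfolding P_def sats_def using i A(1) by (auto split: if_splits)
  then have "avg (PiE {..<K} (\<lambda>_. tuples s m)) (\<lambda>T. of_bool (T i ` {..<s} \<subseteq> A \<and> sats s K T A' = {i}))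
      = (\<Prod>l<K. avg (tuples s m) (\<lambda>v. of_bool (P l v)))"
    using m by (simp only:) (intro avg_PiE_cylinder, auto simp: finite_tuples tuples_nonempty)
  also have "\<dots> = p A * (\<Prod>l\<in>{..<K} - {i}. avg (tuples s m) (\<lambda>v. of_bool (P l v)))"
    using i A avg_tuples_subset[of A m s] by (subst prod.remove[of _ i]) (auto simp: P_def p_def)
  also have "(\<Prod>l\<in>{..<K} - {i}. avg (tuples s m) (\<lambda>v. of_bool (P l v))) = (\<Prod>l\<in>{..<K} - {i}. 1 - p A')"
  proof (rule prod.cong[OF refl])
    fix l assume "l \<in> {..<K} - {i}"
    then have "avg (tuples s m) (\<lambda>v. of_bool (P l v)) = avg (tuples s m) (\<lambda>v. 1 - of_bool (v ` {..<s} \<subseteq> A'))"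
      by (intro avg_cong) (simp add: P_def)
    also have "\<dots> = 1 - p A'"
      unfolding avg_diff avg_tuples_subset[OF A(2)] p_def using m by (simp add: avg_const finite_tuples tuples_nonempty)
    finally show "avg (tuples s m) (\<lambda>v. of_bool (P l v)) = 1 - p A'" .
  qed
  also have "\<dots> = (1 - p A') ^ (K - 1)" using i by simp
  also have "(1 - p A') ^ (K - 1) \<ge> 1 - real K * p A'"
  proof -
    have "1 - real K * p A' \<le> 1 + real (K - 1) * (- p A')"
      using p1 mult_right_mono[of "real (K - 1)" "real K" "p A'"] by simp
    also have "\<dots> \<le> (1 + (- p A')) ^ (K - 1)" by (rule Bernoulli_inequality) (use p1 in simp)
    finally show ?thesis by simp
  qed
  then have "p A * (1 - real K * p A') \<le> p A * (1 - p A') ^ (K - 1)"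
    using p1 by (intro mult_left_mono) auto
  finally show ?thesis unfolding p_def .
qed

context hard_instance
begin

lemma hard_in_boolean_functions: "hard T C h \<kappa> \<in> boolean_functions n"
  unfolding boolean_functions_def PiE_iff extensional_def hard_conv_multiplexer multiplexer_def by auto

text \<open>Going up, the satisfied terms grow and the falsified clauses shrink. If there is exactly
  one of each at both ends, inclusion forces equality, and a single dictator is evaluated. Otherwise
  the case distinction is monotone.\<close>

lemma dictator_monotone: "hard T C dictator \<kappa> \<in> monotone_functions n"
proof -
  have "mono_on (cube n) (hard T C dictator \<kappa>)"
  proof (rule mono_onI)
    fix x y assume xy: "x \<in> cube n" "y \<in> cube n" "x \<le> y"
    have le: "x i \<Longrightarrow> y i" for i using xy(3) by (auto simp: le_fun_def)
    have sub: "supp x \<subseteq> supp y" "zeros y \<subseteq> zeros x" unfolding supp_def zeros_def using le by auto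
    have c: "card (supp x) \<le> card (supp y)" using sub finite_supp by (intro card_mono) auto
    have act: "active x \<Longrightarrow> active y" unfolding active_def using xy le by auto
    let ?Ix = "sats s M T (supp x)" and ?Iy = "sats s M T (supp y)"
    let ?Jx = "sats s M' C (zeros x)" and ?Jy = "sats s M' C (zeros y)"
    have I: "?Ix \<subseteq> ?Iy" and J: "?Jy \<subseteq> ?Jx" unfolding sats_def using sub by auto
    then have cI: "card ?Ix \<le> card ?Iy" and cJ: "card ?Jy \<le> card ?Jx"
      by (auto intro!: card_mono finite_sats)
    have eI: "?Ix = ?Iy" if "card ?Ix = card ?Iy" using I that by (intro card_subset_eq finite_sats)
    have eJ: "?Jy = ?Jx" if "card ?Jy = card ?Jx" using J that by (intro card_subset_eq finite_sats)
    show "hard T C dictator \<kappa> x \<le> hard T C dictator \<kappa> y"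
    proof (rule le_boolI)
      assume fx: "hard T C dictator \<kappa> x"
      show "hard T C dictator \<kappa> y"
      proof (cases "card ?Ix = 1 \<and> card ?Iy = 1 \<and> card ?Jx = 1 \<and> card ?Jy = 1")
        case True
        then have "?Ix = ?Iy" "?Jy = ?Jx" using eI eJ by auto
        then show ?thesis using fx xy act c sub True
          unfolding hard_conv_multiplexer multiplexer_def by (auto simp: dictator_def split: if_splits)
      next
        case False
        then show ?thesis using fx xy act c cI cJ
          unfolding hard_conv_multiplexer multiplexer_def by (auto split: if_splits)
      qed
    qed
  qed
  then show ?thesis unfolding monotone_functions_def using hard_in_boolean_functions by auto
qed

lemma card_active_supp:
  assumes "\<S> \<subseteq> Pow {..<6 * s}"
  shows "card {x. active x \<and> supp x \<in> \<S>} = card \<S> * 2 ^ e"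
proof -
  \<comment> \<open>Inverse of reading off the support and the free coordinates; those in between
    are set to 1.\<close>
  define G where "G = (\<lambda>(S :: nat set, U :: nat set). \<lambda>i\<in>{..<n}. if i < 6 * s then i \<in> S else if i < n - e then True else i \<in> U)"
  have "bij_betw G (\<S> \<times> Pow {n - e..<n}) {x. active x \<and> supp x \<in> \<S>}"
  proof (rule bij_betw_byWitness[where f' = "\<lambda>x. (supp x, {i \<in> {n - e..<n}. x i})"])
    have sG: "supp (G (S, U)) = S" if "S \<subseteq> {..<6 * s}" for S U
      unfolding supp_def G_def using that fits by auto
    show "\<forall>a\<in>\<S> \<times> Pow {n - e..<n}. (\<lambda>x. (supp x, {i \<in> {n - e..<n}. x i})) (G a) = a"
    proof
      fix a assume a: "a \<in> \<S> \<times> Pow {n - e..<n}"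
      obtain S U where SU: "a = (S, U)" "S \<in> \<S>" "U \<subseteq> {n - e..<n}" using a by auto
      have "{i \<in> {n - e..<n}. G (S, U) i} = U" unfolding G_def using SU(3) fits by auto
      then show "(\<lambda>x. (supp x, {i \<in> {n - e..<n}. x i})) (G a) = a"
        using SU sG[of S U] assms by auto
    qed
    show "\<forall>x\<in>{x. active x \<and> supp x \<in> \<S>}. G ((\<lambda>x. (supp x, {i \<in> {n - e..<n}. x i})) x) = x"
    proof
      fix x assume x: "x \<in> {x. active x \<and> supp x \<in> \<S>}"
      show "G ((\<lambda>x. (supp x, {i \<in> {n - e..<n}. x i})) x) = x"
      proof
        fix i
        show "G ((\<lambda>x. (supp x, {i \<in> {n - e..<n}. x i})) x) i = x i"
          using x unfolding G_def active_def supp_def cube_def by (auto simp: PiE_iff extensional_def)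
      qed
    qed
    show "G ` (\<S> \<times> Pow {n - e..<n}) \<subseteq> {x. active x \<and> supp x \<in> \<S>}"
    proof
      fix x assume "x \<in> G ` (\<S> \<times> Pow {n - e..<n})"
      then obtain S U where SU: "x = G (S, U)" "S \<in> \<S>" "U \<subseteq> {n - e..<n}" by auto
      have "active x" unfolding active_def SU(1) G_def cube_def by auto
      moreover have "supp x = S" unfolding SU(1) using SU assms by (intro sG) auto
      ultimately show "x \<in> {x. active x \<and> supp x \<in> \<S>}" using SU by auto
    qed
    show "(\<lambda>x. (supp x, {i \<in> {n - e..<n}. x i})) ` {x. active x \<and> supp x \<in> \<S>} \<subseteq> \<S> \<times> Pow {n - e..<n}"
      by auto
  qed
  then have "card {x. active x \<and> supp x \<in> \<S>} = card (\<S> \<times> Pow {n - e..<n})"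
    by (rule bij_betw_same_card[symmetric])
  also have "\<dots> = card \<S> * 2 ^ e" using fits by (simp add: card_cartesian_product card_Pow)
  finally show ?thesis .
qed

text \<open>Candidates for rejection sampling: contains the ones of every hard function and is at
  most 16 times as large as their set.\<close>

definition region :: "point set" where
  "region = {x. active x \<and> 4 * s \<le> card (supp x)}"

abbreviation layer_size :: nat where
  "layer_size \<equiv> 6 * s choose (4 * s)"

lemma region_subset_cube: "region \<subseteq> cube n"
  unfolding region_def active_def by auto

lemma finite_region: "finite region"
  using region_subset_cube finite_cube finite_subset by blast

lemma card_region_le: "card region \<le> 2 * layer_size * 2 ^ e"
proof -
  let ?\<S> = "{S. S \<subseteq> {..<6 * s} \<and> 4 * s \<le> card S}"
  have "region = {x. active x \<and> supp x \<in> ?\<S>}" unfolding region_def using supp_subset by auto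
  then have "card region = card ?\<S> * 2 ^ e" using card_active_supp[of ?\<S>] by auto
  also have "card ?\<S> \<le> 2 * layer_size"
  proof -
    have "?\<S> \<subseteq> (\<Union>i\<le>2 * s. {S. S \<subseteq> {..<6 * s} \<and> card S = 4 * s + i})"
    proof
      fix S assume S: "S \<in> ?\<S>"
      then have "card S \<le> 6 * s" using card_mono[of "{..<6 * s}" S] by auto
      then have "S \<in> {S. S \<subseteq> {..<6 * s} \<and> card S = 4 * s + (card S - 4 * s)}" "card S - 4 * s \<le> 2 * s"
        using S by auto
      then show "S \<in> (\<Union>i\<le>2 * s. {S. S \<subseteq> {..<6 * s} \<and> card S = 4 * s + i})" by blast
    qed
    then have "card ?\<S> \<le> card (\<Union>i\<le>2 * s. {S. S \<subseteq> {..<6 * s} \<and> card S = 4 * s + i})"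
      by (intro card_mono) auto
    also have "\<dots> \<le> (\<Sum>i\<le>2 * s. card {S. S \<subseteq> {..<6 * s} \<and> card S = 4 * s + i})"
      by (rule card_UN_le) simp
    also have "\<dots> = (\<Sum>i\<le>2 * s. 6 * s choose (4 * s + i))" by (simp add: n_subsets)
    also have "\<dots> \<le> 2 * (6 * s choose (4 * s + 0))"
      by (rule sum_halving) (simp add: binomial_halving)
    finally show ?thesis by simp
  qed
  finally show ?thesis by simp
qed

lemma ones_hard_subset_region: "ones n (hard T C h \<kappa>) \<subseteq> region"
  unfolding ones_def region_def hard_conv_multiplexer multiplexer_def by (auto split: if_splits)

text \<open>Active points of weight \<open>4 * s + 2\<close> are ones whatever the families and
  secrets are.\<close>

lemma card_ones_hard_ge: "layer_size * 2 ^ e \<le> 8 * card (ones n (hard T C h \<kappa>))"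
proof -
  let ?\<S> = "{S. S \<subseteq> {..<6 * s} \<and> card S = 4 * s + 2}"
  have "card ?\<S> = (6 * s choose (4 * s + 2))" using n_subsets[of "{..<6 * s}" "4 * s + 2"] by simp
  moreover have "card {x. active x \<and> supp x \<in> ?\<S>} = card ?\<S> * 2 ^ e"
    by (rule card_active_supp) auto
  ultimately have card: "(6 * s choose (4 * s + 2)) * 2 ^ e = card {x. active x \<and> supp x \<in> ?\<S>}"
    by (simp only:)
  have sub: "{x. active x \<and> supp x \<in> ?\<S>} \<subseteq> ones n (hard T C h \<kappa>)"
    unfolding ones_def hard_conv_multiplexer multiplexer_def active_def by auto
  have "finite (ones n (hard T C h \<kappa>))"
    using finite_cube unfolding ones_def by auto
  then have "(6 * s choose (4 * s + 2)) * 2 ^ e \<le> card (ones n (hard T C h \<kappa>))"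
    unfolding card using sub by (rule card_mono)
  moreover have "layer_size * 2 ^ e \<le> 8 * (6 * s choose (4 * s + 2)) * 2 ^ e"
    using binomial_two_up[OF s_ge] by (intro mult_right_mono) auto
  ultimately show ?thesis by (simp only: mult.assoc)
qed

lemma card_ones_hard_le: "card (ones n (hard T C h \<kappa>)) \<le> 2 * layer_size * 2 ^ e"
  using card_mono[OF finite_region ones_hard_subset_region] card_region_le by (rule order_trans)

lemma layer_size_pos: "0 < layer_size"
  by simp

text \<open>The edge upwards from \<open>S\<close> in the secret direction stays inside one cell. As
  satisfied terms only grow along it and falsified clauses only shrink, it suffices that term
  \<open>i\<close> holds below and is alone above, and that clause \<open>j\<close> is falsified
  above and alone below.\<close>

definition violated :: "(nat \<Rightarrow> nat \<Rightarrow> nat) \<Rightarrow> (nat \<Rightarrow> nat \<Rightarrow> nat) \<Rightarrow> (nat \<times> nat \<Rightarrow> nat) \<Rightarrow> nat set \<Rightarrow> bool" where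
  "violated T C \<kappa> S \<longleftrightarrow> (\<exists>i j. i < M \<and> j < M' \<and> \<kappa> (i, j) \<notin> S
     \<and> T i ` {..<s} \<subseteq> S \<and> sats s M T (insert (\<kappa> (i, j)) S) = {i}
     \<and> C j ` {..<s} \<subseteq> {..<6 * s} - insert (\<kappa> (i, j)) S \<and> sats s M' C ({..<6 * s} - S) = {j})"

definition layer :: "nat set set" where
  "layer = {S. S \<subseteq> {..<6 * s} \<and> card S = 4 * s}"

lemma card_layer: "card layer = layer_size" and finite_layer: "finite layer"
  unfolding layer_def by (simp_all add: n_subsets)

text \<open>Every monotone \<open>g\<close> differs from the function at an end of each violated
  edge. These edges are disjoint: both ends lie in one cell, so the upper end determines the
  direction.\<close>

lemma antidictator_far:
  assumes \<kappa>: "\<kappa> \<in> PiE cells (\<lambda>_. {..<6 * s})"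
    and X: "\<epsilon> * (2 * real layer_size) \<le> real (card {S \<in> layer. violated T C \<kappa> S})"
  shows "hard T C antidictator \<kappa> \<in> far_from_monotone n \<epsilon>"
proof (rule far_from_monotoneI[OF hard_in_boolean_functions])
  fix g assume g: "g \<in> monotone_functions n"
  let ?f = "hard T C antidictator \<kappa>"
  let ?\<Delta> = "sym_diff (ones n ?f) (ones n g)"
  let ?V = "{S \<in> layer. violated T C \<kappa> S}"
  define W where "W = {x. active x \<and> supp x \<in> ?V}"
  define \<phi> where "\<phi> = (\<lambda>x. x(\<kappa> (the (cell T C x)) := True))"
  have cW: "card W = card ?V * 2 ^ e"
    unfolding W_def by (rule card_active_supp) (auto simp: layer_def)
  have W: "\<exists>c. cell T C x = Some c \<and> cell T C (\<phi> x) = Some c \<and> \<kappa> c < 6 * s \<and> \<not> x (\<kappa> c) \<and> \<phi> x = x(\<kappa> c := True)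
      \<and> card (supp x) = 4 * s \<and> card (supp (\<phi> x)) = Suc (4 * s)" if x: "x \<in> W" for x
  proof -
    from x obtain i j where ij: "active x" "card (supp x) = 4 * s" "i < M" "j < M'" "\<kappa> (i, j) \<notin> supp x"
      "T i ` {..<s} \<subseteq> supp x" "sats s M T (insert (\<kappa> (i, j)) (supp x)) = {i}"
      "C j ` {..<s} \<subseteq> {..<6 * s} - insert (\<kappa> (i, j)) (supp x)" "sats s M' C ({..<6 * s} - supp x) = {j}"
      unfolding W_def violated_def layer_def by auto
    define k where "k = \<kappa> (i, j)"
    have k: "k < 6 * s" using \<kappa> ij unfolding k_def by (auto simp: PiE_iff)
    have "sats s M T (supp x) \<subseteq> sats s M T (insert k (supp x))" by (rule sats_mono) auto
    moreover have "i \<in> sats s M T (supp x)" using ij(3,6) unfolding sats_def by simp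
    ultimately have I: "sats s M T (supp x) = {i}" using ij unfolding k_def by auto
    have c: "cell T C x = Some (i, j)" using ij I unfolding cell_def zeros_def by simp
    then have \<phi>: "\<phi> x = x(k := True)" unfolding \<phi>_def k_def by simp
    have sy: "supp (\<phi> x) = insert k (supp x)" unfolding \<phi> supp_def using k by auto
    have "sats s M' C (zeros (\<phi> x)) \<subseteq> sats s M' C ({..<6 * s} - supp x)"
      unfolding zeros_def sy by (rule sats_mono) auto
    moreover have "j \<in> sats s M' C (zeros (\<phi> x))"
      using ij(4,8) unfolding zeros_def sy sats_def k_def by simp
    ultimately have J: "sats s M' C (zeros (\<phi> x)) = {j}" using ij by auto
    have "\<phi> x \<in> cube n" using ij(1) k fits unfolding \<phi> active_def cube_def by (auto simp: PiE_iff extensional_def)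
    then have "active (\<phi> x)" using ij(1) k unfolding active_def \<phi> by auto
    moreover have "card (supp (\<phi> x)) = Suc (4 * s)" unfolding sy using ij finite_supp unfolding k_def by simp
    ultimately have "cell T C (\<phi> x) = Some (i, j)" using ij J unfolding cell_def sy k_def by simp
    then show ?thesis using c k ij(2,5) \<open>card (supp (\<phi> x)) = Suc (4 * s)\<close> \<phi>
      unfolding k_def[symmetric] by (intro exI[of _ "(i, j)"]) (auto simp: supp_def k_def)
  qed
  have f: "x \<in> ones n ?f" "\<phi> x \<in> cube n - ones n ?f" "x \<in> cube n" "x \<le> \<phi> x" if x: "x \<in> W" for x
  proof -
    obtain c where c: "cell T C x = Some c" "cell T C (\<phi> x) = Some c" "\<kappa> c < 6 * s" "\<not> x (\<kappa> c)" "\<phi> x = x(\<kappa> c := True)"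
      using W[OF x] by blast
    have act: "active x" "active (\<phi> x)"
      using cell_SomeD(1)[of T C x "fst c" "snd c"] cell_SomeD(1)[of T C "\<phi> x" "fst c" "snd c"] c by simp_all
    have "?f x" "\<not> ?f (\<phi> x)"
      using c unfolding answers_def antidictator_def by (auto simp: supp_def)
    then show "x \<in> ones n ?f" "\<phi> x \<in> cube n - ones n ?f" "x \<in> cube n"
      using act unfolding ones_def active_def by auto
    show "x \<le> \<phi> x" unfolding c(5) le_fun_def by simp
  qed
  \<comment> \<open>Picks an end of the edge at which \<open>g\<close> differs. A lower end never
    equals an upper one, since they lie in different layers.\<close>
  define \<psi> where "\<psi> = (\<lambda>x. if x \<in> ?\<Delta> then x else \<phi> x)"
  have \<phi>inj: "x = y" if x: "x \<in> W" and y: "y \<in> W" and eq: "\<phi> x = \<phi> y" for x y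
  proof -
    obtain c where c: "cell T C (\<phi> x) = Some c" "\<not> x (\<kappa> c)" "\<phi> x = x(\<kappa> c := True)" using W[OF x] by blast
    obtain d where d: "cell T C (\<phi> y) = Some d" "\<not> y (\<kappa> d)" "\<phi> y = y(\<kappa> d := True)" using W[OF y] by blast
    have "c = d" using c(1) d(1) eq by simp
    then have "x(\<kappa> c := True) = y(\<kappa> c := True)" using c(3) d(3) eq by simp
    then have "(x(\<kappa> c := True))(\<kappa> c := False) = (y(\<kappa> c := True))(\<kappa> c := False)" by simp
    then show ?thesis using c(2) d(2) \<open>c = d\<close> by (simp add: fun_upd_idem)
  qed
  have "inj_on \<psi> W"
  proof (rule inj_onI)
    fix x y assume xy: "x \<in> W" "y \<in> W" "\<psi> x = \<psi> y"
    have "card (supp x) = 4 * s" "card (supp y) = 4 * s" "card (supp (\<phi> x)) = Suc (4 * s)" "card (supp (\<phi> y)) = Suc (4 * s)"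
      using W[OF xy(1)] W[OF xy(2)] by auto
    then have "\<phi> x \<noteq> y" "x \<noteq> \<phi> y" by auto
    then show "x = y" using xy \<phi>inj unfolding \<psi>_def by (auto split: if_splits)
  qed
  moreover have "\<psi> ` W \<subseteq> ?\<Delta>"
  proof
    fix y assume "y \<in> \<psi> ` W"
    then obtain x where x: "x \<in> W" "y = \<psi> x" by auto
    have g: "mono_on (cube n) g" using g unfolding monotone_functions_def by auto
    have "g x \<le> g (\<phi> x)" by (rule mono_onD[OF g]) (use f[OF x(1)] in auto)
    then show "y \<in> ?\<Delta>" using f[OF x(1)] unfolding x(2) \<psi>_def by (auto simp: ones_def)
  qed
  moreover have "finite ?\<Delta>" using finite_cube unfolding ones_def by auto
  ultimately have "card W \<le> card ?\<Delta>" by (rule card_inj_on_le)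
  then have "real (card ?V * 2 ^ e) \<le> real (card ?\<Delta>)" unfolding cW by (simp only: of_nat_le_iff)
  then have V: "real (card ?V) * 2 ^ e \<le> real (card ?\<Delta>)" by simp
  have "card (ones n ?f) > 0"
    using card_ones_hard_ge[of T C antidictator \<kappa>] layer_size_pos
    by (cases "card (ones n ?f) = 0") simp_all
  then have pos: "0 < real (card (ones n ?f))" by simp
  show "\<epsilon> \<le> rel_dist n ?f g"
  proof (cases "\<epsilon> \<le> 0")
    case True
    then show ?thesis unfolding rel_dist_def by (meson divide_nonneg_nonneg of_nat_0_le_iff order_trans)
  next
    case False
    have "real (card (ones n ?f)) \<le> real (2 * layer_size * 2 ^ e)"
      using card_ones_hard_le by (simp only: of_nat_le_iff)
    then have "\<epsilon> * real (card (ones n ?f)) \<le> \<epsilon> * (2 * real layer_size) * 2 ^ e"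
      using False by (simp add: mult.assoc)
    also have "\<dots> \<le> real (card ?V) * 2 ^ e" using X by (intro mult_right_mono) auto
    finally have "\<epsilon> * real (card (ones n ?f)) \<le> real (card ?\<Delta>)" using V by linarith
    then show ?thesis unfolding rel_dist_def using pos by (simp add: field_simps)
  qed
qed

end

section \<open>Expected number of violated edges\<close>

text \<open>Raising the weight from \<open>4 * s\<close> to \<open>4 * s + 1\<close> changes the
  probability of a term by a bounded factor. Bernoulli bounds \<open>(1 - x) ^ s\<close> from below,
  and \<open>(1 + x) * (1 - x) \<le> 1\<close>.\<close>

lemma one_plus_quarter_inverse_power_le:
  assumes "1 \<le> s"
  shows "(1 + 1 / (4 * real s)) ^ s \<le> 2"
proof -
  let ?x = "1 / (4 * real s)"
  have x: "0 < ?x" "?x \<le> 1" using assms by auto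
  have "1 - real s * ?x \<le> (1 - ?x) ^ s"
    using Bernoulli_inequality[of "- ?x" s] x by simp
  moreover have "real s * ?x = 1 / 4" using assms by simp
  ultimately have "3 / 4 \<le> (1 - ?x) ^ s" by simp
  then have "(1 + ?x) ^ s * (3 / 4) \<le> (1 + ?x) ^ s * (1 - ?x) ^ s"
    by (rule mult_left_mono) simp
  also have "\<dots> = ((1 + ?x) * (1 - ?x)) ^ s" by (rule power_mult_distrib[symmetric])
  also have "\<dots> \<le> 1"
  proof (rule power_le_one)
    show "0 \<le> (1 + ?x) * (1 - ?x)" using x by (intro mult_nonneg_nonneg) auto
    have "(1 + ?x) * (1 - ?x) = 1 - ?x * ?x" by (simp add: algebra_simps)
    then show "(1 + ?x) * (1 - ?x) \<le> 1" by simp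
  qed
  finally show ?thesis by simp
qed

lemma one_minus_half_inverse_power_ge:
  assumes "1 \<le> s"
  shows "1 / 2 \<le> (1 - 1 / (2 * real s)) ^ s"
  using Bernoulli_inequality[of "- (1 / (2 * real s))" s] assms by simp

section \<open>Averages over the coins of the tester\<close>

lemma integrable_of_bool_pmf: "integrable (measure_pmf P) (\<lambda>t. of_bool (Q t) :: real)"
  by (rule measure_pmf.integrable_const_bound[where B = 1]) auto

lemma integrable_avg:
  assumes "\<And>x. integrable (measure_pmf P) (\<lambda>t. g t x)"
  shows "integrable (measure_pmf P) (\<lambda>t. avg X (g t))"
  unfolding avg_def using assms by simp

lemma avg_integral:
  assumes "\<And>x. integrable (measure_pmf P) (\<lambda>t. g t x)"
  shows "avg X (\<lambda>x. \<integral>t. g t x \<partial>measure_pmf P) = (\<integral>t. avg X (g t) \<partial>measure_pmf P)"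
  unfolding avg_def using assms by (simp add: Bochner_Integration.integral_sum)

lemma accepts_integral: "accepts P f = (\<integral>t. of_bool (eval_tree t f) \<partial>measure_pmf P)"
proof -
  have "(\<lambda>t. of_bool (eval_tree t f) :: real) = indicator {t. eval_tree t f}" by (auto simp: indicator_def)
  then show ?thesis unfolding accepts_def by simp
qed

lemma accept_prob_integral: "accept_prob n f A = (\<integral>t. tree_accept n f t \<partial>measure_pmf A)"
proof -
  have "accept_prob n f A = pmf (map_pmf fst (run n f A)) True"
    unfolding accept_prob_def pmf_map accepting_runs_conv_vimage ..
  then show ?thesis unfolding run_def map_bind_pmf pmf_bind tree_accept_conv_pmf .
qed

lemma reject_prob_conv: "reject_prob n f A = 1 - accept_prob n f A"
proof -
  have *: "{(b, q). \<not> b} = UNIV - ({(b, q). b} :: (bool \<times> nat) set)"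
    by (rule set_eqI) (simp add: case_prod_unfold)
  show ?thesis
    unfolding reject_prob_def accept_prob_def *
    using measure_pmf.prob_compl[of "{(b, q). b}" "run n f A"] by simp
qed

context hard_instance
begin

abbreviation yes_secrets :: "(nat \<times> nat \<Rightarrow> nat) set" where
  "yes_secrets \<equiv> PiE cells (\<lambda>_. {..<12 * s})"

abbreviation no_secrets :: "(nat \<times> nat \<Rightarrow> nat) set" where
  "no_secrets \<equiv> PiE cells (\<lambda>_. {..<6 * s})"

lemma families_finite: "finite terms" "finite clauses" "finite yes_secrets" "finite no_secrets"
  by (auto intro!: finite_PiE simp: finite_tuples)

lemma families_nonempty: "terms \<noteq> {}" "clauses \<noteq> {}" "yes_secrets \<noteq> {}" "no_secrets \<noteq> {}"
  using s_ge by (simp_all add: PiE_eq_empty_iff tuples_nonempty lessThan_empty_iff)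

text \<open>Violation splits into disjoint events indexed by term, clause and direction
  \<open>c\<close>. Once \<open>c\<close> is fixed, the conditions on \<open>T\<close>,
  \<open>C\<close> and \<kappa> are independent, so their probabilities multiply.\<close>

lemma expected_violations_at:
  assumes S: "S \<in> layer"
    and M: "1 / 8 \<le> real M * (2 / 3) ^ s" "real M * (2 / 3) ^ s \<le> 1 / 4"
    and M': "1 / 8 \<le> real M' * (1 / 3) ^ s" "real M' * (1 / 3) ^ s \<le> 1 / 4"
  shows "1 / 1024 \<le> avg terms (\<lambda>T. avg clauses (\<lambda>C. avg no_secrets (\<lambda>\<kappa>. of_bool (violated T C \<kappa> S))))"
proof -
  let ?m = "6 * s"
  define a where "a = (\<lambda>T i c. of_bool (T i ` {..<s} \<subseteq> S \<and> sats s M T (insert c S) = {i}) :: real)"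
  define b where "b = (\<lambda>C j c. of_bool (C j ` {..<s} \<subseteq> {..<?m} - insert c S \<and> sats s M' C ({..<?m} - S) = {j}) :: real)"
  define k where "k = (\<lambda>\<kappa> i j c. of_bool (\<kappa> (i :: nat, j :: nat) = (c :: nat)) :: real)"
  define Z where "Z = {..<?m} - S"
  have S': "S \<subseteq> {..<?m}" "card S = 4 * s" "finite S" using S finite_subset unfolding layer_def by auto
  have Z: "card Z = 2 * s" "finite Z" unfolding Z_def using S' by (auto simp: card_Diff_subset)
  have s1: "1 \<le> s" using s_ge by simp
  \<comment> \<open>The larger weight at most doubles the probability of a term, so the union bound
    for competing terms is at most 1/2.\<close>
  have avg_a: "(2 / 3) ^ s / 2 \<le> avg terms (\<lambda>T. a T i c)" if i: "i < M" and c: "c \<in> Z" for i c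
  proof -
    have cS: "card (insert c S) = 4 * s + 1" using c S' unfolding Z_def by simp
    have p: "(real (card S) / real ?m) ^ s = (2 / 3) ^ s" using S' s1 by simp
    have "real (card (insert c S)) / real ?m = 2 / 3 * (1 + 1 / (4 * real s))"
      unfolding cS using s1 by (simp add: field_simps)
    then have "(real (card (insert c S)) / real ?m) ^ s = (2 / 3) ^ s * (1 + 1 / (4 * real s)) ^ s"
      by (simp only: power_mult_distrib)
    also have "\<dots> \<le> (2 / 3) ^ s * 2" by (intro mult_left_mono one_plus_quarter_inverse_power_le s1) simp
    finally have "real M * (real (card (insert c S)) / real ?m) ^ s \<le> real M * ((2 / 3) ^ s * 2)"
      by (intro mult_left_mono) auto
    also have "\<dots> \<le> 1 / 2" using M by simp
    finally have "(2 / 3) ^ s * (1 / 2) \<le> (2 / 3) ^ s * (1 - real M * (real (card (insert c S)) / real ?m) ^ s)"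
      by (intro mult_left_mono) auto
    also have "\<dots> \<le> avg terms (\<lambda>T. a T i c)"
      unfolding a_def p[symmetric] using s1 i c S' by (intro prob_unique_ge) (auto simp: Z_def)
    finally show ?thesis by simp
  qed
  \<comment> \<open>The factor 3/8 is 1/2, for the zero lost to \<open>c\<close>, times 3/4, for the
    absence of competing clauses.\<close>
  have avg_b: "(1 / 3) ^ s * (3 / 8) \<le> avg clauses (\<lambda>C. b C j c)" if j: "j < M'" and c: "c \<in> Z" for j c
  proof -
    have cS: "card (insert c S) = 4 * s + 1" using c S' unfolding Z_def by simp
    have "card ({..<?m} - insert c S) = ?m - (4 * s + 1)"
      using S' c unfolding cS[symmetric] Z_def by (subst card_Diff_subset) auto
    then have "real (card ({..<?m} - insert c S)) / real ?m = 1 / 3 * (1 - 1 / (2 * real s))"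
      using s1 by (simp add: of_nat_diff field_simps)
    then have "(real (card ({..<?m} - insert c S)) / real ?m) ^ s = (1 / 3) ^ s * (1 - 1 / (2 * real s)) ^ s"
      by (simp only: power_mult_distrib)
    moreover have "(1 / 3) ^ s * (1 / 2) \<le> (1 / 3) ^ s * (1 - 1 / (2 * real s)) ^ s"
      by (intro mult_left_mono one_minus_half_inverse_power_ge s1) simp
    ultimately have lo: "(1 / 3) ^ s * (1 / 2) \<le> (real (card ({..<?m} - insert c S)) / real ?m) ^ s" by simp
    have "real (card ({..<?m} - S)) / real ?m = 1 / 3" using Z s1 unfolding Z_def[symmetric] by simp
    then have p: "(real (card ({..<?m} - S)) / real ?m) ^ s = (1 / 3) ^ s" by (simp only:)
    have "(1 / 3) ^ s * (1 / 2) * (3 / 4) \<le> (real (card ({..<?m} - insert c S)) / real ?m) ^ s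
        * (1 - real M' * (real (card ({..<?m} - S)) / real ?m) ^ s)"
      unfolding p using M' lo by (intro mult_mono) auto
    also have "\<dots> \<le> avg clauses (\<lambda>C. b C j c)"
      unfolding b_def using s1 j by (intro prob_unique_ge) auto
    finally show ?thesis by simp
  qed
  have avg_k: "avg no_secrets (\<lambda>\<kappa>. k \<kappa> i j c) = 1 / (6 * real s)" if "i < M" "j < M'" "c \<in> Z" for i j c
  proof -
    have "avg no_secrets (\<lambda>\<kappa>. k \<kappa> i j c) = avg no_secrets (\<lambda>\<kappa>. of_bool (\<forall>l\<in>{(i, j)}. \<kappa> l = c))"
      unfolding k_def by simp
    also have "\<dots> = (\<Prod>l\<in>{(i, j)}. avg {..<?m} (\<lambda>v. of_bool (v = c)))"
      by (rule avg_PiE_cylinder) (use s1 that in \<open>auto simp: lessThan_empty_iff\<close>)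
    also have "\<dots> = 1 / (6 * real s)"
      using that unfolding avg_def Z_def by (simp add: of_bool_def sum.delta)
    finally show ?thesis .
  qed
  \<comment> \<open>At most one triple contributes: the uniqueness conditions determine
    \<open>i\<close> and \<open>j\<close>, and \<open>c\<close> is the secret of that cell.\<close>
  have pointwise: "(\<Sum>i<M. \<Sum>j<M'. \<Sum>c\<in>Z. a T i c * b C j c * k \<kappa> i j c) \<le> of_bool (violated T C \<kappa> S)" for T C \<kappa>
  proof -
    define P where "P = (\<lambda>(i, j, c). (T i ` {..<s} \<subseteq> S \<and> sats s M T (insert c S) = {i})
      \<and> (C j ` {..<s} \<subseteq> {..<?m} - insert c S \<and> sats s M' C ({..<?m} - S) = {j}) \<and> \<kappa> (i, j) = c)"
    let ?I = "{..<M} \<times> {..<M'} \<times> Z"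
    have "(\<Sum>i<M. \<Sum>j<M'. \<Sum>c\<in>Z. a T i c * b C j c * k \<kappa> i j c) = (\<Sum>p\<in>?I. of_bool (P p))"
      unfolding a_def b_def k_def P_def
      by (simp add: sum.cartesian_product case_prod_unfold of_bool_conj[symmetric] del: of_bool_conj) 
    also have "\<dots> = real (card {p \<in> ?I. P p})" using Z by (simp add: of_bool_def sum.If_cases Int_def)
    also have "\<dots> \<le> of_bool (violated T C \<kappa> S)"
    proof (cases "violated T C \<kappa> S")
      case True
      have "x = y" if "x \<in> {p \<in> ?I. P p}" "y \<in> {p \<in> ?I. P p}" for x y
      proof -
        obtain i j c where x: "x = (i, j, c)" by (cases x)
        obtain i' j' c' where y: "y = (i', j', c')" by (cases y)
        have "i' \<in> sats s M T S" using that(2) unfolding y P_def sats_def by auto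
        moreover have "sats s M T S \<subseteq> sats s M T (insert c S)" by (rule sats_mono) auto
        moreover have "sats s M T (insert c S) = {i}" using that(1) unfolding x P_def by auto
        ultimately have "i' = i" by auto
        moreover have "j' = j" using that unfolding x y P_def by auto
        moreover have "\<kappa> (i, j) = c" "\<kappa> (i', j') = c'" using that unfolding x y P_def by auto
        ultimately show ?thesis unfolding x y by simp
      qed
      then have "card {p \<in> ?I. P p} \<le> 1"
        using Z by (simp only: One_nat_def) (subst card_le_Suc0_iff_eq, auto)
      then show ?thesis using True by simp
    next
      case False
      have empty: "{p \<in> ?I. P p} = {}"
      proof (rule ccontr)
        assume "{p \<in> ?I. P p} \<noteq> {}"
        then obtain i j c where "i < M" "j < M'" "c \<in> Z" "P (i, j, c)" by auto
        then have P: "\<kappa> (i, j) = c" "T i ` {..<s} \<subseteq> S" "sats s M T (insert c S) = {i}"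
            "C j ` {..<s} \<subseteq> {..<?m} - insert c S" "sats s M' C ({..<?m} - S) = {j}"
          unfolding P_def by simp_all
        have "violated T C \<kappa> S"
          unfolding violated_def
          by (rule exI[of _ i], rule exI[of _ j]) (use P \<open>i < M\<close> \<open>j < M'\<close> \<open>c \<in> Z\<close> in \<open>simp add: Z_def\<close>)
        then show False using False by simp
      qed
      show ?thesis unfolding empty by simp
    qed
    finally show ?thesis .
  qed
  have "(\<Sum>i<M. \<Sum>j<M'. \<Sum>c\<in>Z. (2 / 3) ^ s / 2 * ((1 / 3) ^ s * (3 / 8)) * (1 / (6 * real s)))
    \<le> (\<Sum>i<M. \<Sum>j<M'. \<Sum>c\<in>Z. avg terms (\<lambda>T. a T i c) * avg clauses (\<lambda>C. b C j c) * avg no_secrets (\<lambda>\<kappa>. k \<kappa> i j c))"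
  proof (intro sum_mono)
    fix i j c assume ij: "i \<in> {..<M}" "j \<in> {..<M'}" "c \<in> Z"
    then have "i < M" "j < M'" by simp_all
    have "(2 / 3) ^ s / 2 * ((1 / 3) ^ s * (3 / 8)) \<le> avg terms (\<lambda>T. a T i c) * avg clauses (\<lambda>C. b C j c)"
    proof (rule mult_mono)
      show "(2 / 3) ^ s / 2 \<le> avg terms (\<lambda>T. a T i c)" using \<open>i < M\<close> ij(3) by (rule avg_a)
      show "(1 / 3) ^ s * (3 / 8) \<le> avg clauses (\<lambda>C. b C j c)" using \<open>j < M'\<close> ij(3) by (rule avg_b)
      show "0 \<le> avg terms (\<lambda>T. a T i c)" unfolding a_def by (rule avg_nonneg) simp
    qed simp
    then show "(2 / 3) ^ s / 2 * ((1 / 3) ^ s * (3 / 8)) * (1 / (6 * real s))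
      \<le> avg terms (\<lambda>T. a T i c) * avg clauses (\<lambda>C. b C j c) * avg no_secrets (\<lambda>\<kappa>. k \<kappa> i j c)"
      unfolding avg_k[OF \<open>i < M\<close> \<open>j < M'\<close> ij(3)] by (rule mult_right_mono) simp
  qed
  also have "\<dots> = avg terms (\<lambda>T. avg clauses (\<lambda>C. avg no_secrets (\<lambda>\<kappa>. \<Sum>i<M. \<Sum>j<M'. \<Sum>c\<in>Z. a T i c * b C j c * k \<kappa> i j c)))"
    unfolding avg_sum avg_cmult avg_multc ..
  also have "\<dots> \<le> avg terms (\<lambda>T. avg clauses (\<lambda>C. avg no_secrets (\<lambda>\<kappa>. of_bool (violated T C \<kappa> S))))"
    by (intro avg_mono pointwise)
  finally have le: "(\<Sum>i<M. \<Sum>j<M'. \<Sum>c\<in>Z. (2 / 3) ^ s / 2 * ((1 / 3) ^ s * (3 / 8)) * (1 / (6 * real s)))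
      \<le> avg terms (\<lambda>T. avg clauses (\<lambda>C. avg no_secrets (\<lambda>\<kappa>. of_bool (violated T C \<kappa> S))))" .
  have "(real M * (2 / 3) ^ s) * (real M' * (1 / 3) ^ s) * (1 / 16)
      \<le> avg terms (\<lambda>T. avg clauses (\<lambda>C. avg no_secrets (\<lambda>\<kappa>. of_bool (violated T C \<kappa> S))))"
  proof -
    \<comment> \<open>Collects the constants:
      \<open>2 * (1 / 2) * (3 / 8) * (1 / 6) = 1 / 16\<close>.\<close>
    have gen: "u * (v * (2 * z * (p / 2 * (q * (3 / 8)) * (1 / (6 * z))))) = (u * p) * (v * q) * (1 / 16)"
      if "z \<noteq> 0" for u v z p q :: real
      using that by simp
    have "(\<Sum>i<M. \<Sum>j<M'. \<Sum>c\<in>Z. (2 / 3) ^ s / 2 * ((1 / 3) ^ s * (3 / 8)) * (1 / (6 * real s)))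
        = real M * (real M' * (2 * real s * ((2 / 3) ^ s / 2 * ((1 / 3) ^ s * (3 / 8)) * (1 / (6 * real s)))))"
      by (simp only: sum_constant card_lessThan Z of_nat_mult of_nat_numeral)
    also have "\<dots> = (real M * (2 / 3) ^ s) * (real M' * (1 / 3) ^ s) * (1 / 16)"
      by (rule gen) (use s1 in simp)
    finally show ?thesis using le by (simp only:)
  qed
  moreover have "1 / 8 * (1 / 8) \<le> (real M * (2 / 3) ^ s) * (real M' * (1 / 3) ^ s)"
    using M M' by (intro mult_mono) auto
  ultimately show ?thesis by linarith
qed

text \<open>Reverse Markov inequality: on average at least 1/1024 of the layer is violated, but less
  than 1/2048 of it whenever the function is not far.\<close>

lemma prob_far_ge:
  assumes M: "1 / 8 \<le> real M * (2 / 3) ^ s" "real M * (2 / 3) ^ s \<le> 1 / 4"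
    and M': "1 / 8 \<le> real M' * (1 / 3) ^ s" "real M' * (1 / 3) ^ s \<le> 1 / 4"
  shows "1 / 2048 \<le> avg terms (\<lambda>T. avg clauses (\<lambda>C. avg no_secrets
    (\<lambda>\<kappa>. of_bool (hard T C antidictator \<kappa> \<in> far_from_monotone n (1 / 4096)))))"
proof -
  let ?avg = "\<lambda>g. avg terms (\<lambda>T. avg clauses (\<lambda>C. avg no_secrets (g T C)))"
  let ?B = "real layer_size"
  let ?far = "\<lambda>T C \<kappa>. of_bool (hard T C antidictator \<kappa> \<in> far_from_monotone n (1 / 4096)) :: real"
  have B: "0 < ?B" by simp
  have "?B / 1024 = (\<Sum>S\<in>layer. 1 / 1024)" by (simp add: card_layer)
  also have "\<dots> \<le> (\<Sum>S\<in>layer. ?avg (\<lambda>T C \<kappa>. of_bool (violated T C \<kappa> S)))"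
    using expected_violations_at[OF _ M M'] by (intro sum_mono)
  also have "\<dots> = ?avg (\<lambda>T C \<kappa>. \<Sum>S\<in>layer. of_bool (violated T C \<kappa> S))"
    unfolding avg_sum ..
  also have "\<dots> \<le> ?avg (\<lambda>T C \<kappa>. ?B * ?far T C \<kappa> + ?B / 2048)"
  proof (intro avg_mono)
    fix T C \<kappa> assume \<kappa>: "\<kappa> \<in> no_secrets"
    have X: "(\<Sum>S\<in>layer. of_bool (violated T C \<kappa> S)) = real (card {S \<in> layer. violated T C \<kappa> S})"
      using finite_layer by (simp add: of_bool_def sum.If_cases Int_def)
    have "card {S \<in> layer. violated T C \<kappa> S} \<le> card layer" using finite_layer by (intro card_mono) auto
    then have XB: "real (card {S \<in> layer. violated T C \<kappa> S}) \<le> ?B" unfolding card_layer by simp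
    show "(\<Sum>S\<in>layer. of_bool (violated T C \<kappa> S)) \<le> ?B * ?far T C \<kappa> + ?B / 2048"
    proof (cases "hard T C antidictator \<kappa> \<in> far_from_monotone n (1 / 4096)")
      case False
      then have "\<not> 1 / 4096 * (2 * ?B) \<le> real (card {S \<in> layer. violated T C \<kappa> S})"
        using antidictator_far[OF \<kappa>, of "1 / 4096" T C] by blast
      then show ?thesis using False unfolding X by simp
    qed (use X XB in simp)
  qed
  also have "\<dots> = ?B * ?avg ?far + ?B / 2048"
    by (simp only: avg_add avg_cmult avg_const[OF families_finite(1) families_nonempty(1)]
        avg_const[OF families_finite(2) families_nonempty(2)] avg_const[OF families_finite(4) families_nonempty(4)])
  finally have le: "?B / 1024 \<le> ?B * ?avg ?far + ?B / 2048" .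
  have "1 / 2048 \<le> r" if "b / 1024 \<le> b * r + b / 2048" "0 < b" for b r :: real
  proof -
    have "b * (1 / 2048) \<le> b * r" using that(1) by linarith
    then show ?thesis using that(2) by (simp only: mult_le_cancel_left_pos)
  qed
  from this[OF le B] show ?thesis .
qed

section \<open>From indistinguishability to a query bound\<close>

lemma indistinguishable_pmf:
  assumes t: "\<And>t. t \<in> set_pmf P \<Longrightarrow> mq_only t Q" and w: "1 \<le> w"
    and M: "real M * (2 / 3) ^ s \<le> 1 / 4" "real M' * (1 / 3) ^ s \<le> 1 / 4"
  shows "avg terms (\<lambda>T. avg clauses (\<lambda>C. avg yes_secrets (\<lambda>\<kappa>. accepts P (hard T C dictator \<kappa>))))
    \<le> avg terms (\<lambda>T. avg clauses (\<lambda>C. avg no_secrets (\<lambda>\<kappa>. accepts P (hard T C antidictator \<kappa>))))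
      + (2 * gap w Q + ((1 + exp (- real w / 4)) ^ Q - 1))"
proof -
  have swap: "avg terms (\<lambda>T. avg clauses (\<lambda>C. avg K (\<lambda>\<kappa>. accepts P (hard T C h \<kappa>))))
    = (\<integral>t. avg terms (\<lambda>T. avg clauses (\<lambda>C. avg K (\<lambda>\<kappa>. of_bool (eval_tree t (hard T C h \<kappa>))))) \<partial>measure_pmf P)" for K h
    unfolding accepts_integral
    by (subst avg_integral avg_integral, intro integrable_of_bool_pmf integrable_avg)+ simp
  have "(\<integral>t. avg terms (\<lambda>T. avg clauses (\<lambda>C. avg yes_secrets (\<lambda>\<kappa>. of_bool (eval_tree t (hard T C dictator \<kappa>))))) \<partial>measure_pmf P)
    \<le> (\<integral>t. avg terms (\<lambda>T. avg clauses (\<lambda>C. avg no_secrets (\<lambda>\<kappa>. of_bool (eval_tree t (hard T C antidictator \<kappa>)))))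
        + (2 * gap w Q + ((1 + exp (- real w / 4)) ^ Q - 1)) \<partial>measure_pmf P)"
  proof (rule integral_mono_AE)
    show "AE t in measure_pmf P. avg terms (\<lambda>T. avg clauses (\<lambda>C. avg yes_secrets (\<lambda>\<kappa>. of_bool (eval_tree t (hard T C dictator \<kappa>)))))
      \<le> avg terms (\<lambda>T. avg clauses (\<lambda>C. avg no_secrets (\<lambda>\<kappa>. of_bool (eval_tree t (hard T C antidictator \<kappa>)))))
        + (2 * gap w Q + ((1 + exp (- real w / 4)) ^ Q - 1))"
    proof (rule AE_pmfI)
      fix t assume "t \<in> set_pmf P"
      from indistinguishable[OF t[OF this] w M]
      show "avg terms (\<lambda>T. avg clauses (\<lambda>C. avg yes_secrets (\<lambda>\<kappa>. of_bool (eval_tree t (hard T C dictator \<kappa>)))))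
        \<le> avg terms (\<lambda>T. avg clauses (\<lambda>C. avg no_secrets (\<lambda>\<kappa>. of_bool (eval_tree t (hard T C antidictator \<kappa>)))))
          + (2 * gap w Q + ((1 + exp (- real w / 4)) ^ Q - 1))"
        by (simp only: add.assoc)
    qed
  qed (intro integrable_of_bool_pmf integrable_avg Bochner_Integration.integrable_add measure_pmf.integrable_const)+
  also have "\<dots> = (\<integral>t. avg terms (\<lambda>T. avg clauses (\<lambda>C. avg no_secrets (\<lambda>\<kappa>. of_bool (eval_tree t (hard T C antidictator \<kappa>))))) \<partial>measure_pmf P)
      + (2 * gap w Q + ((1 + exp (- real w / 4)) ^ Q - 1))"
    by (subst Bochner_Integration.integral_add) (intro integrable_of_bool_pmf integrable_avg measure_pmf.integrable_const | simp)+
  finally show ?thesis unfolding swap .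
qed

text \<open>A trial in \<open>region\<close> succeeds with probability at least 1/16, whence the
  15/16.\<close>

lemma tester_accept_close:
  assumes f: "ones n f \<subseteq> region" "layer_size * 2 ^ e \<le> 8 * card (ones n f)"
    and q: "\<And>b q. (b, q) \<in> set_pmf (run n f A) \<Longrightarrow> q \<le> d"
  shows "\<bar>accepts (bind_pmf A (\<lambda>t. sim region L t d)) f - accept_prob n f A\<bar> \<le> real d * (15 / 16) ^ L"
proof -
  have O: "0 < card (ones n f)"
    using f(2) layer_size_pos by (cases "card (ones n f) = 0") auto
  then have ne: "region \<noteq> {}" using f(1) by auto
  have "card region \<le> 16 * card (ones n f)" using card_region_le f(2) by linarith
  then have \<theta>: "1 / 16 * real (card region) \<le> real (card (ones n f))" by simp
  have "\<bar>accepts (sim region L t d) f - tree_accept n f t\<bar> \<le> real d * (1 - 1 / 16) ^ L" if t: "t \<in> set_pmf A" for t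
  proof (rule sim_error[OF finite_region ne region_subset_cube f(1) _ \<theta>])
    fix b q' assume "(b, q') \<in> set_pmf (run_tree n f t)"
    then show "q' \<le> d" using t by (intro q[of b]) (auto simp: run_def)
  qed simp
  then have close: "\<bar>accepts (sim region L t d) f - tree_accept n f t\<bar> \<le> real d * (15 / 16) ^ L" if "t \<in> set_pmf A" for t
    using that by simp
  have int: "integrable (measure_pmf A) (\<lambda>t. accepts (sim region L t d) f)" "integrable (measure_pmf A) (\<lambda>t. tree_accept n f t)"
    by (auto intro!: measure_pmf.integrable_const_bound[where B = 1] simp: accepts_nonneg accepts_le_1 tree_accept_def)
  have "accepts (bind_pmf A (\<lambda>t. sim region L t d)) f - accept_prob n f A
      = (\<integral>t. accepts (sim region L t d) f - tree_accept n f t \<partial>measure_pmf A)"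
    unfolding accepts_bind accept_prob_integral using int by simp
  moreover have "(\<integral>t. accepts (sim region L t d) f - tree_accept n f t \<partial>measure_pmf A) \<le> real d * (15 / 16) ^ L"
    by (rule measure_pmf.integral_le_const) (use int close in \<open>auto intro!: AE_pmfI simp: abs_le_iff\<close>)
  moreover have "- (real d * (15 / 16) ^ L) \<le> (\<integral>t. accepts (sim region L t d) f - tree_accept n f t \<partial>measure_pmf A)"
    by (rule measure_pmf.integral_ge_const) (use int close in \<open>force intro!: AE_pmfI simp: abs_le_iff\<close>)+
  ultimately show ?thesis by (simp add: abs_le_iff)
qed

end

context hard_instance
begin

text \<open>With few queries the amplified tester would accept dictators with probability near 1,
  hence also antidictators on average, although a fraction of at least 1/2048 of these is far. The
  error 1/10000 is chosen because it enters three times and 3/10000 is below 1/2048.\<close>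

lemma tester_makes_queries:
  fixes A :: algorithm and a b t :: real and d L r w :: nat
  defines "F \<equiv> functions_of_size n a b" and "Q \<equiv> 3 ^ r * (L * d)"
  assumes M: "1 / 8 \<le> real M * (2 / 3) ^ s" "real M * (2 / 3) ^ s \<le> 1 / 4"
    and M': "1 / 8 \<le> real M' * (1 / 3) ^ s" "real M' * (1 / 3) ^ s \<le> 1 / 4"
    and size: "8 * a \<le> real (layer_size * 2 ^ e)" "real (2 * layer_size * 2 ^ e) \<le> b"
    and tester: "monotonicity_tester n F (1 / 4096) A"
    and d: "\<And>q. real q < t \<Longrightarrow> q \<le> d"
    and L: "1 \<le> L" "real d * (15 / 16) ^ L \<le> 1 / 100"
    and depth: "\<And>p d t. (\<And>t. t \<in> set_pmf p \<Longrightarrow> mq_only t d) \<Longrightarrow> t \<in> set_pmf ((maj3 ^^ r) p) \<Longrightarrow> mq_only t (3 ^ r * d)"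
    and amp_yes: "\<And>p d f. (\<And>t. t \<in> set_pmf p \<Longrightarrow> mq_only t d) \<Longrightarrow> 13 / 20 \<le> accepts p f \<Longrightarrow> 1 - 1 / 10000 \<le> accepts ((maj3 ^^ r) p) f"
    and amp_no: "\<And>p d f. (\<And>t. t \<in> set_pmf p \<Longrightarrow> mq_only t d) \<Longrightarrow> accepts p f \<le> 7 / 20 \<Longrightarrow> accepts ((maj3 ^^ r) p) f \<le> 1 / 10000"
    and w: "1 \<le> w" "2 * gap w Q + ((1 + exp (- real w / 4)) ^ Q - 1) \<le> 1 / 10000"
  shows "makes_queries n F (1 / 4096) A t"
proof (rule ccontr)
  assume few: "\<not> makes_queries n F (1 / 4096) A t"
  define p where "p = bind_pmf A (\<lambda>t. sim region L t d)"
  define P where "P = (maj3 ^^ r) p"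
  have p: "mq_only t (L * d)" if "t \<in> set_pmf p" for t
    using that mq_only_sim[OF L(1)] unfolding p_def by auto
  have P: "mq_only t Q" if "t \<in> set_pmf P" for t
    using depth[OF p] that unfolding P_def Q_def by blast
  have F: "hard T C h \<kappa> \<in> F" for T C h \<kappa>
  proof -
    have "real (layer_size * 2 ^ e) \<le> real (8 * card (ones n (hard T C h \<kappa>)))"
      using card_ones_hard_ge by (simp only: of_nat_le_iff)
    moreover have "real (card (ones n (hard T C h \<kappa>))) \<le> real (2 * layer_size * 2 ^ e)"
      using card_ones_hard_le by (simp only: of_nat_le_iff)
    ultimately show ?thesis
      unfolding F_def functions_of_size_def using size hard_in_boolean_functions by simp
  qed
  \<comment> \<open>The bound \<open>d\<close> on the calls is known for monotone or far inputs
    only.\<close>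
  have close: "\<bar>accepts p (hard T C h \<kappa>) - accept_prob n (hard T C h \<kappa>) A\<bar> \<le> 1 / 100"
    if adm: "hard T C h \<kappa> \<in> monotone_functions n \<union> far_from_monotone n (1 / 4096)" for T C h \<kappa>
  proof -
    have "q \<le> d" if "(b', q) \<in> set_pmf (run n (hard T C h \<kappa>) A)" for b' q
    proof (rule d)
      show "real q < t"
        using few F[of T C h \<kappa>] adm that unfolding makes_queries_def by (fastforce simp: not_le)
    qed
    then have "\<bar>accepts p (hard T C h \<kappa>) - accept_prob n (hard T C h \<kappa>) A\<bar> \<le> real d * (15 / 16) ^ L"
      unfolding p_def by (intro tester_accept_close ones_hard_subset_region card_ones_hard_ge)
    then show ?thesis using L(2) by linarith
  qed
  have yes: "1 - 1 / 10000 \<le> accepts P (hard T C dictator \<kappa>)" for T C \<kappa>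
  proof -
    have "2 / 3 \<le> accept_prob n (hard T C dictator \<kappa>) A"
      using tester dictator_monotone F unfolding monotonicity_tester_def by blast
    moreover have "\<bar>accepts p (hard T C dictator \<kappa>) - accept_prob n (hard T C dictator \<kappa>) A\<bar> \<le> 1 / 100"
      using dictator_monotone by (intro close) blast
    ultimately have acc: "13 / 20 \<le> accepts p (hard T C dictator \<kappa>)"
      unfolding abs_le_iff by linarith
    show ?thesis unfolding P_def by (rule amp_yes[of p "L * d", OF _ acc]) (rule p)
  qed
  \<comment> \<open>Antidictators that are not far carry no guarantee, so their acceptance is
    bounded by 1.\<close>
  have no: "accepts P (hard T C antidictator \<kappa>)
      \<le> 1 + 1 / 10000 - of_bool (hard T C antidictator \<kappa> \<in> far_from_monotone n (1 / 4096))" for T C \<kappa>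
  proof (cases "hard T C antidictator \<kappa> \<in> far_from_monotone n (1 / 4096)")
    case True
    then have "2 / 3 \<le> reject_prob n (hard T C antidictator \<kappa>) A"
      using tester F unfolding monotonicity_tester_def by blast
    moreover have "\<bar>accepts p (hard T C antidictator \<kappa>) - accept_prob n (hard T C antidictator \<kappa>) A\<bar> \<le> 1 / 100"
      using True by (intro close) blast
    ultimately have acc: "accepts p (hard T C antidictator \<kappa>) \<le> 7 / 20"
      unfolding abs_le_iff reject_prob_conv by linarith
    have "accepts P (hard T C antidictator \<kappa>) \<le> 1 / 10000"
      unfolding P_def by (rule amp_no[of p "L * d", OF _ acc]) (rule p)
    then show ?thesis using True by simp
  next
    case False
    then show ?thesis using accepts_le_1[of P "hard T C antidictator \<kappa>"] by simp
  qed
  have const: "avg terms (\<lambda>_. c) = c" "avg clauses (\<lambda>_. c) = c" "avg yes_secrets (\<lambda>_. c) = c" "avg no_secrets (\<lambda>_. c) = c" for c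
    by (rule avg_const; fact families_finite families_nonempty)+
  have "1 - 1 / 10000 = avg terms (\<lambda>T. avg clauses (\<lambda>C. avg yes_secrets (\<lambda>\<kappa>. 1 - 1 / 10000)))"
    unfolding const ..
  also have "\<dots> \<le> avg terms (\<lambda>T. avg clauses (\<lambda>C. avg yes_secrets (\<lambda>\<kappa>. accepts P (hard T C dictator \<kappa>))))"
    by (intro avg_mono yes)
  also have "\<dots> \<le> avg terms (\<lambda>T. avg clauses (\<lambda>C. avg no_secrets (\<lambda>\<kappa>. accepts P (hard T C antidictator \<kappa>))))
      + (2 * gap w Q + ((1 + exp (- real w / 4)) ^ Q - 1))"
    by (rule indistinguishable_pmf[OF P w(1) M(2) M'(2)])
  also have "\<dots> \<le> avg terms (\<lambda>T. avg clauses (\<lambda>C. avg no_secrets (\<lambda>\<kappa>. accepts P (hard T C antidictator \<kappa>)))) + 1 / 10000"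
    using w(2) by (rule add_left_mono)
  also have "\<dots> \<le> avg terms (\<lambda>T. avg clauses (\<lambda>C. avg no_secrets (\<lambda>\<kappa>. 1 + 1 / 10000
      - of_bool (hard T C antidictator \<kappa> \<in> far_from_monotone n (1 / 4096))))) + 1 / 10000"
    by (intro add_right_mono avg_mono no)
  also have "\<dots> = 1 + 1 / 10000 - avg terms (\<lambda>T. avg clauses (\<lambda>C. avg no_secrets (\<lambda>\<kappa>.
      of_bool (hard T C antidictator \<kappa> \<in> far_from_monotone n (1 / 4096))))) + 1 / 10000"
    unfolding avg_diff const ..
  finally show False using prob_far_ge[OF M M'] by linarith
qed

end

section \<open>Choice of parameters\<close>

lemma floor_quarter_bounds:
  fixes x :: real
  assumes "8 \<le> x"
  shows "1 / 8 \<le> real (nat \<lfloor>x / 4\<rfloor>) * (1 / x)" "real (nat \<lfloor>x / 4\<rfloor>) * (1 / x) \<le> 1 / 4"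
proof -
  have f: "real (nat \<lfloor>x / 4\<rfloor>) = of_int \<lfloor>x / 4\<rfloor>" using assms by simp
  have "of_int \<lfloor>x / 4\<rfloor> \<le> x / 4" "x / 4 - 1 \<le> of_int \<lfloor>x / 4\<rfloor>" by linarith+
  then have "x / 8 \<le> real (nat \<lfloor>x / 4\<rfloor>)" "real (nat \<lfloor>x / 4\<rfloor>) \<le> x / 4"
    unfolding f using assms by linarith+
  then show "1 / 8 \<le> real (nat \<lfloor>x / 4\<rfloor>) * (1 / x)" "real (nat \<lfloor>x / 4\<rfloor>) * (1 / x) \<le> 1 / 4"
    using assms by (auto simp: field_simps)
qed

lemma power_minus_one_le:
  fixes \<epsilon> :: real
  assumes "0 \<le> \<epsilon>" "real Q * \<epsilon> \<le> 1"
  shows "(1 + \<epsilon>) ^ Q - 1 \<le> 2 * (real Q * \<epsilon>)"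
proof -
  have "(1 + \<epsilon>) ^ Q \<le> exp \<epsilon> ^ Q" using assms by (intro power_mono exp_ge_add_one_self) auto
  also have "\<dots> = exp (real Q * \<epsilon>)" by (simp add: exp_of_nat_mult)
  also have "\<dots> \<le> 1 + real Q * \<epsilon> + (real Q * \<epsilon>)\<^sup>2" by (rule exp_bound) (use assms in auto)
  also have "(real Q * \<epsilon>)\<^sup>2 \<le> real Q * \<epsilon>"
    unfolding power2_eq_square using assms by (intro mult_left_le) auto
  finally show ?thesis by linarith
qed

lemma eventually_le_of_tendsto_0:
  fixes X :: "'a \<Rightarrow> real"
  assumes "(X \<longlongrightarrow> 0) G" "0 < c"
  shows "\<forall>\<^sub>F u in G. X u \<le> c"
  using order_tendstoD(2)[OF assms] by (rule eventually_mono) simp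

text \<open>\<open>u\<close> stands for the logarithm of \<open>N\<close>, and \<open>q u\<close>
  bounds the queries after simulation and amplification. It has order
  \<open>u^(2/3) / log u\<close>, so the gap has order \<open>1 / sqrt (log u)\<close>; this is why
  the square of the logarithm appears.\<close>

lemma asymptotic_parameters:
  fixes R \<rho> :: real
  assumes "1 \<le> R" "0 < \<rho>"
  defines "q \<equiv> \<lambda>u. R * ((33 * log 2 u) * (u powr (2 / 3) / log 2 u ^ 2))"
  shows "\<forall>\<^sub>F u in at_top. 2 * ((q u + 54 * log 2 u * (q u * sqrt (q u))) / (\<rho> * u)) \<le> 1 / 20000"
    and "\<forall>\<^sub>F u in at_top. 2 * (q u * u powr (-2)) \<le> 1 / 20000"
    and "\<forall>\<^sub>F u in at_top. u powr (2 / 3) / log 2 u ^ 2 * u powr (-2) \<le> 1 / 100"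
    and "\<forall>\<^sub>F u in at_top. 16 \<le> \<rho> * u \<and> 2 \<le> u \<and> 1 \<le> log 2 u"
proof -
  have R: "R > 0" using assms by simp
  have q: "q = (\<lambda>u. R * 33 * (u powr (2 / 3) / log 2 u))"
    unfolding q_def by (simp add: power2_eq_square fun_eq_iff)
  have "((\<lambda>u. 2 * ((q u + 54 * log 2 u * (q u * sqrt (q u))) / (\<rho> * u))) \<longlongrightarrow> 0) at_top"
    unfolding q using R assms(2) by real_asymp
  then show "\<forall>\<^sub>F u in at_top. 2 * ((q u + 54 * log 2 u * (q u * sqrt (q u))) / (\<rho> * u)) \<le> 1 / 20000"
    by (rule eventually_le_of_tendsto_0) simp
  have "((\<lambda>u. 2 * (q u * u powr (-2))) \<longlongrightarrow> 0) at_top"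
    unfolding q using R assms(2) by real_asymp
  then show "\<forall>\<^sub>F u in at_top. 2 * (q u * u powr (-2)) \<le> 1 / 20000"
    by (rule eventually_le_of_tendsto_0) simp
  show "\<forall>\<^sub>F u::real in at_top. u powr (2 / 3) / log 2 u ^ 2 * u powr (-2) \<le> 1 / 100"
    by real_asymp
  show "\<forall>\<^sub>F u in at_top. 16 \<le> \<rho> * u \<and> 2 \<le> u \<and> 1 \<le> log 2 u"
    using assms(2) by (intro eventually_conj) real_asymp+
qed

text \<open>All constants are absolute; only the threshold \<open>N\<^sub>0\<close> depends on
  \<open>\<alpha>\<^sub>0\<close>.\<close>

theorem theorem1p3:
  fixes \<alpha>\<^sub>0 :: real
  assumes "\<alpha>\<^sub>0 < 1"
  shows "\<exists>\<epsilon>\<^sub>0 > 0. \<exists>c\<^sub>1 > 0. \<exists>c\<^sub>2 > 0. \<exists>C > 0. \<exists>k :: nat. \<exists>N\<^sub>0 :: nat.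
    \<forall>N \<ge> N\<^sub>0. \<forall>n :: nat. real N \<le> 2 powr (\<alpha>\<^sub>0 * real n) \<longrightarrow>
      (\<forall>A :: algorithm.
        monotonicity_tester n (functions_of_size n (c\<^sub>1 * real N) (c\<^sub>2 * real N)) \<epsilon>\<^sub>0 A \<longrightarrow>
        makes_queries n (functions_of_size n (c\<^sub>1 * real N) (c\<^sub>2 * real N)) \<epsilon>\<^sub>0 A
          (C * log 2 (real N) powr (2 / 3) / log 2 (log 2 (real N)) ^ k))"
proof -
  obtain r :: nat where
    depth: "\<And>p d t. (\<And>t. t \<in> set_pmf p \<Longrightarrow> mq_only t d) \<Longrightarrow> t \<in> set_pmf ((maj3 ^^ r) p) \<Longrightarrow> mq_only t (3 ^ r * d)"
    and amp_yes: "\<And>p d f. (\<And>t. t \<in> set_pmf p \<Longrightarrow> mq_only t d) \<Longrightarrow> 13 / 20 \<le> accepts p f \<Longrightarrow> 1 - 1 / 10000 \<le> accepts ((maj3 ^^ r) p) f"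
    and amp_no: "\<And>p d f. (\<And>t. t \<in> set_pmf p \<Longrightarrow> mq_only t d) \<Longrightarrow> accepts p f \<le> 7 / 20 \<Longrightarrow> accepts ((maj3 ^^ r) p) f \<le> 1 / 10000"
    using amplification[of "1 / 10000"] by auto
  define R :: real where "R = 3 ^ r"
  \<comment> \<open>Makes \<open>6 * s\<close> at most
    \<open>(1 - \<alpha>\<^sub>0) * log 2 N\<close>, which leaves room for the free coordinates, at
    most \<open>log 2 N \<le> \<alpha>\<^sub>0 * n\<close> in number.\<close>
  define \<rho> where "\<rho> = (1 - \<alpha>\<^sub>0) / 6"
  define q where "q = (\<lambda>u. R * ((33 * log 2 u) * (u powr (2 / 3) / log 2 u ^ 2)))"
  have R1: "1 \<le> R" and \<rho>: "0 < \<rho>" unfolding R_def \<rho>_def using assms by auto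
  have "\<forall>\<^sub>F u in at_top. 2 * ((q u + 54 * log 2 u * (q u * sqrt (q u))) / (\<rho> * u)) \<le> 1 / 20000
    \<and> 2 * (q u * u powr (-2)) \<le> 1 / 20000
    \<and> u powr (2 / 3) / log 2 u ^ 2 * u powr (-2) \<le> 1 / 100
    \<and> 16 \<le> \<rho> * u \<and> 2 \<le> u \<and> 1 \<le> log 2 u"
    unfolding q_def using asymptotic_parameters[OF R1 \<rho>] by (simp only: eventually_conj_iff)
  then obtain u0 where u0: "\<And>u. u0 \<le> u \<Longrightarrow> 2 * ((q u + 54 * log 2 u * (q u * sqrt (q u))) / (\<rho> * u)) \<le> 1 / 20000
    \<and> 2 * (q u * u powr (-2)) \<le> 1 / 20000
    \<and> u powr (2 / 3) / log 2 u ^ 2 * u powr (-2) \<le> 1 / 100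
    \<and> 16 \<le> \<rho> * u \<and> 2 \<le> u \<and> 1 \<le> log 2 u"
    unfolding eventually_at_top_linorder by blast
  have main: "makes_queries n (functions_of_size n (1 / 16 * real N) (2 * real N)) (1 / 4096) A
      (1 * log 2 (real N) powr (2 / 3) / log 2 (log 2 (real N)) ^ 2)"
    if N: "nat \<lceil>2 powr u0\<rceil> \<le> N" and Nn: "real N \<le> 2 powr (\<alpha>\<^sub>0 * real n)"
      and tester: "monotonicity_tester n (functions_of_size n (1 / 16 * real N) (2 * real N)) (1 / 4096) A"
    for N n :: nat and A
  proof -
    define u where "u = log 2 (real N)"
    define l where "l = log 2 u"
    define t where "t = u powr (2 / 3) / l ^ 2"
    have "2 powr u0 \<le> real N" using N by linarith
    moreover have Npos: "0 < real N" using \<open>2 powr u0 \<le> real N\<close> by (rule less_le_trans[rotated]) simp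
    ultimately have "u0 \<le> u" unfolding u_def by (simp add: le_log_iff)
    note u = u0[OF this, folded l_def, folded t_def]
    have uN: "2 powr u = real N" unfolding u_def using Npos by simp
    have u_le: "u \<le> \<alpha>\<^sub>0 * real n" using Nn uN by (metis one_less_numeral_iff powr_le_cancel_iff semiring_norm(76))
    \<comment> \<open>Otherwise the size bound would force \<open>N \<le> 1\<close>.\<close>
    have \<alpha>: "0 < \<alpha>\<^sub>0"
    proof (rule ccontr)
      assume "\<not> 0 < \<alpha>\<^sub>0"
      then have "\<alpha>\<^sub>0 * real n \<le> 0" by (simp add: mult_nonpos_nonneg)
      then show False using u_le u by linarith
    qed
    have un: "u \<le> real n" using u_le mult_right_mono[of \<alpha>\<^sub>0 1 "real n"] assms by simp
    define s where "s = nat \<lfloor>\<rho> * u\<rfloor>"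
    have s: "real s \<le> \<rho> * u" "\<rho> * u - 1 \<le> real s"
      unfolding s_def using u by linarith+
    then have s8: "8 \<le> s" "\<rho> * u \<le> 2 * real s" using u by linarith+
    define B where "B = (6 * s choose (4 * s))"
    have B: "0 < B" unfolding B_def by simp
    have s6: "real (6 * s) \<le> (1 - \<alpha>\<^sub>0) * u" using s(1) unfolding \<rho>_def by simp
    also have s6u: "\<dots> \<le> 1 * u" using \<alpha> u by (intro mult_right_mono) auto
    finally have "2 powr real (6 * s) \<le> real N" unfolding uN[symmetric] by simp
    then have "real (2 ^ (6 * s)) \<le> real N" by (simp only: powr_realpow[of 2] of_nat_power of_nat_numeral)
    then have "2 ^ (6 * s) \<le> N" by (simp only: of_nat_le_iff)
    then have BN: "B \<le> N" using binomial_le_pow2[of "6 * s" "4 * s"] unfolding B_def by linarith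
    then have "1 \<le> N div B" using B by (simp add: Suc_le_eq div_greater_zero_iff)
    \<comment> \<open>The largest \<open>e\<close> with \<open>B * 2 ^ e \<le> N\<close>, so that
      \<open>B * 2 ^ e\<close> lies between \<open>N / 2\<close> and \<open>N\<close>.\<close>
    then obtain e where e: "2 ^ e \<le> N div B" "N div B < 2 ^ (e + 1)"
      using ex_power_ivl1[of 2 "N div B"] by auto
    have Be: "B * 2 ^ e \<le> N"
      using mult_le_mono2[OF e(1), of B] times_div_less_eq_dividend[of B N] by linarith
    have NB: "N < B * 2 ^ (e + 1)"
      using e(2) B by (simp add: div_less_iff_less_mult mult.commute)
    have "2 ^ e \<le> N" using Be B by (metis One_nat_def Suc_leI le_trans mult_le_mono1 nat_mult_1)
    then have "real (2 ^ e) \<le> real N" by (simp only: of_nat_le_iff)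
    then have "2 powr real e \<le> 2 powr u" unfolding uN by (simp add: powr_realpow)
    then have eu: "real e \<le> u" by simp
    have "(1 - \<alpha>\<^sub>0) * u \<le> (1 - \<alpha>\<^sub>0) * real n" using un assms by (intro mult_left_mono) auto
    then have "real (6 * s) + real e \<le> real n" using s6 eu u_le by (simp add: algebra_simps)
    then have fits: "6 * s + e \<le> n" by linarith
    \<comment> \<open>A quarter of the inverse probability that a term is satisfied, respectively a
      clause falsified, at weight \<open>4 * s\<close>.\<close>
    define M where "M = nat \<lfloor>(3 / 2) ^ s / 4 :: real\<rfloor>"
    define M' where "M' = nat \<lfloor>3 ^ s / 4 :: real\<rfloor>"
    interpret hard_instance s M M' n e
      by unfold_locales (use s8 fits in auto)
    have "(8::real) \<le> (3 / 2) ^ 8" by (simp add: power_divide)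
    also have "\<dots> \<le> (3 / 2) ^ s" using s8 by (intro power_increasing) auto
    finally have b1: "(8::real) \<le> (3 / 2) ^ s" .
    also have "(3 / 2 :: real) ^ s \<le> 3 ^ s" by (intro power_mono) auto
    finally have b2: "(8::real) \<le> 3 ^ s" .
    have inv: "1 / (3 / 2 :: real) ^ s = (2 / 3) ^ s" "1 / (3 :: real) ^ s = (1 / 3) ^ s"
      by (simp_all add: power_divide)
    have M: "1 / 8 \<le> real M * (2 / 3) ^ s" "real M * (2 / 3) ^ s \<le> 1 / 4"
      and M': "1 / 8 \<le> real M' * (1 / 3) ^ s" "real M' * (1 / 3) ^ s \<le> 1 / 4"
      unfolding M_def M'_def inv[symmetric] by (rule floor_quarter_bounds b1 b2)+
    define d where "d = nat \<lfloor>t\<rfloor>"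
    \<comment> \<open>The factors 32 and 8 make \<open>(15 / 16) ^ L\<close> and
      \<open>exp (- real w / 4)\<close> at most \<open>u powr (-2)\<close>, which beats the number
      of queries.\<close>
    define L where "L = nat \<lceil>32 * l\<rceil>"
    define w where "w = nat \<lceil>8 * l\<rceil>"
    define Q where "Q = 3 ^ r * (L * d)"
    have t0: "0 \<le> t" unfolding t_def by simp
    have d: "real d \<le> t" unfolding d_def using t0 by linarith
    have L: "32 * l \<le> real L" "real L \<le> 33 * l" "1 \<le> L" unfolding L_def using u by linarith+
    have w: "8 * l \<le> real w" "real w \<le> 9 * l" "1 \<le> w" unfolding w_def using u by linarith+
    have "real Q = R * (real L * real d)" unfolding Q_def R_def by simp
    also have "\<dots> \<le> R * ((33 * l) * t)" using L d R1 u by (intro mult_left_mono mult_mono) auto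
    finally have Q: "real Q \<le> q u" unfolding q_def t_def l_def .
    have "2 * gap w Q \<le> 2 * ((q u + 54 * l * (q u * sqrt (q u))) / (\<rho> * u))"
    proof -
      have qu: "0 \<le> q u" using Q of_nat_0_le_iff order_trans by blast
      have "6 * real w \<le> 54 * l" "real Q * sqrt (real Q) \<le> q u * sqrt (q u)"
        using w Q qu by (auto intro!: mult_mono)
      then have "6 * real w * (real Q * sqrt (real Q)) \<le> 54 * l * (q u * sqrt (q u))"
        using u by (intro mult_mono[of "6 * real w" "54 * l"]) auto
      with Q have num: "real Q + 6 * real w * (real Q * sqrt (real Q)) \<le> q u + 54 * l * (q u * sqrt (q u))"
        by (rule add_mono)
      show ?thesis
        unfolding gap_def by (intro mult_left_mono frac_le num) (use qu s8 u in auto)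
    qed
    then have g: "2 * gap w Q \<le> 1 / 20000" using u by linarith
    have ln_le_l: "ln u \<le> l"
    proof -
      have "ln u * ln 2 \<le> ln u * 1" using u ln_2_less_1 by (intro mult_left_mono) auto
      then show ?thesis unfolding l_def log_def by (simp add: le_divide_eq)
    qed
    have "exp (- real w / 4) \<le> u powr (-2)"
    proof -
      have "- real w / 4 \<le> -2 * ln u" using w(1) ln_le_l by linarith
      then show ?thesis using u by (simp add: powr_def)
    qed
    then have "real Q * exp (- real w / 4) \<le> q u * u powr (-2)" using Q by (intro mult_mono) auto
    then have \<epsilon>: "real Q * exp (- real w / 4) \<le> 1 / 40000" using u by linarith
    have "(1 + exp (- real w / 4)) ^ Q - 1 \<le> 2 * (real Q * exp (- real w / 4))"
      by (rule power_minus_one_le) (use \<epsilon> in auto)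
    then have wQ: "2 * gap w Q + ((1 + exp (- real w / 4)) ^ Q - 1) \<le> 1 / 10000"
      using g \<epsilon> by linarith
    have "(15 / 16 :: real) ^ L \<le> exp (- (1 / 16)) ^ L"
      using exp_ge_add_one_self[of "- (1 / 16)"] by (intro power_mono) auto
    also have "\<dots> = exp (- real L / 16)" by (simp add: exp_of_nat_mult[symmetric])
    also have "\<dots> \<le> exp (-2 * ln u)" using ln_le_l L(1) by simp
    also have "\<dots> = u powr (-2)" using u by (simp add: powr_def)
    finally have "real d * (15 / 16) ^ L \<le> t * u powr (-2)"
      using d t0 by (intro mult_mono) auto
    then have dL: "real d * (15 / 16) ^ L \<le> 1 / 100" using u by linarith
    \<comment> \<open>A hard function has at least \<open>B * 2 ^ e / 8 \<ge> N / 16\<close> and at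
      most \<open>2 * B * 2 ^ e \<le> 2 * N\<close> ones.\<close>
    have size: "8 * (1 / 16 * real N) \<le> real (B * 2 ^ e)" "real (2 * B * 2 ^ e) \<le> 2 * real N"
    proof -
      have "N \<le> 2 * (B * 2 ^ e)" using NB by simp
      then have "real N \<le> real (2 * (B * 2 ^ e))" by (simp only: of_nat_le_iff)
      then show "8 * (1 / 16 * real N) \<le> real (B * 2 ^ e)" by simp
      have "real (B * 2 ^ e) \<le> real N" using Be by (simp only: of_nat_le_iff)
      then show "real (2 * B * 2 ^ e) \<le> 2 * real N" by simp
    qed
    have "q' \<le> d" if "real q' < t" for q' :: nat
      using that unfolding d_def by linarith
    then have "makes_queries n (functions_of_size n (1 / 16 * real N) (2 * real N)) (1 / 4096) A t"
      by (rule tester_makes_queries[OF M M' size[unfolded B_def] tester _ L(3) dL depth amp_yes amp_no w(3) wQ[unfolded Q_def]])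
    then show ?thesis unfolding t_def l_def u_def by simp
  qed
  show ?thesis
    by (rule exI[of _ "1 / 4096"], rule conjI, simp, rule exI[of _ "1 / 16"], rule conjI, simp,
        rule exI[of _ 2], rule conjI, simp, rule exI[of _ 1], rule conjI, simp,
        rule exI[of _ 2], rule exI[of _ "nat \<lceil>2 powr u0\<rceil>"]) (use main in blast)
qed

end
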